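(* There is a universal constant $c>0$ such that the following holds. Let $0<\varepsilon<1$, $0<\delta<1/5$, $2\le s\le2^{d+1}$, let $\Lambda=\Lambda^{\mathrm{HC}}_{d,s}$ be the hyperbolic cross, and let $\{\phi_{\boldsymbol i}\}_{\boldsymbol i\in\mathbb N_0^d}$ be the tensor Legendre or tensor Chebyshev polynomial basis. Draw $\boldsymbol t_1,\dots,\boldsymbol t_m$ independently according to the corresponding measure $\nu$, with $$m\ \ge\ c\,s^\gamma L(s,n,\delta,\varepsilon).$$ Then, with probability at least $1-\varepsilon$, the following holds. For every $f\in L^2_\nu(D)\cap L^\infty(D)$ with coefficient sequence $\boldsymbol x$, every $\boldsymbol e\in\mathbb C^m\setminus\{\boldsymbol 0\}$ and data $\boldsymbol y=\boldsymbol A\boldsymbol x_\Lambda+\boldsymbol e$, the approximation $\tilde f=\sum_{\boldsymbol i\in\Lambda}\hat x_{\boldsymbol i}\phi_{\boldsymbol i}$ computed from a minimizer (weighted LASSO) $$\hat{\boldsymbol x}_\Lambda\in\arg\min_{\boldsymbol z\in\mathbb C^n}\|\boldsymbol z\|_{1,\boldsymbol u}+\lambda\|\boldsymbol A\boldsymbol z-\boldsymbol y\|_2^2$$ with tuning parameter $$\lambda=\theta\,\frac{\sqrt{K(s)}}{\|\boldsymbol e\|_2},\qquad\theta>0,$$ satisfies $$\|f-\tilde f\|_{L^\infty}\le C_1\,\sigma_{s,L}(\boldsymbol x)_{1,\boldsymbol u}+C_2\,s^{\gamma/2}\|\boldsymbol e\|_2,$$ $$\|f-\tilde f\|_{L^2_\nu}\le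 C_3\,\frac{\sigma_{s,L}(\boldsymbol x)_{1,\boldsymbol u}}{s^{\gamma/2}}+C_4\|\boldsymbol e\|_2+\|f-f_\Lambda\|_{L^2_\nu},$$ where, with $\rho=\frac{4\delta}{1-\delta}$ and $\tau=\frac{\sqrt{1+\delta}}{1-\delta}$, $$C_1=\frac{3+\rho}{1-\rho},\qquad C_2=\frac1{1-\rho}\left[\frac{\tau^2}{(1+\rho)\theta}+(1+\rho)\theta+2\tau\right],\qquad C_3=\frac{4(1+\rho)(2+\rho)}{1-\rho},$$ $$C_4=\frac1{1-\rho}\left[\frac{(5+\rho)^2\tau^2}{4(1+\rho)(2+\rho)\theta}+(1+\rho)(2+\rho)\theta+(5+\rho)\tau\right].$$
   Context: Setting. $d\in\mathbb N$, $D=(-1,1)^d$, $\mathbb N_0=\{0,1,2,\dots\}$. The measure $\nu$ on $D$ is the tensor uniform probability measure $d\nu=2^{-d}d\boldsymbol t$ (Legendre case) or the tensor Chebyshev measure $d\nu=\prod_{\ell=1}^d\frac{1}{\pi\sqrt{1-t_\ell^2}}d\boldsymbol t$ (Chebyshev case). $\{\phi_{\boldsymbol i}\}_{\boldsymbol i\in\mathbb N_0^d}$ is the tensor product of the corresponding univariate orthonormal polynomials; it is an orthonormal basis of $L^2_\nu(D)$. For $f\in L^2_\nu(D)\cap L^\infty(D)$ (complex valued), $\boldsymbol x=(x_{\boldsymbol i})_{\boldsymbol i\in\mathbb N_0^d}$ with $x_{\boldsymbol i}=\langle f,\phi_{\boldsymbol i}\rangle_{L^2_\nu}$, so $f=\sum_{\boldsymbol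 i}x_{\boldsymbol i}\phi_{\boldsymbol i}$. Weights: $u_{\boldsymbol i}=\|\phi_{\boldsymbol i}\|_{L^\infty}$, i.e. $u_{\boldsymbol i}=\prod_{\ell=1}^d\sqrt{2i_\ell+1}$ (Legendre) and $u_{\boldsymbol i}=2^{\|\boldsymbol i\|_0/2}$ (Chebyshev, $\|\boldsymbol i\|_0$ the number of nonzero entries). $\|\boldsymbol z\|_{1,\boldsymbol u}=\sum_{\boldsymbol i}u_{\boldsymbol i}|z_{\boldsymbol i}|$. For $S\subseteq\mathbb N_0^d$, $|S|_{\boldsymbol u}=\sum_{\boldsymbol i\in S}u_{\boldsymbol i}^2$. A set $S\subseteq\mathbb N_0^d$ is lower if $\boldsymbol i\in S$ and $\boldsymbol j\le\boldsymbol i$ componentwise imply $\boldsymbol j\in S$. $\sigma_{s,L}(\boldsymbol z)_{1,\boldsymbol u}=\inf\{\|\boldsymbol z-\boldsymbol z'\|_{1,\boldsymbol u}:|\mathrm{supp}(\boldsymbol z')|\le s,\ \mathrm{supp}(\boldsymbol z')\text{ lower}\}$ (possibly $+\infty$). $K(s)=\max\{|S|_{\boldsymbol u}:S\subseteq\mathbb N_0^d\text{ lower},\ |S|\le s\}$. $\gamma=2$ (Legendre), $\gamma=\ln 3/\ln 2$ (Chebyshev). Hyperbolic cross: $\Lambda^{\mathrm{HC}}_{d,s}=\{\boldsymbol i\in\mathbb N_0^d:\prod_{\ell=1}^d(i_\ell+1)\le s\}$, $n=|\Lambda|$, with a fixed enumeration $\boldsymbol i_1,\dots,\boldsymbol i_n$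 of $\Lambda$. Vectors in $\mathbb C^n$ are indexed by $\Lambda$ and identified with sequences on $\mathbb N_0^d$ vanishing off $\Lambda$. $\boldsymbol x_\Lambda=(x_{\boldsymbol i})_{\boldsymbol i\in\Lambda}$ and $f_\Lambda=\sum_{\boldsymbol i\in\Lambda}x_{\boldsymbol i}\phi_{\boldsymbol i}$. Design matrix: $\boldsymbol A\in\mathbb C^{m\times n}$, $A_{ij}=\frac1{\sqrt m}\phi_{\boldsymbol i_j}(\boldsymbol t_i)$. The data are $\boldsymbol y=\boldsymbol A\boldsymbol x_\Lambda+\boldsymbol e$, where the unknown error $\boldsymbol e$ contains the truncation error $\frac{1}{\sqrt m}(f(\boldsymbol t_i)-f_\Lambda(\boldsymbol t_i))_{i}$ and possibly any further error. Polylogarithmic factor: $$L(s,n,\delta,\varepsilon)=\frac1{\delta^2}\ln\Big(\frac{K(s)}{\delta^2}\Big)\max\Big\{\frac1{\delta^4}\ln\Big(\frac{K(s)}{\delta^2}\ln\Big(\frac{K(s)}{\delta^2}\Big)\Big)\ln(n),\ \frac1\delta\ln\Big(\frac1{\delta\varepsilon}\ln\Big(\frac{K(s)}{\delta^2}\Big)\Big)\Big\}.$$ *)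

theory Defs
  imports "HOL-Probability.Probability" "HOL-Probability.Essential_Supremum"
begin

section \<open>Tensor Legendre and Chebyshev polynomials on the cube\<close>

text \<open>
  The dimension is a natural number \<open>d\<close> over which the theorem quantifies (the constant in the
  sample complexity does not depend on it), so points and multi-indices are functions on the
  index set \<open>{..<d}\<close>, extensional as in \<open>PiE\<close> and \<open>PiM\<close>.
\<close>

datatype poly_family = Legendre | Chebyshev

text \<open>The univariate measure lives on the open interval, so that the space of \<open>nu b d\<close> is
  exactly the cube \<open>{..<d} \<rightarrow>\<^sub>E {-1<..<1}\<close>.\<close>

definition nu1 :: "poly_family \<Rightarrow> real measure" where
  "nu1 b = density (restrict_space lborel {-1<..<1})
     (\<lambda>t. ennreal (case b of Legendre \<Rightarrow> 1 / 2 | Chebyshev \<Rightarrow> 1 / (pi * sqrt (1 - t\<^sup>2))))"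

definition nu :: "poly_family \<Rightarrow> nat \<Rightarrow> (nat \<Rightarrow> real) measure" where
  "nu b d = PiM {..<d} (\<lambda>_. nu1 b)"

text \<open>The classical Legendre polynomials, normalised by \<open>P\<^sub>n(1) = 1\<close>, by Bonnet's recursion.\<close>

fun legendre :: "nat \<Rightarrow> real \<Rightarrow> real" where
  "legendre 0 t = 1"
| "legendre (Suc 0) t = t"
| "legendre (Suc (Suc n)) t =
     ((2 * real n + 3) * t * legendre (Suc n) t - (real n + 1) * legendre n t) / (real n + 2)"

text \<open>The univariate polynomials orthonormal with respect to \<open>nu1 b\<close>; on the interval,
  \<open>cos (n * arccos t)\<close> is the Chebyshev polynomial of the first kind.\<close>

definition phi1 :: "poly_family \<Rightarrow> nat \<Rightarrow> real \<Rightarrow> real" where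
  "phi1 b n t = (case b of
      Legendre \<Rightarrow> sqrt (2 * real n + 1) * legendre n t
    | Chebyshev \<Rightarrow> (if n = 0 then 1 else sqrt 2 * cos (real n * arccos t)))"

definition multi_idx :: "nat \<Rightarrow> (nat \<Rightarrow> nat) set" where
  "multi_idx d = ({..<d} \<rightarrow>\<^sub>E UNIV)"

definition phi :: "poly_family \<Rightarrow> nat \<Rightarrow> (nat \<Rightarrow> nat) \<Rightarrow> (nat \<Rightarrow> real) \<Rightarrow> real" where
  "phi b d i t = (\<Prod>l<d. phi1 b (i l) (t l))"

section \<open>Function spaces and expansions\<close>

definition Linf_norm :: "'a measure \<Rightarrow> ('a \<Rightarrow> complex) \<Rightarrow> ennreal" where
  "Linf_norm M g = esssup M (\<lambda>t. ennreal (cmod (g t)))"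

definition L2_norm :: "'a measure \<Rightarrow> ('a \<Rightarrow> complex) \<Rightarrow> real" where
  "L2_norm M g = sqrt (LINT t|M. (cmod (g t))\<^sup>2)"

definition L2_Linf :: "'a measure \<Rightarrow> ('a \<Rightarrow> complex) set" where
  "L2_Linf M = {g \<in> borel_measurable M. integrable M (\<lambda>t. (cmod (g t))\<^sup>2) \<and> Linf_norm M g < \<infinity>}"

text \<open>No conjugate is needed in the inner product, since the basis functions are real.\<close>

definition coeff_seq ::
  "poly_family \<Rightarrow> nat \<Rightarrow> ((nat \<Rightarrow> real) \<Rightarrow> complex) \<Rightarrow> (nat \<Rightarrow> nat) \<Rightarrow> complex" where
  "coeff_seq b d f i = (LINT t|nu b d. f t * complex_of_real (phi b d i t))"

definition expansion ::
  "poly_family \<Rightarrow> nat \<Rightarrow> (nat \<Rightarrow> nat) set \<Rightarrow> ((nat \<Rightarrow> nat) \<Rightarrow> complex) \<Rightarrow> (nat \<Rightarrow> real) \<Rightarrow> complex" where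
  "expansion b d I z t = (\<Sum>i\<in>I. z i * complex_of_real (phi b d i t))"

section \<open>Weights, lower sets and best lower approximation\<close>

definition weight :: "poly_family \<Rightarrow> nat \<Rightarrow> (nat \<Rightarrow> nat) \<Rightarrow> real" where
  "weight b d i = enn2real (Linf_norm (nu b d) (\<lambda>t. complex_of_real (phi b d i t)))"

definition wcard :: "poly_family \<Rightarrow> nat \<Rightarrow> (nat \<Rightarrow> nat) set \<Rightarrow> real" where
  "wcard b d S = (\<Sum>i\<in>S. (weight b d i)\<^sup>2)"

definition lower_set :: "nat \<Rightarrow> (nat \<Rightarrow> nat) set \<Rightarrow> bool" where
  "lower_set d S \<longleftrightarrow> S \<subseteq> multi_idx d \<and>
     (\<forall>i\<in>S. \<forall>j\<in>multi_idx d. (\<forall>l<d. j l \<le> i l) \<longrightarrow> j \<in> S)"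

text \<open>Sequences on \<open>multi_idx d\<close> are functions whose values elsewhere are ignored. The norm is
  extended-valued, so \<open>sigma_L\<close> may be infinite.\<close>

definition wl1_norm :: "poly_family \<Rightarrow> nat \<Rightarrow> ((nat \<Rightarrow> nat) \<Rightarrow> complex) \<Rightarrow> ennreal" where
  "wl1_norm b d z = (\<Sum>\<^sub>\<infinity>i\<in>multi_idx d. ennreal (weight b d i * cmod (z i)))"

definition supp :: "nat \<Rightarrow> ((nat \<Rightarrow> nat) \<Rightarrow> complex) \<Rightarrow> (nat \<Rightarrow> nat) set" where
  "supp d z = {i \<in> multi_idx d. z i \<noteq> 0}"

definition sigma_L :: "poly_family \<Rightarrow> nat \<Rightarrow> nat \<Rightarrow> ((nat \<Rightarrow> nat) \<Rightarrow> complex) \<Rightarrow> ennreal" where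
  "sigma_L b d s z = (INF z' \<in> {z'. finite (supp d z') \<and> card (supp d z') \<le> s \<and> lower_set d (supp d z')}.
     wl1_norm b d (\<lambda>i. z i - z' i))"

definition K :: "poly_family \<Rightarrow> nat \<Rightarrow> nat \<Rightarrow> real" where
  "K b d s = Max (wcard b d ` {S. lower_set d S \<and> finite S \<and> card S \<le> s})"

definition gamma_exp :: "poly_family \<Rightarrow> real" where
  "gamma_exp b = (case b of Legendre \<Rightarrow> 2 | Chebyshev \<Rightarrow> ln 3 / ln 2)"

definition hyperbolic_cross :: "nat \<Rightarrow> nat \<Rightarrow> (nat \<Rightarrow> nat) set" where
  "hyperbolic_cross d s = {i \<in> multi_idx d. (\<Prod>l<d. i l + 1) \<le> s}"

section \<open>Sampling and the weighted LASSO\<close>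

text \<open>Columns of the design matrix and the vectors it acts on are indexed by the multi-indices
  themselves instead of by an enumeration of \<open>I\<close>; rows by \<open>k < m\<close>.\<close>

definition design_matrix ::
  "poly_family \<Rightarrow> nat \<Rightarrow> nat \<Rightarrow> (nat \<Rightarrow> nat \<Rightarrow> real) \<Rightarrow> nat \<Rightarrow> (nat \<Rightarrow> nat) \<Rightarrow> complex" where
  "design_matrix b d m t k i = complex_of_real (phi b d i (t k) / sqrt (real m))"

definition mat_vec ::
  "(nat \<Rightarrow> nat) set \<Rightarrow> (nat \<Rightarrow> (nat \<Rightarrow> nat) \<Rightarrow> complex) \<Rightarrow> ((nat \<Rightarrow> nat) \<Rightarrow> complex) \<Rightarrow> nat \<Rightarrow> complex" where
  "mat_vec I A z k = (\<Sum>i\<in>I. A k i * z i)"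

definition l2_norm :: "nat \<Rightarrow> (nat \<Rightarrow> complex) \<Rightarrow> real" where
  "l2_norm m v = L2_set (\<lambda>k. cmod (v k)) {..<m}"

definition wlasso_minimizer ::
  "poly_family \<Rightarrow> nat \<Rightarrow> (nat \<Rightarrow> nat) set \<Rightarrow> nat \<Rightarrow> (nat \<Rightarrow> (nat \<Rightarrow> nat) \<Rightarrow> complex) \<Rightarrow>
   (nat \<Rightarrow> complex) \<Rightarrow> real \<Rightarrow> ((nat \<Rightarrow> nat) \<Rightarrow> complex) \<Rightarrow> bool" where
  "wlasso_minimizer b d I m A y lam = is_arg_min
     (\<lambda>z. (\<Sum>i\<in>I. weight b d i * cmod (z i)) + lam * (l2_norm m (\<lambda>k. mat_vec I A z k - y k))\<^sup>2)
     (\<lambda>z. \<forall>i. i \<notin> I \<longrightarrow> z i = 0)"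

text \<open>The polylogarithmic factor, with \<open>\<kappa>\<close> standing for \<open>K b d s\<close>.\<close>

definition polylog :: "real \<Rightarrow> nat \<Rightarrow> real \<Rightarrow> real \<Rightarrow> real" where
  "polylog \<kappa> n \<delta> \<epsilon> = 1 / \<delta>\<^sup>2 * ln (\<kappa> / \<delta>\<^sup>2) *
     max (1 / \<delta>^4 * ln (\<kappa> / \<delta>\<^sup>2 * ln (\<kappa> / \<delta>\<^sup>2)) * ln (real n))
         (1 / \<delta> * ln (1 / (\<delta> * \<epsilon>) * ln (\<kappa> / \<delta>\<^sup>2)))"

end

theory Submission
  imports Defs
begin

text \<open>Write \<open>\<parallel>z\<parallel>\<close> for the Euclidean norm, \<open>\<parallel>z\<parallel>\<^sub>u\<close> for the weighted \<open>l1\<close> norm and \<open>\<kappa> = K(s)\<close>. Everything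
rests on one property of the design matrix \<open>A\<close>, which holds with probability at least
\<open>1 - \<epsilon>\<close>: for all vectors \<open>z\<close> on the hyperbolic cross,
\<open>\<bar>\<parallel>A z\<parallel>\<^sup>2 - \<parallel>z\<parallel>\<^sup>2\<bar> \<le> \<delta>/2 \<parallel>z\<parallel>\<^sup>2 + \<delta>\<^sup>2/\<kappa> \<parallel>z\<parallel>\<^sub>u\<^sup>2\<close> (\<open>sampling_RIP\<close>). It plays the part of a
restricted isometry property, with the penalty \<open>\<parallel>z\<parallel>\<^sub>u\<^sup>2\<close> in place of sparsity.

Why it holds. Divided by their weights, the basis functions are bounded by 1, so
\<open>g = \<Sum>\<^sub>i z\<^sub>i \<phi>\<^sub>i\<close> is \<open>\<parallel>z\<parallel>\<^sub>u\<close> times an element of the symmetric convex hull of \<open>n\<close> functions with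
values in \<open>[-1, 1]\<close>, while \<open>\<parallel>A z\<parallel>\<^sup>2\<close> and \<open>\<parallel>z\<parallel>\<^sup>2\<close> are the empirical and the true mean of \<open>g\<^sup>2\<close>. The
claim is thus a uniform law of large numbers with a multiplicative error \<open>\<delta>\<close> and an additive
error \<open>\<eta>\<close> of order \<open>\<delta>\<^sup>2/\<kappa>\<close> over such a hull (\<open>uniform_square_deviation\<close>). It is proved by a dyadic
decomposition of \<open>g\<^sup>2\<close> into slices of height \<open>c/2\<close>, where \<open>c = 2\<^sup>-\<^sup>i\<close>. On the \<open>i\<close>-th slice
\<open>g\<close> may be replaced by an average of about \<open>2\<^sup>i d\<^sup>-\<^sup>2 ln(1/\<eta>)\<close> dictionary elements (with \<open>d\<close> a
fixed multiple of \<open>\<delta>\<close>), by Maurey's random choice (\<open>maurey_net\<close>): this is accurate up to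
\<open>d sqrt c\<close> outside a set of measure \<open>\<eta>\<close>. The number of these averages is the exponential
of \<open>2\<^sup>i d\<^sup>-\<^sup>2 ln(1/\<eta>) ln n\<close>; but the slice is bounded by \<open>c/2\<close>, so the Chernoff bound
(\<open>relative_chernoff\<close>) has exponent proportional to \<open>2\<^sup>i m\<close>. The factors \<open>2\<^sup>i\<close> cancel, and the
union bound costs the same on each of the \<open>ln(1/\<eta>)\<close> levels. The sample size that this demands
is at most a constant times the one in the theorem (\<open>sample_size_suffices\<close>).

Why it suffices. A lower set \<open>S\<close> with at most \<open>s\<close> elements lies in the hyperbolic cross and
has weighted cardinality at most \<open>\<kappa>\<close>, so \<open>\<parallel>z\<^sub>S\<parallel>\<^sub>u \<le> sqrt \<kappa> \<parallel>z\<^sub>S\<parallel>\<close>. Together with the isometry this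
is the null space property with constants \<open>\<rho>\<close> and \<open>\<tau>\<close> (\<open>null_space_bounds\<close>). Minimality
of the LASSO solution then bounds the error (\<open>lasso_bounds\<close>); the unknown residual enters as a
concave quadratic, whose maximum produces the terms \<open>\<tau>\<^sup>2/\<theta>\<close> in \<open>C2\<close> and \<open>C4\<close>. Since
\<open>s\<^sup>\<gamma>/4 \<le> \<kappa> \<le> s\<^sup>\<gamma>\<close> (\<open>K_ge\<close>, \<open>K_le\<close>), \<open>\<kappa>\<close> may be replaced by \<open>s\<^sup>\<gamma>\<close>.

Why coefficients control functions. The weights bound the basis functions on the whole cube
(\<open>phi_bound\<close>, \<open>weight_eq\<close>), so a summable weighted coefficient sequence gives a uniformly convergent
expansion; that it converges to \<open>f\<close> is the completeness of the basis (\<open>phi_complete\<close>).\<close>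

section \<open>Legendre polynomials\<close>

fun dlegendre :: "nat \<Rightarrow> real \<Rightarrow> real" where
  "dlegendre 0 t = 0"
| "dlegendre (Suc 0) t = 1"
| "dlegendre (Suc (Suc n)) t =
     ((2 * real n + 3) * (legendre (Suc n) t + t * dlegendre (Suc n) t) - (real n + 1) * dlegendre n t) / (real n + 2)"

lemma legendre_has_derivative: "(legendre n has_real_derivative dlegendre n t) (at t within S)"
proof (induction n rule: induct_nat_012)
  case 0
  have "legendre 0 = (\<lambda>_. 1)" by (rule ext) simp
  then show ?case by simp
next
  case 1
  have "legendre (Suc 0) = (\<lambda>t. t)" by (rule ext) simp
  then show ?case by (simp add: DERIV_ident)
next
  case (ge2 n)
  have eq: "legendre (Suc (Suc n)) = (\<lambda>t. ((2 * real n + 3) * t * legendre (Suc n) t - (real n + 1) * legendre n t) / (real n + 2))"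
    by (rule ext) simp
  have "((\<lambda>t. ((2 * real n + 3) * t * legendre (Suc n) t - (real n + 1) * legendre n t) / (real n + 2)) has_real_derivative
     dlegendre (Suc (Suc n)) t) (at t within S)"
    unfolding dlegendre.simps
    by (rule DERIV_cdivide) (rule derivative_eq_intros ge2 refl | simp add: algebra_simps)+
  then show ?case unfolding eq .
qed

lemma dlegendre_recurrences:
  "t * dlegendre (Suc n) t - dlegendre n t = real (Suc n) * legendre (Suc n) t \<and>
   dlegendre (Suc n) t - t * dlegendre n t = real (Suc n) * legendre n t"
proof (induction n)
  case 0 show ?case by simp
next
  case (Suc n)
  define a b p q where "a = dlegendre (Suc n) t" "b = dlegendre n t" "p = legendre (Suc n) t" "q = legendre n t"
  note defs = this
  have h1: "b = t * a - (real n + 1) * p" and h2: "a - t * b = (real n + 1) * q"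
    using conjunct1[OF Suc] conjunct2[OF Suc] unfolding defs of_nat_Suc by (simp_all only: algebra_simps)
  have A: "dlegendre (Suc (Suc n)) t * (real n + 2) = (2 * real n + 3) * (p + t * a) - (real n + 1) * b"
    unfolding defs by simp
  have B: "legendre (Suc (Suc n)) t * (real n + 2) = (2 * real n + 3) * t * p - (real n + 1) * q"
    unfolding defs by simp
  have g2: "dlegendre (Suc (Suc n)) t * (real n + 2) = (t * a + (real n + 2) * p) * (real n + 2)"
    unfolding A h1 by (simp add: algebra_simps)
  then have g2': "dlegendre (Suc (Suc n)) t = t * a + (real n + 2) * p"
    by simp
  have q: "(real n + 1) * q = a - t * (t * a - (real n + 1) * p)" using h1 h2 by simp
  have "(t * dlegendre (Suc (Suc n)) t - a) = (real n + 2) * legendre (Suc (Suc n)) t"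
    unfolding g2' using B q by (simp add: algebra_simps del: legendre.simps(3))
  then show ?case using g2' unfolding defs by (simp add: algebra_simps del: legendre.simps(3) dlegendre.simps(3))
qed

lemma legendre_ODE_first_order:
  "(1 - t\<^sup>2) * dlegendre (Suc n) t = real (Suc n) * (legendre n t - t * legendre (Suc n) t)"
proof -
  note h = dlegendre_recurrences[of t n]
  have "dlegendre (Suc n) t - t * (t * dlegendre (Suc n) t - real (Suc n) * legendre (Suc n) t) = real (Suc n) * legendre n t"
  proof -
    have "t * dlegendre (Suc n) t - real (Suc n) * legendre (Suc n) t = dlegendre n t"
      using h by linarith
    then show ?thesis using h by simp
  qed
  then show ?thesis by (simp add: algebra_simps power2_eq_square)
qed

text \<open>Legendre's differential equation in self-adjoint form: it gives both orthogonality and the bound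
by 1.\<close>

lemma legendre_ODE:
  "((\<lambda>t. (1 - t\<^sup>2) * dlegendre n t) has_real_derivative - (real n * (real n + 1) * legendre n t)) (at t within S)"
proof (cases n)
  case 0
  then have "(\<lambda>t. (1 - t\<^sup>2) * dlegendre n t) = (\<lambda>_. 0)" by auto
  then show ?thesis using 0 by simp
next
  case (Suc k)
  have "((\<lambda>t. real (Suc k) * (legendre k t - t * legendre (Suc k) t)) has_real_derivative
      real (Suc k) * (dlegendre k t - (legendre (Suc k) t + t * dlegendre (Suc k) t))) (at t within S)"
    by (rule derivative_eq_intros legendre_has_derivative refl)+ (simp add: algebra_simps)
  moreover have "real (Suc k) * (dlegendre k t - (legendre (Suc k) t + t * dlegendre (Suc k) t)) = - (real n * (real n + 1) * legendre n t)"
  proof -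
    have e: "dlegendre k t = t * dlegendre (Suc k) t - real (Suc k) * legendre (Suc k) t"
      using dlegendre_recurrences[of t k] by linarith
    show ?thesis unfolding e Suc by (simp add: algebra_simps)
  qed
  ultimately show ?thesis unfolding Suc legendre_ODE_first_order by simp
qed

lemma legendre_1 [simp]: "legendre n 1 = 1"
proof -
  have "legendre n 1 = 1 \<and> legendre (Suc n) 1 = 1"
    by (induction n) (auto simp: field_simps)
  then show ?thesis by simp
qed

lemma legendre_minus: "legendre n (- t) = (- 1) ^ n * legendre n t"
proof -
  have "legendre n (- t) = (- 1) ^ n * legendre n t \<and> legendre (Suc n) (- t) = (- 1) ^ Suc n * legendre (Suc n) t"
    by (induction n) (auto simp: field_simps)
  then show ?thesis by simp
qed

lemma continuous_on_legendre [continuous_intros]: "continuous_on S (legendre n)"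
  by (meson legendre_has_derivative DERIV_isCont continuous_at_imp_continuous_on)

lemma continuous_on_dlegendre: "continuous_on S (dlegendre n)"
proof -
  have "continuous_on S (dlegendre n) \<and> continuous_on S (dlegendre (Suc n))"
  proof (induction n)
    case 0
    have "dlegendre 0 = (\<lambda>_. 0)" "dlegendre (Suc 0) = (\<lambda>_. 1)" by auto
    then show ?case by simp
  next
    case (Suc n)
    have "dlegendre (Suc (Suc n)) = (\<lambda>t. ((2 * real n + 3) * (legendre (Suc n) t + t * dlegendre (Suc n) t) - (real n + 1) * dlegendre n t) / (real n + 2))"
      by auto
    then show ?case using Suc by (auto intro!: continuous_intros simp del: dlegendre.simps)
  qed
  then show ?thesis by simp
qed

text \<open>Sonin's argument: \<open>n(n+1) P\<^sub>n\<^sup>2 + (1 - t\<^sup>2) P\<^sub>n'\<^sup>2\<close> increases on \<open>[0, 1]\<close>, and its value at 1 is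
\<open>n(n+1)\<close>. Negative arguments follow by parity.\<close>

lemma abs_legendre_le_1:
  assumes "\<bar>t\<bar> \<le> 1" shows "\<bar>legendre n t\<bar> \<le> 1"
proof (cases n)
  case 0 then show ?thesis by simp
next
  case (Suc k)
  define N where "N = real n * (real n + 1)"
  have N: "N > 0" using Suc by (simp add: N_def)
  have nonneg: "\<bar>legendre n t\<bar> \<le> 1" if t: "0 \<le> t" "t \<le> 1" for t
  proof -
    define F where "F t = (legendre n t)\<^sup>2 * N + (1 - t\<^sup>2) * (dlegendre n t)\<^sup>2" for t
    have der: "(F has_real_derivative 2 * x * (dlegendre n x)\<^sup>2) (at x)" if x: "0 \<le> x" "x < 1" for x
    proof -
      have ne: "1 - x\<^sup>2 \<noteq> 0" using x by (simp add: abs_square_eq_1 power2_eq_1_iff)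
      \<comment> \<open>This form contains \<open>P\<^sub>n'\<close> only through \<open>(1 - u\<^sup>2) P\<^sub>n'\<close>, whose derivative the equation gives.\<close>
      have ev: "F u = (legendre n u)\<^sup>2 * N + ((1 - u\<^sup>2) * dlegendre n u)\<^sup>2 / (1 - u\<^sup>2)" if "u \<in> {-1<..<1}" for u
        using that by (cases "1 - u\<^sup>2 = 0") (auto simp: F_def power2_eq_square field_simps)
      have "((\<lambda>u. (legendre n u)\<^sup>2 * N + ((1 - u\<^sup>2) * dlegendre n u)\<^sup>2 / (1 - u\<^sup>2)) has_real_derivative
         2 * legendre n x * dlegendre n x * N +
         (2 * ((1 - x\<^sup>2) * dlegendre n x) * (- (N * legendre n x)) * (1 - x\<^sup>2) - ((1 - x\<^sup>2) * dlegendre n x)\<^sup>2 * (- 2 * x)) / ((1 - x\<^sup>2) * (1 - x\<^sup>2))) (at x)"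
        by (rule derivative_eq_intros legendre_has_derivative legendre_ODE[folded N_def] refl ne)+ (simp add: algebra_simps N_def)
      moreover have "2 * legendre n x * dlegendre n x * N +
         (2 * ((1 - x\<^sup>2) * dlegendre n x) * (- (N * legendre n x)) * (1 - x\<^sup>2) - ((1 - x\<^sup>2) * dlegendre n x)\<^sup>2 * (- 2 * x)) / ((1 - x\<^sup>2) * (1 - x\<^sup>2))
         = 2 * x * (dlegendre n x)\<^sup>2"
      proof -
        have *: "2 * p * D * N + (2 * (w * D) * (- (N * p)) * w - (w * D)\<^sup>2 * (- 2 * x)) / (w * w) = 2 * x * D\<^sup>2"
          if "w \<noteq> 0" for w p D :: real
          using that by (simp add: field_simps power2_eq_square)
        show ?thesis by (rule *[OF ne])
      qed
      ultimately have d: "((\<lambda>u. (legendre n u)\<^sup>2 * N + ((1 - u\<^sup>2) * dlegendre n u)\<^sup>2 / (1 - u\<^sup>2)) has_real_derivative 2 * x * (dlegendre n x)\<^sup>2) (at x)"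
        by simp
      show ?thesis
        by (rule has_field_derivative_transform_within_open[OF d, of "{-1<..<1}"]) (use x ev in auto)
    qed
    have cont: "continuous_on {t..1} F" unfolding F_def
      by (intro continuous_intros continuous_on_dlegendre)
    have "F t \<le> F 1"
    proof (cases "t = 1")
      case False
      show ?thesis
      proof (rule DERIV_nonneg_imp_increasing_open[of t 1 F])
        show "t \<le> 1" by (rule t)
        fix x assume "t < x" "x < 1"
        then show "\<exists>y. (F has_real_derivative y) (at x) \<and> 0 \<le> y"
          using der[of x] t by (intro exI[of _ "2 * x * (dlegendre n x)\<^sup>2"]) auto
      qed (rule cont)
    qed simp
    also have "F 1 = N" by (simp add: F_def)
    finally have "(legendre n t)\<^sup>2 * N + (1 - t\<^sup>2) * (dlegendre n t)\<^sup>2 \<le> N" by (simp add: F_def)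
    moreover have "(1 - t\<^sup>2) * (dlegendre n t)\<^sup>2 \<ge> 0" using t by (simp add: power_le_one_iff abs_square_le_1)
    ultimately have "(legendre n t)\<^sup>2 * N \<le> 1 * N" by linarith
    then have "(legendre n t)\<^sup>2 \<le> 1" using N by (subst (asm) mult_le_cancel_right_pos) auto
    then show ?thesis by (simp add: abs_square_le_1)
  qed
  show ?thesis
  proof (cases "t \<ge> 0")
    case True then show ?thesis using nonneg assms by auto
  next
    case False
    then show ?thesis using nonneg[of "- t"] assms by (simp add: legendre_minus abs_mult power_abs)
  qed
qed

lemma minus_one_le_one_ereal: "(- 1 :: ereal) \<le> 1"
  using ereal_less_eq(3)[of "-1" 1] by (simp add: one_ereal_def del: ereal_less_eq)

lemma FTC_interval_pm1:
  fixes F f :: "real \<Rightarrow> real"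
  assumes "continuous_on {-1..1} f" "\<And>t S. (F has_real_derivative f t) (at t within S)"
  shows "(LBINT t=-1..1. f t) = F 1 - F (-1)"
proof -
  have "(LBINT t=ereal (-1)..ereal 1. f t) = F 1 - F (-1)"
    by (rule interval_integral_FTC_finite)
       (use assms in \<open>auto simp: has_real_derivative_iff_has_vector_derivative[symmetric]\<close>)
  then show ?thesis by (simp add: one_ereal_def)
qed

text \<open>The antiderivative of a multiple of \<open>P\<^sub>m P\<^sub>n\<close> is the Wronskian of the self-adjoint equation; it
vanishes at both end points because of its factor \<open>1 - t\<^sup>2\<close>.\<close>

lemma legendre_orthogonal:
  assumes "m \<noteq> n" shows "(LBINT t=-1..1. legendre m t * legendre n t) = 0"
proof -
  let ?W = "\<lambda>t. ((1 - t\<^sup>2) * dlegendre m t) * legendre n t - ((1 - t\<^sup>2) * dlegendre n t) * legendre m t"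
  let ?c = "real n * (real n + 1) - real m * (real m + 1)"
  have "?c \<noteq> 0"
  proof -
    have "?c = (real n - real m) * (real n + real m + 1)" by (simp add: algebra_simps)
    then show ?thesis using assms by (auto simp: add_eq_0_iff)
  qed
  have d: "(?W has_real_derivative ?c * (legendre m t * legendre n t)) (at t within S)" for t S
    by (rule derivative_eq_intros legendre_ODE legendre_has_derivative refl)+ (simp add: algebra_simps)
  have "(LBINT t=-1..1. ?c * (legendre m t * legendre n t)) = ?W 1 - ?W (-1)"
    by (rule FTC_interval_pm1[where F = ?W]) (intro continuous_intros continuous_on_legendre, rule d)
  also have "\<dots> = 0" by simp
  finally show ?thesis using \<open>?c \<noteq> 0\<close> by simp
qed

text \<open>Bonnet's recursion at two consecutive degrees, integrated against a suitable polynomial, expresses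
both norms through the same integral of \<open>t P\<^sub>k\<^sub>+\<^sub>1 P\<^sub>k\<^sub>+\<^sub>2\<close>.\<close>

lemma legendre_norm_sq: "(LBINT t=-1..1. legendre n t * legendre n t) = 2 / (2 * real n + 1)"
proof -
  have int: "interval_lebesgue_integrable lborel (-1) 1 (\<lambda>t::real. f t)" if "continuous_on {-1..1} f" for f :: "real \<Rightarrow> real"
    using that interval_integrable_continuous_on[of "-1" 1 f] by (simp add: one_ereal_def)
  have step: "(LBINT t=-1..1. legendre (Suc (Suc k)) t * legendre (Suc (Suc k)) t) * (2 * real k + 5)
     = (LBINT t=-1..1. legendre (Suc k) t * legendre (Suc k) t) * (2 * real k + 3)" for k
  proof -
    let ?I = "LBINT t=-1..1. t * (legendre (Suc k) t * legendre (Suc (Suc k)) t)"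
    have e1: "(real k + 2) * legendre (Suc (Suc k)) t = (2 * real k + 3) * t * legendre (Suc k) t - (real k + 1) * legendre k t" for t
      by simp
    have e2: "(real k + 3) * legendre (Suc (Suc (Suc k))) t = (2 * real k + 5) * t * legendre (Suc (Suc k)) t - (real k + 2) * legendre (Suc k) t" for t
      unfolding legendre.simps(3)[of "Suc k"] of_nat_Suc by (simp add: divide_simps mult.commute add.commute del: legendre.simps(3))
    have "(real k + 2) * (LBINT t=-1..1. legendre (Suc (Suc k)) t * legendre (Suc (Suc k)) t)
       = (LBINT t=-1..1. (2 * real k + 3) * (t * (legendre (Suc k) t * legendre (Suc (Suc k)) t)) - (real k + 1) * (legendre k t * legendre (Suc (Suc k)) t))"
      unfolding interval_lebesgue_integral_mult_right[symmetric]
    proof (rule interval_lebesgue_integral_cong)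
      show "(real k + 2) * (legendre (Suc (Suc k)) t * legendre (Suc (Suc k)) t) =
         (2 * real k + 3) * (t * (legendre (Suc k) t * legendre (Suc (Suc k)) t)) - (real k + 1) * (legendre k t * legendre (Suc (Suc k)) t)" for t
        unfolding mult.assoc[symmetric] e1 by (simp only: algebra_simps)
    qed (simp_all only: minus_one_le_one_ereal borel_einterval sets_lborel)
    also have "\<dots> = (2 * real k + 3) * ?I - (real k + 1) * (LBINT t=-1..1. legendre k t * legendre (Suc (Suc k)) t)"
      by (subst interval_lebesgue_integral_diff) (intro int continuous_intros, intro int continuous_intros, simp)
    also have "\<dots> = (2 * real k + 3) * ?I" using legendre_orthogonal[of k "Suc (Suc k)"] by simp
    finally have 1: "(real k + 2) * (LBINT t=-1..1. legendre (Suc (Suc k)) t * legendre (Suc (Suc k)) t) = (2 * real k + 3) * ?I" .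
    have "0 = (real k + 3) * (LBINT t=-1..1. legendre (Suc (Suc (Suc k))) t * legendre (Suc k) t)"
      using legendre_orthogonal[of "Suc (Suc (Suc k))" "Suc k"] by simp
    also have "\<dots> = (LBINT t=-1..1. (2 * real k + 5) * (t * (legendre (Suc k) t * legendre (Suc (Suc k)) t)) - (real k + 2) * (legendre (Suc k) t * legendre (Suc k) t))"
      unfolding interval_lebesgue_integral_mult_right[symmetric]
    proof (rule interval_lebesgue_integral_cong)
      show "(real k + 3) * (legendre (Suc (Suc (Suc k))) t * legendre (Suc k) t) =
         (2 * real k + 5) * (t * (legendre (Suc k) t * legendre (Suc (Suc k)) t)) - (real k + 2) * (legendre (Suc k) t * legendre (Suc k) t)" for t
        unfolding mult.assoc[symmetric] e2 by (simp only: algebra_simps)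
    qed (simp_all only: minus_one_le_one_ereal borel_einterval sets_lborel)
    also have "\<dots> = (2 * real k + 5) * ?I - (real k + 2) * (LBINT t=-1..1. legendre (Suc k) t * legendre (Suc k) t)"
      by (subst interval_lebesgue_integral_diff) (intro int continuous_intros, intro int continuous_intros, simp)
    finally have 2: "(real k + 2) * (LBINT t=-1..1. legendre (Suc k) t * legendre (Suc k) t) = (2 * real k + 5) * ?I" by simp
    have "A * (2 * x + 5) = B * (2 * x + 3)"
      if "(x + 2) * A = (2 * x + 3) * I" "(x + 2) * B = (2 * x + 5) * I" "x \<ge> 0" for A B I x :: real
    proof -
      have "(x + 2) * (A * (2 * x + 5)) = ((x + 2) * A) * (2 * x + 5)" by (simp only: mult.assoc)
      also have "\<dots> = ((x + 2) * B) * (2 * x + 3)" unfolding that(1,2) by (simp only: mult_ac)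
      also have "\<dots> = (x + 2) * (B * (2 * x + 3))" by (simp only: mult.assoc)
      finally show ?thesis using that(3) by simp
    qed
    from this[OF 1 2] show ?thesis by simp
  qed
  show ?thesis
  proof (induction n rule: induct_nat_012)
    case 0
    have "(LBINT t=-1..1. (1::real)) = 1 - (-1)"
      by (rule FTC_interval_pm1) (auto intro!: derivative_eq_intros)
    then show ?case by simp
  next
    case 1
    have "(LBINT t=-1..1. t * t :: real) = 1 ^ 3 / 3 - (-1) ^ 3 / 3"
      by (rule FTC_interval_pm1[where F = "\<lambda>t. t ^ 3 / 3"])
         (auto intro!: continuous_intros derivative_eq_intros simp: power2_eq_square)
    then show ?case by simp
  next
    case (ge2 k)
    have "(LBINT t=-1..1. legendre (Suc (Suc k)) t * legendre (Suc (Suc k)) t) * (2 * real k + 5) = 2"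
      unfolding step ge2 by (simp add: field_simps)
    then show ?case by (simp add: field_simps)
  qed
qed

section \<open>Lower sets and the hyperbolic cross\<close>

text \<open>The square of the uniform norm of the univariate polynomial of degree \<open>n\<close>.\<close>

definition level_weight :: "poly_family \<Rightarrow> nat \<Rightarrow> real" where
  "level_weight b n = (case b of Legendre \<Rightarrow> 2 * real n + 1 | Chebyshev \<Rightarrow> (if n = 0 then 1 else 2))"

lemma level_weight_0 [simp]: "level_weight b 0 = 1"
  by (cases b) (auto simp: level_weight_def)

lemma level_weight_pos: "level_weight b n > 0"
  by (cases b) (auto simp: level_weight_def)

lemma gamma_exp_ge_1: "gamma_exp b \<ge> 1"
  by (cases b) (auto simp: gamma_exp_def)

text \<open>The exponent \<open>\<gamma>\<close> is the one for which the set \<open>{0, 1}\<close> attains equality in the cardinality bound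
below.\<close>

lemma two_powr_gamma: "2 powr gamma_exp b = 1 + level_weight b 1"
proof (cases b)
  case Legendre then show ?thesis by (simp add: gamma_exp_def level_weight_def powr_numeral)
next
  case Chebyshev then show ?thesis by (simp add: gamma_exp_def level_weight_def powr_def)
qed

lemma powr_diff_mono:
  fixes x y :: real
  assumes "g \<ge> 1" "0 < x" "x \<le> y"
  shows "(1 + x) powr g - x powr g \<le> (1 + y) powr g - y powr g"
proof (rule DERIV_nonneg_imp_nondecreasing[OF assms(3)])
  fix z assume z: "x \<le> z" "z \<le> y"
  then have "z > 0" using assms by simp
  have "((\<lambda>x. (1 + x) powr g - x powr g) has_real_derivative g * (1 + z) powr (g - 1) - g * z powr (g - 1)) (at z)"
    using \<open>z > 0\<close> by (auto intro!: derivative_eq_intros)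
  moreover have "z powr (g - 1) \<le> (1 + z) powr (g - 1)" using assms \<open>z > 0\<close> by (intro powr_mono2) auto
  then have "0 \<le> g * (1 + z) powr (g - 1) - g * z powr (g - 1)" using assms by simp
  ultimately show "\<exists>D. ((\<lambda>x. (1 + x) powr g - x powr g) has_real_derivative D) (at z) \<and> 0 \<le> D" by blast
qed

text \<open>The numerical form of the induction step for \<open>lower_set_card_bound\<close>, with \<open>T\<close> the size of
a slice at height \<open>k\<close> and \<open>R\<close> the size of the rest. For Chebyshev polynomials it is scale invariant, so it
reduces to \<open>(1 + x)\<^sup>\<gamma> - x\<^sup>\<gamma> \<ge> 2\<close> for \<open>x \<ge> 1\<close>; this holds at \<open>x = 1\<close> and the left side increases.\<close>

lemma peel_inequality:
  fixes R T :: real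
  assumes k: "k \<ge> 1" and T: "T > 0" and R: "R \<ge> real k * T"
  shows "R powr gamma_exp b + level_weight b k * T powr gamma_exp b \<le> (R + T) powr gamma_exp b"
proof (cases b)
  case Legendre
  have "real k * T * T \<le> R * T" using R T by (intro mult_right_mono) auto
  moreover have "R > 0" using R T k by (smt (verit) mult_pos_pos of_nat_0_less_iff not_one_le_zero gr0I)
  ultimately show ?thesis using T Legendre
    by (simp add: gamma_exp_def level_weight_def powr_numeral power2_eq_square algebra_simps)
next
  case Chebyshev
  let ?g = "gamma_exp b"
  define x where "x = R / T"
  have RT: "R \<ge> T"
  proof -
    have "1 * T \<le> real k * T" using k T by (intro mult_right_mono) auto
    then show ?thesis using R by simp
  qed
  then have x: "x \<ge> 1" using T by (simp add: x_def)
  have "2 powr ?g - 1 \<le> (1 + x) powr ?g - x powr ?g"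
    using powr_diff_mono[OF gamma_exp_ge_1, of 1 x b] x by simp
  then have "x powr ?g + 2 \<le> (1 + x) powr ?g" using Chebyshev two_powr_gamma[of b] by (simp add: level_weight_def)
  then have "T powr ?g * (x powr ?g + 2) \<le> T powr ?g * (1 + x) powr ?g" by (intro mult_left_mono) auto
  moreover have "T powr ?g * x powr ?g = R powr ?g" using T RT by (simp add: powr_mult[symmetric] x_def)
  moreover have "T powr ?g * (1 + x) powr ?g = (R + T) powr ?g"
    using T RT x by (simp add: powr_mult[symmetric] x_def distrib_left add.commute)
  ultimately show ?thesis using k Chebyshev by (simp add: level_weight_def distrib_left mult.commute)
qed

text \<open>Induction on the cardinality. Cut off the top slice \<open>T\<close> of \<open>S\<close> in some direction, at height
\<open>k \<ge> 1\<close>. What remains is lower, and so is \<open>T\<close> pushed down to height 0, which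
divides its weighted cardinality by the weight at \<open>k\<close>. The \<open>k\<close> translates of \<open>T\<close> to the
heights \<open>0, \<dots>, k - 1\<close> are disjoint subsets of the rest, so the rest has at least \<open>k\<close> times as
many elements as \<open>T\<close>.\<close>

lemma lower_set_card_bound:
  assumes "lower_set d S" "finite S" "S \<noteq> {}"
  shows "(\<Sum>i\<in>S. \<Prod>l<d. level_weight b (i l)) \<le> real (card S) powr gamma_exp b"
  using assms
proof (induction "card S" arbitrary: S rule: less_induct)
  case less
  let ?w = "\<lambda>i. \<Prod>l<d. level_weight b (i l)"
  note S = less.prems
  have sub: "S \<subseteq> multi_idx d" and low: "\<And>i j. i \<in> S \<Longrightarrow> j \<in> multi_idx d \<Longrightarrow> (\<forall>l<d. j l \<le> i l) \<Longrightarrow> j \<in> S"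
    using S(1) unfolding lower_set_def by auto
  show ?case
  proof (cases "\<forall>i\<in>S. \<forall>l<d. i l = 0")
    case True
    have "i = j" if "i \<in> S" "j \<in> S" for i j
    proof (rule PiE_ext[of i "{..<d}" "\<lambda>_. UNIV" j])
      show "i l = j l" if "l \<in> {..<d}" for l
      proof -
        have "i l = 0" "j l = 0" using True \<open>i \<in> S\<close> \<open>j \<in> S\<close> that by blast+
        then show ?thesis by simp
      qed
    qed (use that sub in \<open>auto simp: multi_idx_def\<close>)
    then obtain i where "S = {i}" using S(3) by blast
    then show ?thesis using True by simp
  next
    case False
    then obtain i0 l where l: "i0 \<in> S" "l < d" "i0 l \<noteq> 0" by blast
    define k where "k = Max ((\<lambda>i. i l) ` S)"
    have kmax: "i l \<le> k" if "i \<in> S" for i unfolding k_def using S that by auto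
    have "k \<in> (\<lambda>i. i l) ` S" unfolding k_def using S by (intro Max_in) auto
    then obtain i1 where i1: "i1 \<in> S" "i1 l = k" by auto
    have k: "k \<ge> 1" using kmax[OF l(1)] l(3) by simp
    define T where "T = {i \<in> S. i l = k}"
    define R where "R = S - T"
    define T0 where "T0 = (\<lambda>i. i(l := 0)) ` T"
    have fin: "finite T" "finite R" "finite T0" using S by (auto simp: T_def R_def T0_def)
    have upd_in: "i(l := j) \<in> S" if "i \<in> S" "j \<le> i l" for i j
      by (rule low[OF that(1)]) (use that sub l(2) in \<open>auto simp: multi_idx_def PiE_iff extensional_def\<close>)
    have inj: "inj_on (\<lambda>i. i(l := j)) T" for j
    proof (rule inj_onI)
      fix x y assume "x \<in> T" "y \<in> T" "x(l := j) = y(l := j)"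
      then show "x = y" unfolding T_def by (metis (mono_tags, lifting) fun_upd_triv fun_upd_upd mem_Collect_eq)
    qed
    have cT0: "card T0 = card T" unfolding T0_def by (rule card_image[OF inj])
    have Tne: "T \<noteq> {}" using i1 by (auto simp: T_def)
    have cS: "card S = card R + card T" unfolding R_def using S fin by (subst card_Diff_subset) (auto simp: T_def card_mono)
    have Rcard: "k * card T \<le> card R"
    proof -
      have "card (\<Union>j<k. (\<lambda>i. i(l := j)) ` T) = (\<Sum>j<k. card ((\<lambda>i. i(l := j)) ` T))"
      proof (rule card_UN_disjoint)
        show "\<forall>i\<in>{..<k}. \<forall>j\<in>{..<k}. i \<noteq> j \<longrightarrow> (\<lambda>f. f(l := i)) ` T \<inter> (\<lambda>f. f(l := j)) ` T = {}"
          by (auto dest!: fun_cong[of _ _ l])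
      qed (use fin in auto)
      also have "\<dots> = k * card T" by (simp add: card_image[OF inj])
      finally have "k * card T = card (\<Union>j<k. (\<lambda>i. i(l := j)) ` T)" by simp
      also have "\<dots> \<le> card R"
        by (rule card_mono[OF fin(2)]) (auto simp: R_def T_def intro!: upd_in)
      finally show ?thesis .
    qed
    have cT: "card T > 0" using Tne fin by (simp add: card_gt_0_iff)
    have "k * card T \<ge> 1 * card T" using k by (intro mult_le_mono) auto
    then have cR: "card R > 0" using Rcard cT by linarith
    have lowR: "lower_set d R"
      unfolding lower_set_def R_def T_def using sub low kmax l(2) by (auto, metis le_antisym)
    have lowT0: "lower_set d T0"
      unfolding lower_set_def
    proof (intro conjI ballI impI)
      show "T0 \<subseteq> multi_idx d" unfolding T0_def T_def using sub upd_in by blast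
      fix i j assume i: "i \<in> T0" and j: "j \<in> multi_idx d" and le: "\<forall>l<d. j l \<le> i l"
      from i obtain i' where i': "i' \<in> S" "i' l = k" "i = i'(l := 0)" unfolding T0_def T_def by blast
      have "j l = 0" using le l(2) i' by auto
      moreover have "j(l := k) \<in> S"
        by (rule low[OF i'(1)]) (use j le i' l(2) in \<open>auto simp: multi_idx_def PiE_iff extensional_def\<close>)
      ultimately show "j \<in> T0" unfolding T0_def T_def
        by (intro image_eqI[of _ _ "j(l := k)"]) (auto simp: fun_upd_idem)
    qed
    have wT: "(\<Sum>i\<in>T. ?w i) = level_weight b k * (\<Sum>i\<in>T0. ?w i)"
    proof -
      have "?w i = level_weight b k * ?w (i(l := 0))" if "i \<in> T" for i
      proof -
        have pr: "?w f = level_weight b (f l) * (\<Prod>l'\<in>{..<d} - {l}. level_weight b (f l'))" for f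
          using l(2) by (subst prod.remove[of _ l]) auto
        then have "?w (i(l := 0)) = (\<Prod>l'\<in>{..<d} - {l}. level_weight b (i l'))"
          unfolding pr[of "i(l := 0)"] by (auto intro!: prod.cong)
        moreover have "?w i = level_weight b k * (\<Prod>l'\<in>{..<d} - {l}. level_weight b (i l'))"
          using that pr[of i] by (simp add: T_def)
        ultimately show ?thesis by simp
      qed
      then show ?thesis unfolding T0_def by (subst sum.reindex[OF inj]) (simp add: sum_distrib_left)
    qed
    have "(\<Sum>i\<in>S. ?w i) = (\<Sum>i\<in>R. ?w i) + (\<Sum>i\<in>T. ?w i)"
      unfolding R_def using S by (subst sum.subset_diff[of T S]) (auto simp: T_def)
    also have "\<dots> \<le> real (card R) powr gamma_exp b + level_weight b k * real (card T) powr gamma_exp b"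
      unfolding wT
    proof (intro add_mono mult_left_mono)
      show "(\<Sum>i\<in>R. ?w i) \<le> real (card R) powr gamma_exp b"
        by (rule less.hyps[OF _ lowR fin(2)]) (use cS cT cR fin in auto)
      show "(\<Sum>i\<in>T0. ?w i) \<le> real (card T) powr gamma_exp b"
        unfolding cT0[symmetric] by (rule less.hyps[OF _ lowT0 fin(3)]) (use cS cR Tne cT0 in \<open>auto simp: T0_def\<close>)
    qed (simp add: level_weight_pos less_imp_le)
    also have "\<dots> \<le> (real (card R) + real (card T)) powr gamma_exp b"
      using Rcard cT by (intro peel_inequality k) (auto simp flip: of_nat_mult)
    finally show ?thesis using cS by simp
  qed
qed


lemma hyperbolic_cross_finite: "finite (hyperbolic_cross d s)"
proof (rule finite_subset)
  show "hyperbolic_cross d s \<subseteq> {..<d} \<rightarrow>\<^sub>E {..s}"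
  proof
    fix i assume i: "i \<in> hyperbolic_cross d s"
    have "i l \<le> s" if l: "l < d" for l
    proof -
      have "i l + 1 \<le> (i l + 1) * (\<Prod>l'\<in>{..<d} - {l}. i l' + 1)"
      proof -
        have "1 \<le> (\<Prod>l'\<in>{..<d} - {l}. i l' + 1)" by (intro prod_ge_1) simp
        from mult_le_mono2[OF this, of "i l + 1"] show ?thesis by simp
      qed
      also have "\<dots> = (\<Prod>l<d. i l + 1)" using l by (subst prod.remove[of _ l]) auto
      finally show ?thesis using i by (simp add: hyperbolic_cross_def)
    qed
    then show "i \<in> {..<d} \<rightarrow>\<^sub>E {..s}" using i by (auto simp: hyperbolic_cross_def multi_idx_def PiE_iff)
  qed
qed (auto intro!: finite_PiE)

text \<open>A lower set contains with \<open>i\<close> the whole box below \<open>i\<close>, which has \<open>\<Prod>(i\<^sub>l + 1)\<close> elements.\<close>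

lemma lower_set_subset_hyperbolic_cross:
  assumes "lower_set d S" "finite S" "card S \<le> s"
  shows "S \<subseteq> hyperbolic_cross d s"
proof
  fix i assume i: "i \<in> S"
  have im: "i \<in> multi_idx d" using assms(1) i unfolding lower_set_def by auto
  have "({..<d} \<rightarrow>\<^sub>E UNIV) \<inter> (PiE {..<d} (\<lambda>l. {..i l})) \<subseteq> S"
    using assms(1) i unfolding lower_set_def by (auto simp: multi_idx_def PiE_iff)
  then have sub: "PiE {..<d} (\<lambda>l. {..i l}) \<subseteq> S" by (auto simp: PiE_iff)
  have "(\<Prod>l<d. i l + 1) = card (PiE {..<d} (\<lambda>l. {..i l}))" by (simp add: card_PiE)
  also have "\<dots> \<le> card S" by (rule card_mono[OF assms(2) sub])
  finally show "i \<in> hyperbolic_cross d s" using im assms(3) by (simp add: hyperbolic_cross_def)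
qed

lemma card_hyperbolic_cross_ge_2:
  assumes "1 \<le> d" "2 \<le> s"
  shows "2 \<le> card (hyperbolic_cross d s)"
proof -
  let ?z = "\<lambda>l\<in>{..<d}. 0 :: nat" and ?e = "(\<lambda>l\<in>{..<d}. 0 :: nat)(0 := 1)"
  have "(\<Prod>l<d. ?e l + 1) = 2"
    using assms by (subst prod.remove[of _ 0]) (auto intro!: prod.neutral)
  then have "{?z, ?e} \<subseteq> hyperbolic_cross d s"
    using assms by (auto simp: hyperbolic_cross_def multi_idx_def PiE_iff extensional_def)
  moreover have "?z \<noteq> ?e" using assms by (auto dest: fun_cong[of _ _ 0])
  then have "card {?z, ?e} = 2" by simp
  ultimately show ?thesis using card_mono[OF hyperbolic_cross_finite] by metis
qed

section \<open>The univariate orthonormal polynomials\<close>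

definition nu1_density :: "poly_family \<Rightarrow> real \<Rightarrow> real" where
  "nu1_density b t = (case b of Legendre \<Rightarrow> 1 / 2 | Chebyshev \<Rightarrow> 1 / (pi * sqrt (1 - t\<^sup>2)))"

lemma nu1_density_pos: "t \<in> {-1<..<1} \<Longrightarrow> nu1_density b t > 0"
  by (cases b) (auto simp: nu1_density_def abs_square_less_1)

lemma borel_measurable_nu1_density [measurable]: "nu1_density b \<in> borel_measurable borel"
  by (cases b) (auto simp: nu1_density_def[abs_def])

lemma nu1_alt: "nu1 b = density (restrict_space lborel {-1<..<1}) (\<lambda>t. ennreal (nu1_density b t))"
  by (cases b) (simp_all add: nu1_def nu1_density_def)

lemma space_nu1 [simp]: "space (nu1 b) = {-1<..<1}"
  by (simp add: nu1_alt space_restrict_space)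

lemma sets_nu1: "sets (nu1 b) = sets (restrict_space borel {-1<..<1})"
  unfolding nu1_alt sets_density by (rule sets_restrict_space_cong) simp

lemma measurable_nu1_borel: "f \<in> borel_measurable borel \<Longrightarrow> f \<in> borel_measurable (nu1 b)"
  unfolding measurable_cong_sets[OF sets_nu1 refl] by (rule measurable_restrict_space1)

lemma einterval_pm1: "einterval (-1) 1 = {-1<..<1::real}"
  by (auto simp: einterval_iff one_ereal_def)

lemma integral_nu1:
  fixes f :: "real \<Rightarrow> real"
  assumes "f \<in> borel_measurable (nu1 b)"
  shows "(\<integral>t. f t \<partial>nu1 b) = (LBINT t=-1..1. nu1_density b t * f t)"
proof -
  have f: "f \<in> borel_measurable (restrict_space lborel {-1<..<1})"
    using assms unfolding nu1_alt by simp
  have w: "nu1_density b \<in> borel_measurable (restrict_space lborel {-1<..<1})"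
    by (rule measurable_restrict_space1) simp
  have "(\<integral>t. f t \<partial>nu1 b) = (\<integral>t. nu1_density b t *\<^sub>R f t \<partial>restrict_space lborel {-1<..<1})"
    unfolding nu1_alt
    by (rule integral_density[OF f w]) (auto intro!: AE_I2 less_imp_le[OF nu1_density_pos] simp: space_restrict_space)
  also have "\<dots> = (LINT t:{-1<..<1}|lborel. nu1_density b t * f t)"
    by (subst integral_restrict_space) (auto simp: set_lebesgue_integral_def)
  finally show ?thesis
    by (simp add: interval_lebesgue_integral_def einterval_pm1 minus_one_le_one_ereal)
qed

text \<open>Boundary values in the form in which the fundamental theorem for improper integrals wants them.\<close>

lemma tendsto_at_pm1:
  fixes F :: "real \<Rightarrow> real"
  assumes "continuous_on {-1..1} F"
  shows "((F \<circ> real_of_ereal) \<longlongrightarrow> F (-1)) (at_right (-1))" "((F \<circ> real_of_ereal) \<longlongrightarrow> F 1) (at_left 1)"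
proof -
  have "(F \<longlongrightarrow> F (-1)) (at_right (-1))" by (rule continuous_on_Icc_at_rightD[OF assms]) simp
  then have "((F \<circ> real_of_ereal) \<longlongrightarrow> F (-1)) (at_right (ereal (-1)))" unfolding ereal_tendsto_simps .
  then show "((F \<circ> real_of_ereal) \<longlongrightarrow> F (-1)) (at_right (-1))" by (simp add: one_ereal_def)
  have "(F \<longlongrightarrow> F 1) (at_left 1)" by (rule continuous_on_Icc_at_leftD[OF assms]) simp
  then have "((F \<circ> real_of_ereal) \<longlongrightarrow> F 1) (at_left (ereal 1))" unfolding ereal_tendsto_simps .
  then show "((F \<circ> real_of_ereal) \<longlongrightarrow> F 1) (at_left 1)" by (simp add: one_ereal_def)
qed

lemma in_pm1: "-1 < ereal x \<Longrightarrow> ereal x < 1 \<Longrightarrow> -1 < x \<and> x < 1"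
  using ereal_less(4)[of x] by (metis ereal_less_eq(4) ereal_less(2) less_ereal.simps(1) one_ereal_def uminus_ereal.simps(1))

lemma chebyshev_density_integral:
  "set_integrable lborel (einterval (-1) 1) (nu1_density Chebyshev)"
  "(LBINT t=-1..1. nu1_density Chebyshev t) = 1"
proof -
  let ?F = "\<lambda>t. - arccos t / pi"
  have sq: "1 - x\<^sup>2 > 0" if "-1 < x" "x < 1" for x :: real using that by (simp add: abs_square_less_1)
  have F: "(?F has_real_derivative nu1_density Chebyshev x) (at x)" if "-1 < x" "x < 1" for x
    using that sq[OF that] by (auto intro!: derivative_eq_intros simp: nu1_density_def field_simps)
  have f: "isCont (nu1_density Chebyshev) x" if "-1 < x" "x < 1" for x
    unfolding nu1_density_def using sq[OF that] by (auto intro!: continuous_intros)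
  have cF: "continuous_on {-1..1} ?F" by (intro continuous_intros) auto
  have lt: "(-1 :: ereal) < 1" using minus_one_le_one_ereal by (simp add: less_le one_ereal_def)
  note FTC = interval_integral_FTC_nonneg[OF lt _ _ _ tendsto_at_pm1[OF cF], of "nu1_density Chebyshev"]
  have a: "\<And>x. -1 < ereal x \<Longrightarrow> ereal x < 1 \<Longrightarrow> DERIV ?F x :> nu1_density Chebyshev x"
    using F in_pm1 by blast
  have c: "\<And>x. -1 < ereal x \<Longrightarrow> ereal x < 1 \<Longrightarrow> isCont (nu1_density Chebyshev) x"
    using f in_pm1 by blast
  have n: "AE x in lborel. -1 < ereal x \<longrightarrow> ereal x < 1 \<longrightarrow> 0 \<le> nu1_density Chebyshev x"
    by (intro AE_I2 impI less_imp_le nu1_density_pos) (auto dest: in_pm1)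
  show "set_integrable lborel (einterval (-1) 1) (nu1_density Chebyshev)"
    by (rule FTC(1)[OF a c n])
  show "(LBINT t=-1..1. nu1_density Chebyshev t) = 1"
    by (subst FTC(2)[OF a c n]) auto
qed

text \<open>An antiderivative is \<open>- sin (k arccos t) / (k \<pi>)\<close>, and it vanishes at both end points.\<close>

lemma chebyshev_cos_integral:
  assumes "k > 0"
  shows "(LBINT t=-1..1. nu1_density Chebyshev t * cos (real k * arccos t)) = 0"
proof -
  let ?f = "\<lambda>t. nu1_density Chebyshev t * cos (real k * arccos t)"
  let ?F = "\<lambda>t. - sin (real k * arccos t) / (real k * pi)"
  have sq: "1 - x\<^sup>2 > 0" if "-1 < x" "x < 1" for x :: real using that by (simp add: abs_square_less_1)
  have F: "(?F has_real_derivative ?f x) (at x)" if "-1 < x" "x < 1" for x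
    using that sq[OF that] assms by (auto intro!: derivative_eq_intros simp: nu1_density_def field_simps)
  have f: "isCont ?f x" if "-1 < x" "x < 1" for x
    unfolding nu1_density_def using sq[OF that] that by (auto intro!: continuous_intros isCont_arccos)
  have cF: "continuous_on {-1..1} ?F" by (intro continuous_intros) (use assms in auto)
  have lt: "(-1 :: ereal) < 1" using minus_one_le_one_ereal by (simp add: less_le one_ereal_def)
  have int: "set_integrable lborel (einterval (-1) 1) ?f"
  proof (rule set_integrable_bound[OF chebyshev_density_integral(1)])
    have "continuous_on {-1<..<1} ?f"
      using f by (intro continuous_at_imp_continuous_on) auto
    then show "set_borel_measurable lborel (einterval (-1) 1) ?f"
      unfolding einterval_pm1 set_borel_measurable_def
      using borel_measurable_continuous_on_indicator[of "{-1<..<1}" ?f] by simp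
    show "AE x in lborel. x \<in> einterval (-1) 1 \<longrightarrow> norm (?f x) \<le> norm (nu1_density Chebyshev x)"
      by (intro AE_I2) (simp add: abs_mult mult_left_le)
  qed
  have "(LBINT t=-1..1. ?f t) = ?F 1 - ?F (-1)"
    by (rule interval_integral_FTC_integrable[OF lt _ _ int tendsto_at_pm1[OF cF]])
       (use F f in_pm1 in \<open>auto simp: has_real_derivative_iff_has_vector_derivative[symmetric]\<close>)
  then show ?thesis by (simp add: sin_npi)
qed

lemma prob_space_nu1: "prob_space (nu1 b)"
proof
  have w: "(\<lambda>t. ennreal (nu1_density b t)) \<in> borel_measurable (restrict_space lborel {-1<..<1})"
    by (rule measurable_restrict_space1) simp
  have "emeasure (nu1 b) (space (nu1 b)) = (\<integral>\<^sup>+t. ennreal (nu1_density b t) \<partial>restrict_space lborel {-1<..<1})"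
    unfolding nu1_alt by (subst emeasure_density[OF w]) (auto simp: space_restrict_space sets_restrict_space intro!: nn_integral_cong image_eqI[of _ _ UNIV])
  also have "\<dots> = (\<integral>\<^sup>+t. ennreal (indicator {-1<..<1} t * nu1_density b t) \<partial>lborel)"
    by (subst nn_integral_restrict_space) (auto intro!: nn_integral_cong simp: indicator_def)
  also have "\<dots> = ennreal (LINT t:{-1<..<1}|lborel. nu1_density b t)"
    unfolding set_lebesgue_integral_def real_scaleR_def
  proof (rule nn_integral_eq_integral)
    show "integrable lborel (\<lambda>t. indicator {-1<..<1} t * nu1_density b t)"
    proof (cases b)
      case Chebyshev
      then show ?thesis using chebyshev_density_integral(1) by (simp add: einterval_pm1 set_integrable_def)
    next
      case Legendre
      then show ?thesis by (simp add: nu1_density_def)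
    qed
  qed (auto intro!: AE_I2 simp: indicator_def less_imp_le[OF nu1_density_pos])
  also have "(LINT t:{-1<..<1}|lborel. nu1_density b t) = 1"
  proof (cases b)
    case Chebyshev
    then show ?thesis using chebyshev_density_integral(2)
      by (simp add: interval_lebesgue_integral_def einterval_pm1 minus_one_le_one_ereal)
  next
    case Legendre
    then show ?thesis by (simp add: nu1_density_def set_lebesgue_integral_def)
  qed
  finally show "emeasure (nu1 b) (space (nu1 b)) = 1" by simp
qed

lemma continuous_on_phi1: "continuous_on {-1..1} (phi1 b n)"
  by (cases b; cases "n = 0")
     (auto simp: phi1_def[abs_def] intro!: continuous_intros continuous_on_legendre)

lemma borel_measurable_phi1 [measurable]: "phi1 b n \<in> borel_measurable (nu1 b)"
  unfolding measurable_cong_sets[OF sets_nu1 refl]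
  by (rule borel_measurable_continuous_on_restrict) (rule continuous_on_subset[OF continuous_on_phi1], auto)

lemma phi1_bound:
  assumes "t \<in> {-1<..<1}" shows "\<bar>phi1 b n t\<bar> \<le> sqrt (level_weight b n)"
proof (cases b)
  case Legendre
  have "\<bar>legendre n t\<bar> \<le> 1" using assms by (intro abs_legendre_le_1) auto
  then show ?thesis using Legendre by (simp add: phi1_def level_weight_def abs_mult mult_left_le)
next
  case Chebyshev
  then show ?thesis by (simp add: phi1_def level_weight_def abs_mult mult_left_le)
qed

lemma phi1_1: "phi1 b n 1 = sqrt (level_weight b n)"
  by (cases b) (auto simp: phi1_def level_weight_def)

lemma phi1_0: "phi1 b 0 t = 1"
  by (cases b) (auto simp: phi1_def)

text \<open>In the Chebyshev case products of cosines are turned into sums, so only the integrals of single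
cosines matter.\<close>

lemma phi1_orthonormal: "(\<integral>t. phi1 b i t * phi1 b j t \<partial>nu1 b) = of_bool (i = j)"
proof -
  have I: "(\<integral>t. phi1 b i t * phi1 b j t \<partial>nu1 b) = (LBINT t=-1..1. nu1_density b t * (phi1 b i t * phi1 b j t))"
    by (rule integral_nu1) measurable
  show ?thesis
  proof (cases b)
    case Legendre
    have "(\<integral>t. phi1 b i t * phi1 b j t \<partial>nu1 b) = (LBINT t=-1..1. (sqrt (2 * real i + 1) * sqrt (2 * real j + 1) / 2) * (legendre i t * legendre j t))"
      unfolding I using Legendre by (simp add: nu1_density_def phi1_def mult_ac)
    also have "\<dots> = (sqrt (2 * real i + 1) * sqrt (2 * real j + 1) / 2) * (LBINT t=-1..1. legendre i t * legendre j t)"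
      by (rule interval_lebesgue_integral_mult_right)
    finally have *: "(\<integral>t. phi1 b i t * phi1 b j t \<partial>nu1 b) = (sqrt (2 * real i + 1) * sqrt (2 * real j + 1) / 2) * (LBINT t=-1..1. legendre i t * legendre j t)" .
    show ?thesis
    proof (cases "i = j")
      case True
      have "(2 * real j + 1) / 2 * (2 / (2 * real j + 1)) = 1" by (simp add: divide_simps)
      then show ?thesis unfolding * using True by (simp only: legendre_norm_sq real_sqrt_mult_self abs_of_nonneg) simp
    qed (simp add: * legendre_orthogonal)
  next
    case Chebyshev
    have ci: "(\<integral>t. cos (real k * arccos t) \<partial>nu1 b) = of_bool (k = 0)" for k
    proof -
      have m: "(\<lambda>t. cos (real k * arccos t)) \<in> borel_measurable (nu1 b)"
        unfolding measurable_cong_sets[OF sets_nu1 refl]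
        by (rule borel_measurable_continuous_on_restrict) (auto intro!: continuous_intros)
      show ?thesis unfolding integral_nu1[OF m] using Chebyshev chebyshev_cos_integral[of k] chebyshev_density_integral(2) by auto
    qed
    have ii: "integrable (nu1 b) (\<lambda>t. cos (real k * arccos t))" for k
    proof (rule finite_measure.integrable_const_bound[of _ _ 1])
      show "finite_measure (nu1 b)" using prob_space_nu1 by (rule prob_space.finite_measure)
      show "(\<lambda>t. cos (real k * arccos t)) \<in> borel_measurable (nu1 b)"
        unfolding measurable_cong_sets[OF sets_nu1 refl]
        by (rule borel_measurable_continuous_on_restrict) (auto intro!: continuous_intros)
    qed auto
    define p q where "p = i + j" "q = (if i \<le> j then j - i else i - j)"
    have cc: "cos (real i * x) * cos (real j * x) = (cos (real p * x) + cos (real q * x)) / 2" for x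
    proof -
      have "cos (real q * x) = cos (real i * x - real j * x)"
        by (cases "i \<le> j") (auto simp: p_q_def of_nat_diff algebra_simps cos_diff)
      then show ?thesis by (simp add: p_q_def cos_times_cos algebra_simps)
    qed
    have ij: "(\<integral>t. cos (real i * arccos t) * cos (real j * arccos t) \<partial>nu1 b) = (of_bool (p = 0) + of_bool (q = 0)) / 2"
      unfolding cc using ci ii by simp
    have "(\<integral>t. phi1 b i t * phi1 b j t \<partial>nu1 b) = (\<integral>t. sqrt (level_weight b i) * sqrt (level_weight b j) * (cos (real i * arccos t) * cos (real j * arccos t)) \<partial>nu1 b)"
      using Chebyshev by (intro Bochner_Integration.integral_cong) (auto simp: phi1_def level_weight_def)
    also have "\<dots> = sqrt (level_weight b i) * sqrt (level_weight b j) * ((of_bool (p = 0) + of_bool (q = 0)) / 2)"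
      unfolding ij[symmetric] by simp
    also have "\<dots> = of_bool (i = j)" using Chebyshev by (auto simp: p_q_def level_weight_def)
    finally show ?thesis .
  qed
qed


section \<open>Tensor products and their uniform norms\<close>

lemma product_sigma_finite_nu1: "product_sigma_finite (\<lambda>_. nu1 b)"
  unfolding product_sigma_finite_def
  using prob_space_nu1 prob_space.finite_measure finite_measure.axioms(1) by blast

lemma prob_space_nu: "prob_space (nu b d)"
  unfolding nu_def by (intro prob_space_PiM prob_space_nu1)

lemma space_nu: "space (nu b d) = {..<d} \<rightarrow>\<^sub>E {-1<..<1}"
  by (simp add: nu_def space_PiM)

lemma borel_measurable_phi [measurable]: "phi b d i \<in> borel_measurable (nu b d)"
  unfolding phi_def[abs_def] nu_def
proof (rule borel_measurable_prod)
  fix l assume "l \<in> {..<d}"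
  then have "(\<lambda>t. t l) \<in> measurable (\<Pi>\<^sub>M l\<in>{..<d}. nu1 b) (nu1 b)" by (rule measurable_component_singleton)
  then show "(\<lambda>t. phi1 b (i l) (t l)) \<in> borel_measurable (\<Pi>\<^sub>M l\<in>{..<d}. nu1 b)"
    by (rule measurable_compose) (rule borel_measurable_phi1)
qed

text \<open>The explicit value of the weight; \<open>weight_eq\<close> shows the agreement with the essential supremum.\<close>

definition tensor_weight :: "poly_family \<Rightarrow> nat \<Rightarrow> (nat \<Rightarrow> nat) \<Rightarrow> real" where
  "tensor_weight b d i = (\<Prod>l<d. sqrt (level_weight b (i l)))"

lemma tensor_weight_pos: "tensor_weight b d i > 0"
  unfolding tensor_weight_def by (intro prod_pos) (auto simp: level_weight_pos)

lemma phi_bound: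
  assumes "t \<in> space (nu b d)" shows "\<bar>phi b d i t\<bar> \<le> tensor_weight b d i"
  unfolding phi_def tensor_weight_def abs_prod
  using assms by (intro prod_mono) (auto simp: space_nu PiE_iff intro!: phi1_bound)

lemma phi_orthonormal:
  assumes "i \<in> multi_idx d" "j \<in> multi_idx d"
  shows "(\<integral>t. phi b d i t * phi b d j t \<partial>nu b d) = of_bool (i = j)"
proof -
  interpret product_sigma_finite "\<lambda>_. nu1 b" by (rule product_sigma_finite_nu1)
  interpret N: prob_space "nu1 b" by (rule prob_space_nu1)
  have int: "integrable (nu1 b) (\<lambda>t. phi1 b m t * phi1 b n t)" for m n
    by (rule N.integrable_const_bound[of _ "sqrt (level_weight b m) * sqrt (level_weight b n)"])
       (auto intro!: AE_I2 mult_mono phi1_bound less_imp_le[OF level_weight_pos] simp: abs_mult)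
  have "(\<integral>t. phi b d i t * phi b d j t \<partial>nu b d) = (\<integral>t. (\<Prod>l<d. phi1 b (i l) (t l) * phi1 b (j l) (t l)) \<partial>nu b d)"
    by (simp add: phi_def prod.distrib)
  also have "\<dots> = (\<Prod>l<d. \<integral>t. phi1 b (i l) t * phi1 b (j l) t \<partial>nu1 b)"
    unfolding nu_def by (rule product_integral_prod) (use int in auto)
  also have "\<dots> = (\<Prod>l<d. of_bool (i l = j l))" by (simp add: phi1_orthonormal)
  also have "\<dots> = of_bool (i = j)"
  proof (cases "i = j")
    case False
    then obtain l where "l < d" "i l \<noteq> j l"
      using PiE_ext[of i "{..<d}" "\<lambda>_. UNIV" j] assms unfolding multi_idx_def by auto
    then show ?thesis using False by (auto intro!: prod_zero)
  qed simp
  finally show ?thesis .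
qed

text \<open>Needed to see that values near the end point 1 count for the essential supremum.\<close>

lemma nu1_right_end_pos:
  assumes "a < 1" "-1 \<le> a" shows "emeasure (nu1 b) {a<..<1} \<noteq> 0" "{a<..<1} \<in> sets (nu1 b)"
proof -
  have s: "{a<..<1} \<in> sets (restrict_space lborel {-1<..<1})"
    using assms by (auto simp: sets_restrict_space intro!: image_eqI[of _ _ "{a<..<1}"])
  then show "{a<..<1} \<in> sets (nu1 b)" unfolding nu1_alt by simp
  have w: "(\<lambda>t. ennreal (nu1_density b t)) \<in> borel_measurable (restrict_space lborel {-1<..<1})"
    by (rule measurable_restrict_space1) simp
  show "emeasure (nu1 b) {a<..<1} \<noteq> 0"
  proof
    assume "emeasure (nu1 b) {a<..<1} = 0"
    then have "{a<..<1} \<in> null_sets (nu1 b)" using s by (simp add: null_sets_def nu1_alt)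
    then have "AE x in restrict_space lborel {-1<..<1}. x \<in> {a<..<1} \<longrightarrow> ennreal (nu1_density b x) = 0"
      unfolding nu1_alt by (simp add: null_sets_density_iff[OF w])
    then have "AE x in lborel. x \<in> {-1<..<1} \<longrightarrow> x \<in> {a<..<1} \<longrightarrow> ennreal (nu1_density b x) = 0"
      by (subst (asm) AE_restrict_space_iff) auto
    then have "AE x in lborel. x \<notin> {a<..<1}"
    proof eventually_elim
      case (elim x)
      then show ?case using nu1_density_pos[of x b] assms by auto
    qed
    then have "emeasure lborel {a<..<1} = 0"
      by (subst (asm) AE_iff_measurable[of "{a<..<1}"]) auto
    then show False using assms by simp
  qed
qed

text \<open>The basis functions attain their uniform norm at the corner \<open>(1, \<dots>, 1)\<close> of the closed cube.\<close>

lemma Linf_norm_phi: "Linf_norm (nu b d) (\<lambda>t. complex_of_real (phi b d i t)) = ennreal (tensor_weight b d i)"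
proof (rule antisym)
  have m: "(\<lambda>t. ennreal (cmod (complex_of_real (phi b d i t)))) \<in> borel_measurable (nu b d)" by simp
  show "Linf_norm (nu b d) (\<lambda>t. complex_of_real (phi b d i t)) \<le> ennreal (tensor_weight b d i)"
    unfolding Linf_norm_def by (rule esssup_I[OF m]) (auto intro!: AE_I2 ennreal_leI phi_bound)
  interpret product_sigma_finite "\<lambda>_. nu1 b" by (rule product_sigma_finite_nu1)
  \<comment> \<open>Near 1 each univariate factor exceeds \<open>q\<close> times its value at 1; the resulting box has positive measure.\<close>
  have ge: "ennreal (q ^ d * tensor_weight b d i) \<le> Linf_norm (nu b d) (\<lambda>t. complex_of_real (phi b d i t))"
    if q: "0 < q" "q < 1" for q
  proof (rule ccontr)
    assume "\<not> ?thesis"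
    then have lt: "Linf_norm (nu b d) (\<lambda>t. complex_of_real (phi b d i t)) < ennreal (q ^ d * tensor_weight b d i)" by simp
    have "\<exists>a. -1 \<le> a \<and> a < 1 \<and> (\<forall>t\<in>{a<..<1}. phi1 b n t \<ge> q * sqrt (level_weight b n))" for n
    proof -
      have "(phi1 b n \<longlongrightarrow> phi1 b n 1) (at_left 1)" by (rule continuous_on_Icc_at_leftD[OF continuous_on_phi1]) simp
      moreover have "q * sqrt (level_weight b n) < phi1 b n 1" unfolding phi1_1 using q level_weight_pos[of b n] by simp
      ultimately have "eventually (\<lambda>t. q * sqrt (level_weight b n) < phi1 b n t) (at_left 1)" by (rule order_tendstoD(1))
      then obtain a where "a < 1" "\<And>t. a < t \<Longrightarrow> t < 1 \<Longrightarrow> q * sqrt (level_weight b n) < phi1 b n t"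
        unfolding eventually_at_left_field by blast
      then show ?thesis by (intro exI[of _ "max a (-1)"]) (auto simp: less_imp_le)
    qed
    then obtain a where a: "\<And>n. -1 \<le> a n" "\<And>n. a n < 1" "\<And>n t. t \<in> {a n<..<1} \<Longrightarrow> phi1 b n t \<ge> q * sqrt (level_weight b n)"
      by metis
    define X where "X = ({..<d} \<rightarrow>\<^sub>E UNIV) \<inter> (\<Pi>\<^sub>E l\<in>{..<d}. {a (i l)<..<1})"
    have X: "X = (\<Pi>\<^sub>E l\<in>{..<d}. {a (i l)<..<1})" unfolding X_def by (auto simp: PiE_iff)
    have eX: "emeasure (nu b d) X = (\<Prod>l<d. emeasure (nu1 b) {a (i l)<..<1})"
      unfolding X nu_def by (rule emeasure_PiM) (use nu1_right_end_pos(2) a in auto)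
    then have X0: "emeasure (nu b d) X \<noteq> 0" using nu1_right_end_pos(1) a by (simp add: prod_zero_iff)
    have Xs: "X \<in> sets (nu b d)" unfolding X nu_def by (rule sets_PiM_I_finite) (use nu1_right_end_pos(2) a in auto)
    have big: "cmod (complex_of_real (phi b d i t)) \<ge> q ^ d * tensor_weight b d i" if "t \<in> X" for t
    proof -
      have "q ^ d * tensor_weight b d i = (\<Prod>l<d. q * sqrt (level_weight b (i l)))" by (simp add: tensor_weight_def prod.distrib)
      also have "\<dots> \<le> (\<Prod>l<d. phi1 b (i l) (t l))"
        using that q unfolding X by (intro prod_mono) (auto intro!: a(3) simp: less_imp_le[OF level_weight_pos] PiE_iff)
      finally show ?thesis unfolding phi_def norm_of_real by linarith
    qed
    have "AE t in nu b d. ennreal (cmod (complex_of_real (phi b d i t))) \<le> Linf_norm (nu b d) (\<lambda>t. complex_of_real (phi b d i t))"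
      unfolding Linf_norm_def by (rule esssup_AE)
    then have "AE t in nu b d. t \<notin> X"
    proof eventually_elim
      case (elim t)
      then have "ennreal (cmod (complex_of_real (phi b d i t))) < ennreal (q ^ d * tensor_weight b d i)" using lt by (rule le_less_trans)
      then show ?case using big[of t] by (auto simp: ennreal_less_iff not_less)
    qed
    moreover have "X \<subseteq> space (nu b d)" using Xs by (rule sets.sets_into_space)
    ultimately have "emeasure (nu b d) X = 0" using Xs by (subst (asm) AE_iff_measurable[of X]) auto
    then show False using X0 by simp
  qed
  have "((\<lambda>q. ennreal (q ^ d * tensor_weight b d i)) \<longlongrightarrow> ennreal (1 ^ d * tensor_weight b d i)) (at_left 1)"
    by (intro tendsto_ennrealI tendsto_intros)
  moreover have "eventually (\<lambda>q::real. ennreal (q ^ d * tensor_weight b d i) \<le> Linf_norm (nu b d) (\<lambda>t. complex_of_real (phi b d i t))) (at_left 1)"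
    unfolding eventually_at_left_field by (intro exI[of _ 0]) (auto intro: ge)
  ultimately show "ennreal (tensor_weight b d i) \<le> Linf_norm (nu b d) (\<lambda>t. complex_of_real (phi b d i t))"
    using tendsto_upperbound[of "\<lambda>q. ennreal (q ^ d * tensor_weight b d i)" _ "at_left 1"] by simp
qed

lemma weight_eq: "weight b d i = tensor_weight b d i"
  unfolding weight_def Linf_norm_phi using tensor_weight_pos[of b d i] by simp

lemma wcard_eq: "wcard b d S = (\<Sum>i\<in>S. \<Prod>l<d. level_weight b (i l))"
  unfolding wcard_def weight_eq tensor_weight_def
  by (intro sum.cong refl) (simp add: prod_power_distrib less_imp_le[OF level_weight_pos] real_sqrt_pow2)

section \<open>The largest weighted cardinality of a lower set\<close>

lemma finite_lower_sets: "finite {S. lower_set d S \<and> finite S \<and> card S \<le> s}"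
  by (rule finite_subset[of _ "Pow (hyperbolic_cross d s)"])
     (use lower_set_subset_hyperbolic_cross hyperbolic_cross_finite in auto)

lemma wcard_le_K:
  assumes "lower_set d S" "finite S" "card S \<le> s" shows "wcard b d S \<le> K b d s"
  unfolding K_def using assms finite_lower_sets by (intro Max_ge) auto

lemma K_le:
  assumes "s \<ge> 1" shows "K b d s \<le> real s powr gamma_exp b"
  unfolding K_def
proof (subst Max_le_iff)
  show "finite (wcard b d ` {S. lower_set d S \<and> finite S \<and> card S \<le> s})" using finite_lower_sets by simp
  have "lower_set d {}" by (simp add: lower_set_def)
  then show "wcard b d ` {S. lower_set d S \<and> finite S \<and> card S \<le> s} \<noteq> {}" by auto
  show "\<forall>a\<in>wcard b d ` {S. lower_set d S \<and> finite S \<and> card S \<le> s}. a \<le> real s powr gamma_exp b"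
  proof (intro ballI, elim imageE CollectE conjE)
    fix a S assume a: "a = wcard b d S" and S: "lower_set d S" "finite S" "card S \<le> s"
    show "a \<le> real s powr gamma_exp b"
    proof (cases "S = {}")
      case False
      have "a \<le> real (card S) powr gamma_exp b"
        unfolding a wcard_eq by (rule lower_set_card_bound[OF S(1,2) False])
      also have "\<dots> \<le> real s powr gamma_exp b"
        using S(3) gamma_exp_ge_1[of b] by (intro powr_mono2) auto
      finally show ?thesis .
    qed (simp add: a wcard_def)
  qed
qed

text \<open>The cube \<open>{0, 1}\<^sup>k\<close>, embedded in the first \<open>k\<close> coordinates, is a lower set with \<open>2\<^sup>k\<close> elements, whose
weighted cardinality factorises.\<close>

lemma K_ge_cube:
  assumes "k \<le> d" "2 ^ k \<le> s"
  shows "real (2 ^ k) powr gamma_exp b \<le> K b d s"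
proof -
  define c where "c l = (if l < k then {0, 1} else {0 :: nat})" for l
  define S where "S = (\<Pi>\<^sub>E l\<in>{..<d}. c l)"
  have fc: "finite (c l)" for l by (simp add: c_def)
  have split: "(\<Prod>l<d. if l < k then x else 1) = x ^ k" for x :: "'a :: comm_monoid_mult"
  proof -
    have "(\<Prod>l<d. if l < k then x else 1) = (\<Prod>l\<in>{..<d} \<inter> {l. l < k}. x)"
      by (subst prod.inter_restrict) auto
    also have "{..<d} \<inter> {l. l < k} = {..<k}" using assms(1) by auto
    finally show ?thesis by simp
  qed
  have fS: "finite S" unfolding S_def using fc by (intro finite_PiE) auto
  have "card S = (\<Prod>l<d. card (c l))" unfolding S_def by (simp add: card_PiE)
  also have "\<dots> = (\<Prod>l<d. if l < k then 2 else 1)" by (intro prod.cong refl) (simp add: c_def)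
  also have "\<dots> = 2 ^ k" by (rule split)
  finally have cS: "card S \<le> s" using assms(2) by simp
  have low: "lower_set d S"
    unfolding lower_set_def
  proof (intro conjI ballI impI)
    show "S \<subseteq> multi_idx d" unfolding S_def multi_idx_def by auto
    fix i j assume i: "i \<in> S" and j: "j \<in> multi_idx d" and le: "\<forall>l<d. j l \<le> i l"
    have "j l \<in> c l" if "l < d" for l
    proof -
      have "i l \<in> c l" "j l \<le> i l" using i le that unfolding S_def by auto
      then show ?thesis unfolding c_def by (auto split: if_splits)
    qed
    then show "j \<in> S" using j unfolding S_def multi_idx_def by (auto simp: PiE_iff)
  qed
  have "real (2 ^ k) powr gamma_exp b = (2 powr gamma_exp b) ^ k"
    by (simp add: powr_realpow[symmetric] powr_powr mult.commute)
  also have "\<dots> = (\<Prod>l<d. if l < k then 1 + level_weight b 1 else 1)" unfolding two_powr_gamma by (rule split[symmetric])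
  also have "\<dots> = (\<Prod>l<d. \<Sum>n\<in>c l. level_weight b n)" by (intro prod.cong refl) (simp add: c_def)
  also have "\<dots> = wcard b d S" unfolding wcard_eq S_def by (rule prod_sum_PiE) (use fc in auto)
  also have "\<dots> \<le> K b d s" by (rule wcard_le_K[OF low fS cS])
  finally show ?thesis .
qed

text \<open>Rounding \<open>s\<close> down to a power of two loses at most the factor \<open>2\<^sup>\<gamma> \<le> 4\<close>.\<close>

lemma K_ge:
  assumes "2 \<le> s" "s \<le> 2 ^ (d + 1)"
  shows "real s powr gamma_exp b / 4 \<le> K b d s"
proof -
  \<comment> \<open>There are only \<open>d\<close> coordinates for the cube, which is why \<open>s\<close> must not exceed \<open>2\<^sup>d\<^sup>+\<^sup>1\<close>.\<close>
  have "\<exists>k\<le>d. 2 ^ k \<le> s \<and> s \<le> 2 * 2 ^ k"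
  proof (cases "2 ^ d \<le> s")
    case True then show ?thesis using assms by (intro exI[of _ d]) auto
  next
    case False
    define k where "k = (GREATEST k. 2 ^ k \<le> s)"
    have ex: "(2::nat) ^ 0 \<le> s" using assms by simp
    have bd: "k' \<le> d" if "2 ^ k' \<le> s" for k'
      using that False by (meson le_trans linorder_not_le nat_less_le one_less_numeral_iff power_strict_increasing_iff semiring_norm(76))
    have k: "2 ^ k \<le> s" unfolding k_def by (rule GreatestI_nat[where P = "\<lambda>k. 2 ^ k \<le> s" and k = 0 and b = d]) (use ex bd in auto)
    have "\<not> 2 ^ Suc k \<le> s"
    proof
      assume "2 ^ Suc k \<le> s"
      then have "Suc k \<le> k" unfolding k_def using Greatest_le_nat[of "\<lambda>k. 2 ^ k \<le> s" "Suc k" d] bd k_def by blast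
      then show False by simp
    qed
    then show ?thesis using k bd[OF k] by (intro exI[of _ k]) auto
  qed
  then obtain k where k: "k \<le> d" "2 ^ k \<le> s" "s \<le> 2 * 2 ^ k" by blast
  have "real s \<le> 2 * real (2 ^ k)" using k(3) by (metis of_nat_le_iff of_nat_mult of_nat_numeral)
  then have "real s powr gamma_exp b \<le> (2 * real (2 ^ k)) powr gamma_exp b" using gamma_exp_ge_1[of b] by (intro powr_mono2) auto
  also have "\<dots> = 2 powr gamma_exp b * real (2 ^ k) powr gamma_exp b" by (rule powr_mult)
  also have "\<dots> \<le> 4 * real (2 ^ k) powr gamma_exp b"
    unfolding two_powr_gamma by (intro mult_right_mono) (cases b, auto simp: level_weight_def)
  finally show ?thesis using K_ge_cube[OF k(1,2), of b] by simp
qed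

lemma K_ge_1: "s \<ge> 1 \<Longrightarrow> K b d s \<ge> 1"
  using K_ge_cube[of 0 d s b] by simp

section \<open>Completeness of the tensor basis\<close>

lemma integrable_mult_bounded:
  fixes G h :: "'a \<Rightarrow> real"
  assumes "integrable M G" "h \<in> borel_measurable M" "\<And>x. x \<in> space M \<Longrightarrow> \<bar>h x\<bar> \<le> C"
  shows "integrable M (\<lambda>x. G x * h x)"
proof (rule Bochner_Integration.integrable_bound[of M "\<lambda>x. C * G x"])
  show "AE x in M. norm (G x * h x) \<le> norm (C * G x)"
  proof (rule AE_I2)
    fix x assume "x \<in> space M"
    then have "\<bar>h x\<bar> \<le> \<bar>C\<bar>" using assms(3) by fastforce
    then have "\<bar>G x\<bar> * \<bar>h x\<bar> \<le> \<bar>G x\<bar> * \<bar>C\<bar>" by (intro mult_left_mono) auto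
    then show "norm (G x * h x) \<le> norm (C * G x)" by (simp add: abs_mult mult.commute)
  qed
qed (use assms in auto)

text \<open>Dynkin's argument for the signed measure with density \<open>G\<close>, pushed forward along \<open>X\<close>.\<close>

lemma integrals_zero_on_sigma_algebra:
  fixes G :: "'a \<Rightarrow> real"
  assumes G: "integrable M G" and X [measurable]: "X \<in> measurable M N"
    and gen: "sets N = sigma_sets (space N) \<G>" "Int_stable \<G>" "\<G> \<subseteq> Pow (space N)"
    and total: "(\<integral>x. G x \<partial>M) = 0"
    and zero: "\<And>A. A \<in> \<G> \<Longrightarrow> (\<integral>x. G x * indicator A (X x) \<partial>M) = 0"
    and A: "A \<in> sets N"
  shows "(\<integral>x. G x * indicator A (X x) \<partial>M) = 0"
proof -
  note bi = integrable_mult_bounded[OF G]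
  have "A \<in> sigma_sets (space N) \<G>" using A gen(1) by simp
  with gen(2,3) have "A \<in> sets N \<and> (\<integral>x. G x * indicator A (X x) \<partial>M) = 0"
  proof (induction rule: sigma_sets_induct_disjoint)
    case (basic A)
    then have "A \<in> sets N" unfolding gen(1) by (rule sigma_sets.Basic)
    then show ?case using zero[OF basic] by simp
  next
    case empty then show ?case by simp
  next
    case (compl A)
    then have [measurable]: "A \<in> sets N" by simp
    have "(\<integral>x. G x * indicator (space N - A) (X x) \<partial>M) = (\<integral>x. G x - G x * indicator A (X x) \<partial>M)"
      using measurable_space[OF X] by (intro Bochner_Integration.integral_cong) (auto simp: indicator_def)
    also have "\<dots> = 0" using compl total G bi[of "\<lambda>x. indicator A (X x)" 1]
      by (subst Bochner_Integration.integral_diff) (auto simp: indicator_def)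
    finally show ?case by simp
  next
    case (union F)
    then have [measurable]: "\<And>i. F i \<in> sets N" by auto
    have "(\<lambda>n. \<integral>x. G x * indicator (\<Union>i<n. F i) (X x) \<partial>M) \<longlonglongrightarrow> (\<integral>x. G x * indicator (\<Union>i. F i) (X x) \<partial>M)"
    proof (rule integral_dominated_convergence[where w = "\<lambda>x. \<bar>G x\<bar>"])
      show "AE x in M. (\<lambda>n. G x * indicator (\<Union>i<n. F i) (X x)) \<longlonglongrightarrow> G x * indicator (\<Union>i. F i) (X x)"
        by (intro AE_I2 tendsto_intros LIMSEQ_indicator_UN)
      show "AE x in M. norm (G x * indicator (\<Union>i<n. F i) (X x)) \<le> \<bar>G x\<bar>" for n
        by (intro AE_I2) (auto simp: indicator_def)
      have [measurable]: "(\<Union>i. F i) \<in> sets N" "(\<Union>i<n. F i) \<in> sets N" for n by auto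
      have [measurable]: "G \<in> borel_measurable M" using G by simp
      show "(\<lambda>x. G x * indicator (\<Union>i. F i) (X x)) \<in> borel_measurable M"
        "(\<lambda>x. G x * indicator (\<Union>i<n. F i) (X x)) \<in> borel_measurable M" for n by measurable
    qed (use G in auto)
    moreover have "(\<integral>x. G x * indicator (\<Union>i<n. F i) (X x) \<partial>M) = 0" for n
    proof -
      have "indicator (\<Union>i<n. F i) y = (\<Sum>i<n. indicator (F i) y :: real)" for y
        by (rule indicator_UN_disjoint) (use union(1) in \<open>auto simp: disjoint_family_on_def\<close>)
      then have "(\<integral>x. G x * indicator (\<Union>i<n. F i) (X x) \<partial>M) = (\<integral>x. (\<Sum>i<n. G x * indicator (F i) (X x)) \<partial>M)"
        by (simp add: sum_distrib_left)
      also have "\<dots> = (\<Sum>i<n. \<integral>x. G x * indicator (F i) (X x) \<partial>M)"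
        by (rule Bochner_Integration.integral_sum) (auto intro!: bi[of _ 1] simp: indicator_def)
      finally show ?thesis using union by simp
    qed
    ultimately have "(\<integral>x. G x * indicator (\<Union>i. F i) (X x) \<partial>M) = 0" by (simp add: LIMSEQ_const_iff)
    then show ?case by auto
  qed
  then show ?thesis by simp
qed

text \<open>The functional \<open>h \<mapsto> \<integral> G h(X)\<close> vanishes on polynomials, hence on continuous functions by
Weierstrass, hence on indicators of half lines by dominated convergence, and these generate the
Borel sets.\<close>

lemma moments_determine_integrals:
  fixes G X :: "'a \<Rightarrow> real"
  assumes G: "integrable M G" and X [measurable]: "X \<in> borel_measurable M"
    and X1: "\<And>x. x \<in> space M \<Longrightarrow> X x \<in> {-1..1}"
    and mom: "\<And>k. (\<integral>x. G x * X x ^ k \<partial>M) = 0"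
    and A: "A \<in> sets borel"
  shows "(\<integral>x. G x * indicator A (X x) \<partial>M) = 0"
proof -
  have [measurable]: "G \<in> borel_measurable M" using G by simp
  note bi = integrable_mult_bounded[OF G]
  have poly: "(\<integral>x. G x * p (X x) \<partial>M) = 0" if p: "real_polynomial_function p" for p
  proof -
    obtain a n where p: "p = (\<lambda>x. \<Sum>i\<le>n. a i * x ^ i)" using p real_polynomial_function_iff_sum by blast
    have "(\<integral>x. G x * p (X x) \<partial>M) = (\<integral>x. (\<Sum>i\<le>n. a i * (G x * X x ^ i)) \<partial>M)"
      by (simp add: p sum_distrib_left algebra_simps)
    also have "\<dots> = (\<Sum>i\<le>n. a i * (\<integral>x. G x * X x ^ i \<partial>M))"
    proof (subst Bochner_Integration.integral_sum)
      show "integrable M (\<lambda>x. a i * (G x * X x ^ i))" for i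
        by (intro Bochner_Integration.integrable_mult_right bi[of _ 1]) (use X1 in \<open>auto simp: power_abs power_le_one abs_le_iff\<close>)
    qed simp
    finally show ?thesis by (simp add: mom)
  qed
  have cont: "(\<integral>x. G x * f (X x) \<partial>M) = 0" if f: "continuous_on UNIV f" for f :: "real \<Rightarrow> real"
  proof (rule ccontr)
    assume ne: "(\<integral>x. G x * f (X x) \<partial>M) \<noteq> 0"
    define I where "I = \<bar>\<integral>x. G x * f (X x) \<partial>M\<bar>"
    define e where "e = I / (1 + (\<integral>x. \<bar>G x\<bar> \<partial>M))"
    have IG: "(\<integral>x. \<bar>G x\<bar> \<partial>M) \<ge> 0" by simp
    have pos: "1 + (\<integral>x. \<bar>G x\<bar> \<partial>M) > 0" using IG by linarith
    then have e: "e > 0" using ne unfolding e_def I_def by (intro divide_pos_pos) auto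
    obtain p where p: "real_polynomial_function p" "\<And>x. x \<in> {-1..1} \<Longrightarrow> \<bar>f x - p x\<bar> < e"
      using Stone_Weierstrass_real_polynomial_function[of "{-1..1::real}" f e] e continuous_on_subset[OF f] by auto
    have [measurable]: "f \<in> borel_measurable borel" using f by (rule borel_measurable_continuous_onI)
    have "continuous_on UNIV p" using p(1)
      by (simp add: continuous_on_polymonial_function real_polynomial_function_eq)
    then have pm [measurable]: "p \<in> borel_measurable borel" by (rule borel_measurable_continuous_onI)
    have "bounded (f ` {-1..1})" by (intro compact_imp_bounded compact_continuous_image continuous_on_subset[OF f]) auto
    then obtain C where "\<forall>y\<in>f ` {-1..1}. norm y \<le> C" unfolding bounded_iff by blast
    then have C: "\<bar>f x\<bar> \<le> C" if "x \<in> {-1..1}" for x using that by auto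
    have i1: "integrable M (\<lambda>x. G x * f (X x))" by (rule bi[of _ C]) (use C X1 in auto)
    have i2: "integrable M (\<lambda>x. G x * p (X x))"
    proof (rule bi[of _ "C + e"])
      fix x assume "x \<in> space M"
      then show "\<bar>p (X x)\<bar> \<le> C + e" using C[of "X x"] p(2)[of "X x"] X1[of x] by fastforce
    qed simp
    have "I = \<bar>(\<integral>x. G x * f (X x) - G x * p (X x) \<partial>M)\<bar>"
      using i1 i2 poly[OF p(1)] by (simp add: I_def)
    also have "\<dots> \<le> (\<integral>x. \<bar>G x * f (X x) - G x * p (X x)\<bar> \<partial>M)" by (rule integral_abs_bound)
    also have "\<dots> \<le> (\<integral>x. e * \<bar>G x\<bar> \<partial>M)"
    proof (rule integral_mono)
      fix x assume x: "x \<in> space M"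
      have "\<bar>G x * f (X x) - G x * p (X x)\<bar> = \<bar>f (X x) - p (X x)\<bar> * \<bar>G x\<bar>"
        by (simp add: abs_mult[symmetric] algebra_simps)
      also have "\<dots> \<le> e * \<bar>G x\<bar>" using p(2)[OF X1[OF x]] by (intro mult_right_mono) auto
      finally show "\<bar>G x * f (X x) - G x * p (X x)\<bar> \<le> e * \<bar>G x\<bar>" .
    qed (use i1 i2 G in auto)
    also have "\<dots> = e * (\<integral>x. \<bar>G x\<bar> \<partial>M)" by simp
    also have "\<dots> < e * (1 + (\<integral>x. \<bar>G x\<bar> \<partial>M))" using e by simp
    also have "\<dots> = I" using pos unfolding e_def by (simp only: nonzero_eq_divide_eq[symmetric] less_imp_neq[THEN not_sym] times_divide_eq_left) simp
    finally show False by simp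
  qed
  have half_line: "(\<integral>x. G x * indicator {..a} (X x) \<partial>M) = 0" for a
  proof -
    define f where "f n x = max 0 (min 1 (1 - real n * (x - a)))" for n x
    have lim: "(\<lambda>n. f n x) \<longlonglongrightarrow> indicator {..a} x" for x
    proof (cases "x \<le> a")
      case True
      have "f n x = 1" for n
      proof -
        have "real n * (x - a) \<le> 0" using True by (simp add: mult_nonneg_nonpos)
        then show ?thesis by (simp add: f_def)
      qed
      then show ?thesis using True by simp
    next
      case False
      obtain N where N: "real N * (x - a) > 1" using False reals_Archimedean3[of "x - a"] by auto
      have "f n x = 0" if "n \<ge> N" for n
      proof -
        have "real N * (x - a) \<le> real n * (x - a)" using that False by (intro mult_right_mono) auto
        then show ?thesis using N by (simp add: f_def)
      qed
      then have "eventually (\<lambda>n. f n x = 0) sequentially" by (auto simp: eventually_sequentially)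
      then show ?thesis using False by (simp add: tendsto_eventually)
    qed
    have cf: "continuous_on UNIV (f n)" for n unfolding f_def[abs_def] by (intro continuous_intros)
    have [measurable]: "f n \<in> borel_measurable borel" for n using cf by (rule borel_measurable_continuous_onI)
    have "(\<lambda>n. \<integral>x. G x * f n (X x) \<partial>M) \<longlonglongrightarrow> (\<integral>x. G x * indicator {..a} (X x) \<partial>M)"
    proof (rule integral_dominated_convergence[where w = "\<lambda>x. \<bar>G x\<bar>"])
      show "AE x in M. (\<lambda>n. G x * f n (X x)) \<longlonglongrightarrow> G x * indicator {..a} (X x)"
        by (intro AE_I2 tendsto_intros lim)
      show "AE x in M. norm (G x * f n (X x)) \<le> \<bar>G x\<bar>" for n
        by (intro AE_I2) (auto simp: abs_mult f_def intro!: mult_left_le)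
    qed (use G in auto)
    then show ?thesis using LIMSEQ_unique by (simp add: cont[OF cf] LIMSEQ_const_iff)
  qed
  show ?thesis
  proof (rule integrals_zero_on_sigma_algebra[OF G X _ _ _ _ _ A])
    show "sets borel = sigma_sets (space borel) (range (\<lambda>a::real. {..a}))"
      by (subst borel_eq_atMost) simp
    show "Int_stable (range (\<lambda>a::real. {..a}))"
    proof (rule Int_stableI)
      fix a b :: "real set" assume "a \<in> range atMost" "b \<in> range atMost"
      then obtain x y where "a = {..x}" "b = {..y}" by auto
      then have "a \<inter> b = {..min x y}" by auto
      then show "a \<inter> b \<in> range atMost" by auto
    qed
    show "(\<integral>x. G x \<partial>M) = 0" using mom[of 0] by simp
  qed (use half_line in auto)
qed

lemma AE_zero_if_set_integrals_zero:
  fixes g :: "'a \<Rightarrow> real"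
  assumes g: "integrable M g" and z: "\<And>A. A \<in> sets M \<Longrightarrow> (\<integral>x. g x * indicator A x \<partial>M) = 0"
  shows "AE x in M. g x = 0"
proof -
  have [measurable]: "g \<in> borel_measurable M" using g by simp
  have main: "AE x in M. \<not> h x > 0" if h: "integrable M h" "\<And>A. A \<in> sets M \<Longrightarrow> (\<integral>x. h x * indicator A x \<partial>M) = 0" for h :: "'a \<Rightarrow> real"
  proof -
    have [measurable]: "h \<in> borel_measurable M" using h by simp
    let ?A = "{x \<in> space M. h x > 0}"
    have "(\<integral>x. h x * indicator ?A x \<partial>M) = 0" by (rule h(2)) measurable
    moreover have "integrable M (\<lambda>x. h x * indicator ?A x)" by (rule integrable_mult_bounded[OF h(1), of _ 1]) (auto simp: indicator_def)
    ultimately have "AE x in M. h x * indicator ?A x = 0"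
      by (subst (asm) integral_nonneg_eq_0_iff_AE) (auto simp: indicator_def)
    then show ?thesis by (rule AE_mp) (auto intro!: AE_I2 simp: indicator_def)
  qed
  have "AE x in M. \<not> g x > 0" by (rule main[OF g z])
  moreover have "AE x in M. \<not> - g x > 0" by (rule main) (use g z in auto)
  ultimately show ?thesis by eventually_elim auto
qed

text \<open>Membership in the linear span of the univariate basis, with equality asked for on the open
interval only. A separate predicate, because functions on the reals do not form an instance of the
class of real vector spaces.\<close>

definition phi1_combination :: "poly_family \<Rightarrow> (real \<Rightarrow> real) \<Rightarrow> bool" where
  "phi1_combination b f \<longleftrightarrow> (\<exists>N c. \<forall>t\<in>{-1<..<1}. f t = (\<Sum>n<N. c n * phi1 b n t))"

lemma phi1_combination_add:
  assumes "phi1_combination b f" "phi1_combination b g"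
  shows "phi1_combination b (\<lambda>t. x * f t + y * g t)"
proof -
  obtain N c N' c' where f: "\<forall>t\<in>{-1<..<1}. f t = (\<Sum>n<N. c n * phi1 b n t)" and g: "\<forall>t\<in>{-1<..<1}. g t = (\<Sum>n<N'. c' n * phi1 b n t)"
    using assms unfolding phi1_combination_def by blast
  have pad: "(\<Sum>n<M. (if n < N then c n else 0) * phi1 b n t) = (\<Sum>n<N. c n * phi1 b n t)" if "N \<le> M" for N M c t
    using that by (intro sum.mono_neutral_cong_right) auto
  have "x * f t + y * g t = (\<Sum>n<max N N'. (x * (if n < N then c n else 0) + y * (if n < N' then c' n else 0)) * phi1 b n t)" if "t \<in> {-1<..<1}" for t
    using f g that pad[of N "max N N'" c t] pad[of N' "max N N'" c' t]
    by (simp add: distrib_right sum.distrib mult.assoc sum_distrib_left[symmetric])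
  then show ?thesis unfolding phi1_combination_def
    by (intro exI[of _ "max N N'"] exI[of _ "\<lambda>n. x * (if n < N then c n else 0) + y * (if n < N' then c' n else 0)"]) blast
qed

lemma phi1_combination_phi1: "phi1_combination b (phi1 b n)"
  unfolding phi1_combination_def
  by (intro exI[of _ "Suc n"] exI[of _ "\<lambda>k. of_bool (k = n)"]) (auto simp: of_bool_def if_distrib[of "\<lambda>x. x * _"] cong: if_cong)

lemma phi1_combination_cong:
  "phi1_combination b f \<Longrightarrow> (\<And>t. t \<in> {-1<..<1} \<Longrightarrow> f t = g t) \<Longrightarrow> phi1_combination b g"
  unfolding phi1_combination_def by auto

text \<open>The three-term recursion, solved for \<open>t\<close> times the middle term.\<close>

lemma phi1_combination_times_phi1: "phi1_combination b (\<lambda>t. t * phi1 b n t)"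
proof (cases b)
  case Legendre
  have leg: "phi1_combination b (\<lambda>t. legendre n t)" for n
    by (rule phi1_combination_cong[OF phi1_combination_add[OF phi1_combination_phi1[of b n] phi1_combination_phi1[of b n], of "1 / sqrt (2 * real n + 1)" 0]])
       (use Legendre in \<open>simp add: phi1_def\<close>)
  show ?thesis
  proof (cases n)
    case 0
    show ?thesis
      by (rule phi1_combination_cong[OF leg[of 1]]) (use 0 Legendre in \<open>simp add: phi1_def\<close>)
  next
    case (Suc k)
    show ?thesis
    proof (rule phi1_combination_cong[OF phi1_combination_add[OF leg[of "Suc (Suc k)"] leg[of k],
        of "sqrt (2 * real n + 1) * (real k + 2) / (2 * real k + 3)" "sqrt (2 * real n + 1) * (real k + 1) / (2 * real k + 3)"]])
      fix t
      have "(real k + 2) * legendre (Suc (Suc k)) t + (real k + 1) * legendre k t = (2 * real k + 3) * (t * legendre (Suc k) t)"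
        by simp
      then have e: "t * legendre (Suc k) t = ((real k + 2) * legendre (Suc (Suc k)) t + (real k + 1) * legendre k t) / (2 * real k + 3)"
        by (simp add: field_simps del: legendre.simps(3))
      have "t * phi1 b n t = sqrt (2 * real n + 1) * (t * legendre (Suc k) t)" using Legendre Suc by (simp add: phi1_def)
      also have "\<dots> = sqrt (2 * real n + 1) * (real k + 2) / (2 * real k + 3) * legendre (Suc (Suc k)) t + sqrt (2 * real n + 1) * (real k + 1) / (2 * real k + 3) * legendre k t"
      proof -
        have "A * ((B * P + C * Q) / D) = A * B / D * P + A * C / D * Q" for A B C D P Q :: real
          by (simp add: add_divide_distrib distrib_left)
        then show ?thesis unfolding e .
      qed
      finally show "sqrt (2 * real n + 1) * (real k + 2) / (2 * real k + 3) * legendre (Suc (Suc k)) t + sqrt (2 * real n + 1) * (real k + 1) / (2 * real k + 3) * legendre k t = t * phi1 b n t" by simp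
    qed
  qed
next
  case Chebyshev
  have ch: "phi1_combination b (\<lambda>t. cos (real n * arccos t))" for n
    by (rule phi1_combination_cong[OF phi1_combination_add[OF phi1_combination_phi1[of b n] phi1_combination_phi1[of b n], of "if n = 0 then 1 else 1 / sqrt 2" 0]])
       (use Chebyshev in \<open>auto simp: phi1_def\<close>)
  define u where "u = (if n = 0 then 1 else sqrt 2)"
  define k where "k = (if n = 0 then 1 else n - 1)"
  show ?thesis
  proof (rule phi1_combination_cong[OF phi1_combination_add[OF ch[of "Suc n"] ch[of k], of "u / 2" "u / 2"]])
    fix t :: real assume t: "t \<in> {-1<..<1}"
    have ct: "cos (arccos t) = t" using t by (intro cos_arccos) auto
    have "cos (real n * x) * cos x = (cos (real (Suc n) * x) + cos (real k * x)) / 2" for x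
    proof -
      have "cos (real k * x) = cos (real n * x - x)"
        by (cases n) (auto simp: k_def algebra_simps)
      moreover have "cos (real n * x) * cos x = (cos (real n * x - x) + cos (real n * x + x)) / 2"
        by (rule cos_times_cos)
      moreover have "real (Suc n) * x = real n * x + x" by (simp add: algebra_simps)
      ultimately show ?thesis by simp
    qed
    from this[of "arccos t"] have s: "cos (real (Suc n) * arccos t) + cos (real k * arccos t) = 2 * (cos (real n * arccos t) * t)"
      unfolding ct by simp
    have "u / 2 * cos (real (Suc n) * arccos t) + u / 2 * cos (real k * arccos t) = u / 2 * (cos (real (Suc n) * arccos t) + cos (real k * arccos t))"
      by (simp only: distrib_left)
    also have "\<dots> = t * (u * cos (real n * arccos t))" unfolding s by simp
    also have "u * cos (real n * arccos t) = phi1 b n t" using Chebyshev by (simp add: phi1_def u_def)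
    finally show "u / 2 * cos (real (Suc n) * arccos t) + u / 2 * cos (real k * arccos t) = t * phi1 b n t" .
  qed
qed

lemma phi1_combination_power: "phi1_combination b (\<lambda>t. t ^ k)"
proof (induction k)
  case 0
  show ?case by (rule phi1_combination_cong[OF phi1_combination_phi1[of b 0]]) (simp add: phi1_0)
next
  case (Suc k)
  then obtain N c where c: "\<forall>t\<in>{-1<..<1}. t ^ k = (\<Sum>n<N. c n * phi1 b n t)"
    unfolding phi1_combination_def by blast
  have "phi1_combination b (\<lambda>t. \<Sum>n<N. c n * (t * phi1 b n t))"
  proof (induction N)
    case 0
    show ?case by (rule phi1_combination_cong[OF phi1_combination_add[OF phi1_combination_phi1[of b 0] phi1_combination_phi1[of b 0], of 0 0]]) simp
  next
    case (Suc N)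
    from phi1_combination_add[OF Suc phi1_combination_times_phi1[of b N], of 1 "c N"]
    show ?case by simp
  qed
  then show ?case
    by (rule phi1_combination_cong) (use c in \<open>simp add: sum_distrib_left algebra_simps\<close>)
qed

text \<open>All monomials have integral 0 against \<open>g\<close>. In one coordinate after the other the power is
replaced by the indicator of a Borel set, with the remaining factors kept inside the integrable
function of \<open>moments_determine_integrals\<close>. At the end \<open>g\<close> integrates to 0 over every box.\<close>

lemma phi_complete:
  fixes g :: "(nat \<Rightarrow> real) \<Rightarrow> real"
  assumes g: "integrable (nu b d) g"
    and z: "\<And>i. i \<in> multi_idx d \<Longrightarrow> (\<integral>t. g t * phi b d i t \<partial>nu b d) = 0"
  shows "AE t in nu b d. g t = 0"
proof (rule AE_zero_if_set_integrals_zero[OF g])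
  have [measurable]: "g \<in> borel_measurable (nu b d)" using g by simp
  have tl: "(\<lambda>t. t l) \<in> borel_measurable (nu b d)" if "l < d" for l
  proof -
    have "(\<lambda>t. t l) \<in> measurable (nu b d) (nu1 b)" unfolding nu_def using that by (intro measurable_component_singleton) simp
    moreover have "(\<lambda>t. t) \<in> measurable (nu1 b) borel" by (rule measurable_nu1_borel) simp
    ultimately show ?thesis by (rule measurable_compose)
  qed
  have t1: "t l \<in> {-1<..<1}" if "t \<in> space (nu b d)" "l < d" for t l
    using that by (auto simp: space_nu PiE_iff)
  note bi = integrable_mult_bounded[OF g]
  have base: "(\<integral>t. g t * (\<Prod>l<d. t l ^ k l) \<partial>nu b d) = 0" for k
  proof -
    have "\<forall>j. \<exists>N c. \<forall>t\<in>{-1<..<1}. t ^ j = (\<Sum>n<N. c n * phi1 b n t)"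
      using phi1_combination_power unfolding phi1_combination_def by blast
    then obtain N c where c: "\<And>j t. t \<in> {-1<..<1} \<Longrightarrow> t ^ j = (\<Sum>n<N j. c j n * phi1 b n t)" by metis
    let ?P = "\<Pi>\<^sub>E l\<in>{..<d}. {..<N (k l)}"
    have "(\<Prod>l<d. t l ^ k l) = (\<Sum>i\<in>?P. (\<Prod>l<d. c (k l) (i l)) * phi b d i t)" if "t \<in> space (nu b d)" for t
    proof -
      have "(\<Prod>l<d. t l ^ k l) = (\<Prod>l<d. \<Sum>n<N (k l). c (k l) n * phi1 b n (t l))"
        by (intro prod.cong refl c) (use that t1 in auto)
      also have "\<dots> = (\<Sum>i\<in>?P. \<Prod>l<d. c (k l) (i l) * phi1 b (i l) (t l))" by (rule prod_sum_PiE) auto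
      finally show ?thesis by (simp add: phi_def prod.distrib)
    qed
    then have "(\<integral>t. g t * (\<Prod>l<d. t l ^ k l) \<partial>nu b d) = (\<integral>t. (\<Sum>i\<in>?P. (\<Prod>l<d. c (k l) (i l)) * (g t * phi b d i t)) \<partial>nu b d)"
      by (intro Bochner_Integration.integral_cong) (auto simp: sum_distrib_left algebra_simps)
    also have "\<dots> = (\<Sum>i\<in>?P. (\<Prod>l<d. c (k l) (i l)) * (\<integral>t. g t * phi b d i t \<partial>nu b d))"
      by (subst Bochner_Integration.integral_sum) (auto intro!: Bochner_Integration.integrable_mult_right bi phi_bound)
    also have "\<dots> = 0" by (intro sum.neutral ballI) (use z in \<open>auto simp: multi_idx_def PiE_iff\<close>)
    finally show ?thesis .
  qed
  have box: "(\<integral>t. g t * ((\<Prod>l<j. indicator (A l) (t l)) * (\<Prod>l\<in>{j..<d}. t l ^ k l)) \<partial>nu b d) = 0"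
    if A: "\<And>l. A l \<in> sets borel" and "j \<le> d" for A :: "nat \<Rightarrow> real set" and j k
    using \<open>j \<le> d\<close>
  proof (induction j arbitrary: k)
    case 0 then show ?case using base by (simp add: atLeast0LessThan)
  next
    case (Suc j)
    then have jd: "j < d" by simp
    let ?h = "\<lambda>t. (\<Prod>l<j. indicator (A l) (t l)) * (\<Prod>l\<in>{Suc j..<d}. t l ^ k l)"
    have hm: "?h \<in> borel_measurable (nu b d)"
    proof (intro borel_measurable_times borel_measurable_prod borel_measurable_power)
      fix l assume "l \<in> {..<j}"
      then have [measurable]: "(\<lambda>t. t l) \<in> borel_measurable (nu b d)" using jd by (intro tl) auto
      note A[measurable]
      show "(\<lambda>t. indicator (A l) (t l)) \<in> borel_measurable (nu b d)" by measurable
    qed (auto intro!: tl)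
    have hb: "\<bar>?h t\<bar> \<le> 1" if "t \<in> space (nu b d)" for t
    proof -
      have "\<bar>\<Prod>l<j. indicator (A l) (t l) :: real\<bar> \<le> 1" unfolding abs_prod by (rule prod_le_1) (auto simp: indicator_def)
      moreover have "\<bar>\<Prod>l\<in>{Suc j..<d}. t l ^ k l\<bar> \<le> 1" unfolding abs_prod
      proof (rule prod_le_1)
        fix l assume "l \<in> {Suc j..<d}"
        then have "\<bar>t l\<bar> \<le> 1" using t1[OF that, of l] by auto
        then show "0 \<le> \<bar>t l ^ k l\<bar> \<and> \<bar>t l ^ k l\<bar> \<le> 1" by (simp add: power_abs power_le_one)
      qed
      ultimately show ?thesis unfolding abs_mult by (intro mult_le_one) auto
    qed
    have "(\<integral>t. (g t * ?h t) * indicator (A j) (t j) \<partial>nu b d) = 0"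
    proof (rule moments_determine_integrals)
      show "integrable (nu b d) (\<lambda>t. g t * ?h t)" by (rule bi[OF hm hb])
      show "(\<lambda>t. t j) \<in> borel_measurable (nu b d)" by (rule tl[OF jd])
      show "t j \<in> {-1..1}" if "t \<in> space (nu b d)" for t using t1[OF that jd] by simp
      fix n
      have "(\<Prod>l\<in>{j..<d}. t l ^ (k(j := n)) l) = t j ^ n * (\<Prod>l\<in>{Suc j..<d}. t l ^ k l)" for t :: "nat \<Rightarrow> real"
      proof -
        have "{j..<d} = insert j {Suc j..<d}" using jd by auto
        moreover have "(\<Prod>l\<in>{Suc j..<d}. t l ^ (k(j := n)) l) = (\<Prod>l\<in>{Suc j..<d}. t l ^ k l)"
          by (intro prod.cong) auto
        ultimately show ?thesis by simp
      qed
      then show "(\<integral>t. g t * ?h t * t j ^ n \<partial>nu b d) = 0" using Suc.IH[of "k(j := n)"] jd by (simp add: mult_ac)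
    qed (rule A)
    then show ?case by (simp add: mult_ac)
  qed
  fix B assume B: "B \<in> sets (nu b d)"
  have "(\<lambda>t. t) \<in> measurable (nu b d) (nu b d)" by simp
  then show "(\<integral>t. g t * indicator B t \<partial>nu b d) = 0"
  proof (rule integrals_zero_on_sigma_algebra[OF g _ _ Int_stable_prod_algebra _ _ _ B])
    show "sets (nu b d) = sigma_sets (space (nu b d)) (prod_algebra {..<d} (\<lambda>_. nu1 b))"
      unfolding nu_def sets_PiM space_PiM ..
    show "prod_algebra {..<d} (\<lambda>_. nu1 b) \<subseteq> Pow (space (nu b d))"
      unfolding nu_def space_PiM by (rule prod_algebra_sets_into_space)
    show "(\<integral>t. g t \<partial>nu b d) = 0" using base[of "\<lambda>_. 0"] by simp
    fix B assume B: "B \<in> prod_algebra {..<d} (\<lambda>_. nu1 b)"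
    from B obtain C where C: "B = (\<Pi>\<^sub>E l\<in>{..<d}. C l)" "C \<in> (\<Pi> l\<in>{..<d}. sets (nu1 b))"
      unfolding prod_algebra_eq_finite[OF finite_lessThan] by blast
    have "\<forall>l\<in>{..<d}. \<exists>A. A \<in> sets borel \<and> C l = A \<inter> {-1<..<1}"
    proof
      fix l assume "l \<in> {..<d}"
      then have "C l \<in> sets (nu1 b)" using C(2) by (simp add: Pi_iff)
      then obtain A where "A \<in> sets borel" "C l = {-1<..<1} \<inter> A"
        unfolding sets_nu1 sets_restrict_space by blast
      then show "\<exists>A. A \<in> sets borel \<and> C l = A \<inter> {-1<..<1}" by (intro exI[of _ A]) auto
    qed
    then obtain A' where A': "\<And>l. l < d \<Longrightarrow> A' l \<in> sets borel \<and> C l = A' l \<inter> {-1<..<1}" by (metis lessThan_iff)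
    define A where "A l = (if l < d then A' l else {})" for l
    have A: "A l \<in> sets borel" for l using A' by (auto simp: A_def)
    have "indicator B t = (\<Prod>l<d. indicator (A l) (t l) :: real)" if t: "t \<in> space (nu b d)" for t
    proof (cases "t \<in> B")
      case True
      then have "\<forall>l<d. t l \<in> A l" using C(1) A' unfolding A_def by (auto simp: PiE_iff)
      then show ?thesis using True by simp
    next
      case False
      then obtain l where "l < d" "t l \<notin> C l" using t unfolding C(1) by (auto simp: space_nu PiE_iff)
      then have "l < d" "t l \<notin> A l" using A' t1[OF t] unfolding A_def by auto
      then have "(\<Prod>l<d. indicator (A l) (t l) :: real) = 0" by (intro prod_zero bexI[of _ l]) auto
      then show ?thesis using False by simp
    qed
    then have "(\<integral>t. g t * indicator B t \<partial>nu b d) = (\<integral>t. g t * ((\<Prod>l<d. indicator (A l) (t l)) * (\<Prod>l\<in>{d..<d}. t l ^ 0)) \<partial>nu b d)"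
      by (intro Bochner_Integration.integral_cong) auto
    also have "\<dots> = 0" by (rule box[OF A, where k = "\<lambda>_. 0"]) simp
    finally show "(\<integral>t. g t * indicator B t \<partial>nu b d) = 0" .
  qed
qed

section \<open>A multiplicative uniform law for convex hulls\<close>

text \<open>The part of \<open>x\<^sup>2\<close> that lies between the heights \<open>c/2\<close> and \<open>c\<close>. If \<open>\<bar>x\<bar> \<le> 1\<close>, the slices for
\<open>c = 1, 1/2, 1/4, \<dots>\<close> add up to \<open>x\<^sup>2\<close>; each is bounded by \<open>c/2\<close> and varies only for \<open>\<bar>x\<bar>\<close> between
\<open>sqrt (c/2)\<close> and \<open>sqrt c\<close>.\<close>

definition slice :: "real \<Rightarrow> real \<Rightarrow> real" where
  "slice c x = max 0 (min (x\<^sup>2) c - c / 2)"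

lemma slice_bounds: assumes "c \<ge> 0" shows "0 \<le> slice c x" "slice c x \<le> c / 2"
  using assms unfolding slice_def by linarith+

lemma slice_eq: "c \<ge> 0 \<Longrightarrow> slice c x = min (x\<^sup>2) c - min (x\<^sup>2) (c / 2)"
  by (auto simp: slice_def min_def max_def)

lemma borel_measurable_slice [measurable]: "slice c \<in> borel_measurable borel"
  unfolding slice_def[abs_def] by measurable

lemma sum_slice: "(\<Sum>i<L. slice ((1/2) ^ i) x) = min (x\<^sup>2) 1 - min (x\<^sup>2) ((1/2) ^ L)"
  by (induction L) (auto simp: slice_eq)

text \<open>An error of relative size \<open>d\<close> at scale \<open>sqrt c\<close> perturbs the slice by at most \<open>2 d c\<close>, and it perturbs it at all
only where \<open>x\<^sup>2 \<ge> c/4\<close>. There the slice two levels below is full, that is \<open>c/8\<close>. Bounding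
the error by that slice makes the errors of all levels summable to a multiple of \<open>d x\<^sup>2\<close>.\<close>

lemma slice_close:
  assumes "0 \<le> d" "d \<le> 1 / 5" "c > 0" "\<bar>y - x\<bar> \<le> d * sqrt c"
  shows "\<bar>slice c y - slice c x\<bar> \<le> 16 * d * slice (c / 4) x"
proof (cases "x\<^sup>2 < c / 4")
  case True
  have sc: "sqrt c > 0" "sqrt c * sqrt c = c" using assms by auto
  have "\<bar>x\<bar> < sqrt c / 2"
  proof (rule power2_less_imp_less)
    show "\<bar>x\<bar>\<^sup>2 < (sqrt c / 2)\<^sup>2" using True assms by (simp add: power_divide)
  qed (use sc in simp)
  moreover have "d * sqrt c \<le> 1 / 5 * sqrt c" using assms sc by (intro mult_right_mono) auto
  \<comment> \<open>\<open>7/10 = 1/2 + 1/5\<close> has a square below \<open>1/2\<close>, so both slices are empty.\<close>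
  ultimately have "\<bar>y\<bar> \<le> 7 / 10 * sqrt c" using assms(4) by linarith
  then have "\<bar>y\<bar>\<^sup>2 \<le> (7 / 10 * sqrt c)\<^sup>2" by (intro power_mono) auto
  then have "y\<^sup>2 \<le> 49 / 100 * c" using assms by (simp add: power_mult_distrib power_divide)
  then have "slice c y = 0" "slice c x = 0" using assms True by (auto simp: slice_def)
  then show ?thesis using slice_bounds(1)[of "c / 4" x] assms by simp
next
  case False
  then have s4: "slice (c / 4) x = c / 8" using assms by (auto simp: slice_def)
  have "\<bar>slice c y - slice c x\<bar> \<le> \<bar>min (y\<^sup>2) c - min (x\<^sup>2) c\<bar>"
    unfolding slice_def by linarith
  also have "min (z\<^sup>2) c = (min \<bar>z\<bar> (sqrt c))\<^sup>2" for z
  proof (cases "\<bar>z\<bar> \<le> sqrt c")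
    case True then have "\<bar>z\<bar>\<^sup>2 \<le> (sqrt c)\<^sup>2" by (intro power_mono) auto
    with True assms show ?thesis by simp
  next
    case False then have "(sqrt c)\<^sup>2 \<le> \<bar>z\<bar>\<^sup>2" using assms by (intro power_mono) auto
    with False assms show ?thesis by simp
  qed
  then have "\<bar>min (y\<^sup>2) c - min (x\<^sup>2) c\<bar> = \<bar>(min \<bar>y\<bar> (sqrt c))\<^sup>2 - (min \<bar>x\<bar> (sqrt c))\<^sup>2\<bar>" by simp
  also have "\<dots> = \<bar>min \<bar>y\<bar> (sqrt c) - min \<bar>x\<bar> (sqrt c)\<bar> * \<bar>min \<bar>y\<bar> (sqrt c) + min \<bar>x\<bar> (sqrt c)\<bar>"
    by (simp add: power2_eq_square abs_mult[symmetric] algebra_simps)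
  also have "\<dots> \<le> (d * sqrt c) * (2 * sqrt c)"
    using assms by (intro mult_mono) auto
  also have "\<dots> = 16 * d * slice (c / 4) x" unfolding s4 using assms by simp
  finally show ?thesis .
qed

lemma exp_le_1_plus_x_plus_sq: "\<bar>x\<bar> \<le> 1 \<Longrightarrow> exp x \<le> 1 + x + x\<^sup>2" for x :: real
proof -
  assume a: "\<bar>x\<bar> \<le> 1"
  show ?thesis
  proof (cases "x \<ge> 0")
    case True then show ?thesis using exp_bound[of x] a by simp
  next
    case False
    have "1 \<le> (1 + x + x\<^sup>2) * (1 - x)" 
    proof -
      have "(1 + x + x\<^sup>2) * (1 - x) = 1 - x ^ 3" by (simp add: algebra_simps power2_eq_square power3_eq_cube)
      moreover have "x ^ 3 \<le> 0" using False by (auto simp: power_le_zero_eq)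
      ultimately show ?thesis by simp
    qed
    also have "\<dots> \<le> (1 + x + x\<^sup>2) * exp (- x)"
    proof (intro mult_left_mono)
      show "1 - x \<le> exp (- x)" using exp_ge_add_one_self[of "-x"] by simp
      show "0 \<le> 1 + x + x\<^sup>2" using a by simp
    qed
    finally show ?thesis by (simp add: exp_minus field_simps)
  qed
qed

context prob_space
begin

abbreviation sample :: "nat \<Rightarrow> (nat \<Rightarrow> 'a) measure" where
  "sample m \<equiv> PiM {..<m} (\<lambda>_. M)"

lemma nn_integral_prod_sample:
  assumes [measurable]: "h \<in> borel_measurable M"
  shows "(\<integral>\<^sup>+ t. (\<Prod>k<m. h (t k)) \<partial>sample m) = (integral\<^sup>N M h) ^ m"
proof -
  interpret P: product_sigma_finite "\<lambda>_. M" by unfold_locales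
  show ?thesis by (subst P.product_nn_integral_prod) auto
qed

lemma prob_space_sample: "prob_space (sample m)"
  by (intro prob_space_PiM prob_space_axioms)

text \<open>Markov's inequality for the exponential of a sum over the sample, for either sign of \<open>l\<close>.\<close>

lemma exp_moment_tail:
  fixes h :: "'a \<Rightarrow> real"
  assumes [measurable]: "h \<in> borel_measurable M"
    and E: "(\<integral>\<^sup>+ x. ennreal (exp (l * h x)) \<partial>M) \<le> ennreal (exp v)"
  shows "measure (sample m) {t \<in> space (sample m). l * (\<Sum>k<m. h (t k)) \<ge> u} \<le> exp (real m * v - u)"
proof -
  interpret S: prob_space "sample m" by (rule prob_space_sample)
  have "emeasure (sample m) {t \<in> space (sample m). l * (\<Sum>k<m. h (t k)) \<ge> u}
     = emeasure (sample m) {t \<in> space (sample m). 1 \<le> ennreal (exp (- u)) * (\<Prod>k<m. ennreal (exp (l * h (t k))))}"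
  proof (rule arg_cong[of _ _ "emeasure _"], rule Collect_cong, rule conj_cong, rule refl)
    fix t
    have "ennreal (exp (- u)) * (\<Prod>k<m. ennreal (exp (l * h (t k)))) = ennreal (exp (l * (\<Sum>k<m. h (t k)) - u))"
      by (simp add: prod_ennreal ennreal_mult[symmetric] exp_sum[symmetric] sum_distrib_left mult_exp_exp)
    moreover have "1 \<le> ennreal (exp (l * (\<Sum>k<m. h (t k)) - u)) \<longleftrightarrow> u \<le> l * (\<Sum>k<m. h (t k))"
      by (subst ennreal_1[symmetric], subst ennreal_le_iff) auto
    ultimately show "u \<le> l * (\<Sum>k<m. h (t k)) \<longleftrightarrow> 1 \<le> ennreal (exp (- u)) * (\<Prod>k<m. ennreal (exp (l * h (t k))))"
      by simp
  qed
  also have "\<dots> \<le> ennreal (exp (- u)) * (\<integral>\<^sup>+ t. (\<Prod>k<m. ennreal (exp (l * h (t k)))) \<partial>sample m)"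
    by (rule order_trans[OF nn_integral_Markov_inequality[where A="space (sample m)" and u="\<lambda>t. \<Prod>k<m. ennreal (exp (l * h (t k)))"]])
       (auto simp: mult_left_mono nn_integral_mono)
  also have "\<dots> \<le> ennreal (exp (- u)) * ennreal (exp v) ^ m"
    unfolding nn_integral_prod_sample[of "\<lambda>x. ennreal (exp (l * h x))", simplified]
    by (intro mult_left_mono power_mono E) auto
  also have "\<dots> = ennreal (exp (real m * v - u))"
    by (simp add: ennreal_power ennreal_mult[symmetric] exp_of_nat_mult[symmetric] mult_exp_exp)
  finally show ?thesis unfolding S.emeasure_eq_measure by simp
qed

text \<open>The deviation is measured relative to the mean \<open>p\<close>, plus \<open>\<eta>\<close>. Because the variance of \<open>h\<close> is at
most \<open>b p\<close>, the relative part absorbs it, and the exponent contains \<open>1/b\<close> instead of \<open>1/b\<^sup>2\<close>.\<close>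

lemma relative_chernoff:
  fixes h :: "'a \<Rightarrow> real"
  assumes [measurable]: "h \<in> borel_measurable M"
    and h: "\<And>x. x \<in> space M \<Longrightarrow> 0 \<le> h x" "\<And>x. x \<in> space M \<Longrightarrow> h x \<le> b"
    and b: "b > 0" and d: "0 < d" "d \<le> 1"
  defines "p \<equiv> expectation h"
  shows "measure (sample m) {t \<in> space (sample m). \<bar>(\<Sum>k<m. h (t k)) - m * p\<bar> > m * (d * p + \<eta>)}
          \<le> 2 * exp (- (m * d * \<eta> / b))"
proof -
  interpret S: prob_space "sample m" by (rule prob_space_sample)
  have int: "integrable M h"
    by (rule integrable_const_bound[of _ b]) (use h in auto)
  have mom: "(\<integral>\<^sup>+ x. ennreal (exp (l * h x)) \<partial>M) \<le> ennreal (exp (l * p + l\<^sup>2 * b * p))"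
    if l: "\<bar>l\<bar> * b \<le> 1" for l
  proof -
    have bd: "exp (l * h x) \<le> 1 + (l + l\<^sup>2 * b) * h x" if x: "x \<in> space M" for x
    proof -
      have "\<bar>l * h x\<bar> \<le> \<bar>l\<bar> * b" unfolding abs_mult using h[OF x] by (intro mult_left_mono) auto
      then have "exp (l * h x) \<le> 1 + l * h x + (l * h x)\<^sup>2"
        using l by (intro exp_le_1_plus_x_plus_sq) linarith
      also have "(l * h x)\<^sup>2 \<le> l\<^sup>2 * (b * h x)"
        unfolding power_mult_distrib using h[OF x] by (intro mult_left_mono) (auto simp: power2_eq_square mult_right_mono)
      finally show ?thesis by (simp add: algebra_simps)
    qed
    have "(\<integral>\<^sup>+ x. ennreal (exp (l * h x)) \<partial>M) \<le> (\<integral>\<^sup>+ x. ennreal (1 + (l + l\<^sup>2 * b) * h x) \<partial>M)"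
      by (intro nn_integral_mono ennreal_leI bd)
    also have "\<dots> = ennreal (\<integral> x. 1 + (l + l\<^sup>2 * b) * h x \<partial>M)"
    proof (rule nn_integral_eq_integral)
      show "AE x in M. 0 \<le> 1 + (l + l\<^sup>2 * b) * h x"
        using bd by (intro AE_I2) (meson exp_ge_zero order_trans)
    qed (use int in auto)
    also have "(\<integral> x. 1 + (l + l\<^sup>2 * b) * h x \<partial>M) = 1 + (l + l\<^sup>2 * b) * p"
      using int by (simp add: p_def prob_space)
    also have "1 + (l + l\<^sup>2 * b) * p \<le> exp ((l + l\<^sup>2 * b) * p)" by (rule exp_ge_add_one_self)
    finally show ?thesis by (simp add: algebra_simps ennreal_leI)
  qed
  \<comment> \<open>the exponential moments with parameters \<open>d / b\<close> and \<open>- d / b\<close>\<close>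
  define U where "U = {t \<in> space (sample m). d / b * (\<Sum>k<m. h (t k)) \<ge> d / b * (m * ((1 + d) * p + \<eta>))}"
  define V where "V = {t \<in> space (sample m). (- d / b) * (\<Sum>k<m. h (t k)) \<ge> (- d / b) * (m * ((1 - d) * p - \<eta>))}"
  have [measurable]: "U \<in> S.events" "V \<in> S.events" unfolding U_def V_def by measurable
  have "measure (sample m) U \<le> exp (real m * (d / b * p + (d / b)\<^sup>2 * b * p) - d / b * (m * ((1 + d) * p + \<eta>)))"
    unfolding U_def by (rule exp_moment_tail) (use b d mom[of "d / b"] in auto)
  also have "real m * (d / b * p + (d / b)\<^sup>2 * b * p) - d / b * (m * ((1 + d) * p + \<eta>)) = - (m * d * \<eta> / b)"
    using b by (simp add: field_simps power2_eq_square)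
  finally have U: "measure (sample m) U \<le> exp (- (m * d * \<eta> / b))" .
  have "measure (sample m) V \<le> exp (real m * ((- d / b) * p + (- d / b)\<^sup>2 * b * p) - (- d / b) * (m * ((1 - d) * p - \<eta>)))"
    unfolding V_def by (rule exp_moment_tail) (use b d mom[of "- d / b"] in auto)
  also have "real m * ((- d / b) * p + (- d / b)\<^sup>2 * b * p) - (- d / b) * (m * ((1 - d) * p - \<eta>)) = - (m * d * \<eta> / b)"
    using b by (simp add: field_simps power2_eq_square)
  finally have V: "measure (sample m) V \<le> exp (- (m * d * \<eta> / b))" .
  have "measure (sample m) {t \<in> space (sample m). \<bar>(\<Sum>k<m. h (t k)) - m * p\<bar> > m * (d * p + \<eta>)} \<le> measure (sample m) (U \<union> V)"
  proof (rule S.finite_measure_mono)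
    show "{t \<in> space (sample m). \<bar>(\<Sum>k<m. h (t k)) - m * p\<bar> > m * (d * p + \<eta>)} \<subseteq> U \<union> V"
    proof
      fix t assume "t \<in> {t \<in> space (sample m). \<bar>(\<Sum>k<m. h (t k)) - m * p\<bar> > m * (d * p + \<eta>)}"
      then have t: "t \<in> space (sample m)" "\<bar>(\<Sum>k<m. h (t k)) - m * p\<bar> > m * (d * p + \<eta>)" by auto
      from t(2) consider "(\<Sum>k<m. h (t k)) \<ge> m * ((1 + d) * p + \<eta>)" | "(\<Sum>k<m. h (t k)) \<le> m * ((1 - d) * p - \<eta>)"
        by (fastforce simp: algebra_simps)
      then show "t \<in> U \<union> V"
      proof cases
        case 1
        then have "t \<in> U" unfolding U_def using t(1) b d by (auto intro!: mult_left_mono simp del: times_divide_eq_left)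
        then show ?thesis ..
      next
        case 2
        then have "t \<in> V" unfolding V_def using t(1) b d by (auto intro!: mult_left_mono_neg simp del: times_divide_eq_left)
        then show ?thesis ..
      qed
    qed
  qed measurable
  also have "\<dots> \<le> measure (sample m) U + measure (sample m) V"
    by (rule measure_Un_le) measurable
  finally show ?thesis using U V by linarith
qed

lemma slice_expectation_close:
  assumes [measurable]: "g \<in> borel_measurable M" "h \<in> borel_measurable M"
    and d: "0 \<le> d" "d \<le> 1 / 5" and c: "c > 0"
  shows "\<bar>expectation (\<lambda>x. slice c (h x)) - expectation (\<lambda>x. slice c (g x))\<bar>
     \<le> 16 * d * expectation (\<lambda>x. slice (c / 4) (g x)) + c / 2 * prob {x \<in> space M. \<bar>h x - g x\<bar> > d * sqrt c}"
proof -
  let ?B = "{x \<in> space M. \<bar>h x - g x\<bar> > d * sqrt c}"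
  have i: "integrable M (\<lambda>x. slice b (f x))" if "b > 0" "f \<in> borel_measurable M" for b f
    by (rule integrable_const_bound[of _ "b / 2"]) (use that slice_bounds[of b] in auto)
  have iB: "integrable M (indicator ?B :: _ \<Rightarrow> real)"
    by (rule integrable_real_indicator) (auto simp: emeasure_eq_measure)
  have "\<bar>expectation (\<lambda>x. slice c (h x)) - expectation (\<lambda>x. slice c (g x))\<bar>
     = \<bar>expectation (\<lambda>x. slice c (h x) - slice c (g x))\<bar>"
    using c by (subst Bochner_Integration.integral_diff) (auto intro: i)
  also have "\<dots> \<le> expectation (\<lambda>x. \<bar>slice c (h x) - slice c (g x)\<bar>)"
    by (rule integral_abs_bound)
  also have "\<dots> \<le> expectation (\<lambda>x. 16 * d * slice (c / 4) (g x) + c / 2 * indicator ?B x)"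
  proof (rule integral_mono)
    fix x assume x: "x \<in> space M"
    show "\<bar>slice c (h x) - slice c (g x)\<bar> \<le> 16 * d * slice (c / 4) (g x) + c / 2 * indicator ?B x"
    proof (cases "x \<in> ?B")
      case True
      have "\<bar>slice c (h x) - slice c (g x)\<bar> \<le> c / 2"
        using slice_bounds[of c "h x"] slice_bounds[of c "g x"] c by linarith
      moreover have "0 \<le> 16 * d * slice (c / 4) (g x)"
        using slice_bounds(1)[of "c / 4" "g x"] d c by simp
      ultimately show ?thesis using True by simp
    next
      case False
      then show ?thesis using slice_close[OF d c, of "h x" "g x"] x by auto
    qed
  qed (use c i iB in auto)
  also have "\<dots> = 16 * d * expectation (\<lambda>x. slice (c / 4) (g x)) + c / 2 * prob ?B"
    using c i[of "c / 4" g] iB by (subst Bochner_Integration.integral_add) auto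
  finally show ?thesis .
qed

lemma expectation_square_slices:
  assumes [measurable]: "g \<in> borel_measurable M" and g: "\<And>x. x \<in> space M \<Longrightarrow> \<bar>g x\<bar> \<le> 1"
  shows "expectation (\<lambda>x. (g x)\<^sup>2)
     = (\<Sum>i<L. expectation (\<lambda>x. slice ((1/2) ^ i) (g x))) + expectation (\<lambda>x. min ((g x)\<^sup>2) ((1/2) ^ L))"
proof -
  have i: "integrable M (\<lambda>x. slice b (g x))" if "b > 0" for b
    by (rule integrable_const_bound[of _ "b / 2"]) (use that slice_bounds[of b] in auto)
  have im: "integrable M (\<lambda>x. min ((g x)\<^sup>2) ((1/2) ^ L))"
    by (rule integrable_const_bound[of _ "(1/2) ^ L"]) auto
  have "expectation (\<lambda>x. (g x)\<^sup>2) = expectation (\<lambda>x. (\<Sum>i<L. slice ((1/2) ^ i) (g x)) + min ((g x)\<^sup>2) ((1/2) ^ L))"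
    by (rule Bochner_Integration.integral_cong) (use g in \<open>auto simp: sum_slice min_def abs_square_le_1\<close>)
  also have "\<dots> = (\<Sum>i<L. expectation (\<lambda>x. slice ((1/2) ^ i) (g x))) + expectation (\<lambda>x. min ((g x)\<^sup>2) ((1/2) ^ L))"
    by (subst Bochner_Integration.integral_add) (auto intro!: i im Bochner_Integration.integral_sum Bochner_Integration.integrable_sum)
  finally show ?thesis .
qed

lemma sum_shifted_slices_le:
  assumes [measurable]: "g \<in> borel_measurable M" and g: "\<And>x. x \<in> space M \<Longrightarrow> \<bar>g x\<bar> \<le> 1"
  shows "(\<Sum>i<L. expectation (\<lambda>x. slice ((1/2) ^ i / 4) (g x))) \<le> expectation (\<lambda>x. (g x)\<^sup>2)"
proof -
  have "(\<Sum>i<L. expectation (\<lambda>x. slice ((1/2) ^ i / 4) (g x))) = (\<Sum>i=2..<L + 2. expectation (\<lambda>x. slice ((1/2) ^ i) (g x)))"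
    by (rule sum.reindex_bij_witness[of _ "\<lambda>i. i - 2" "\<lambda>i. i + 2"]) (auto simp: power_add power2_eq_square)
  also have "\<dots> \<le> (\<Sum>i<L + 2. expectation (\<lambda>x. slice ((1/2) ^ i) (g x)))"
    by (rule sum_mono2) (auto intro!: Bochner_Integration.integral_nonneg slice_bounds(1))
  also have "\<dots> \<le> expectation (\<lambda>x. (g x)\<^sup>2)"
  proof -
    have "0 \<le> expectation (\<lambda>x. min ((g x)\<^sup>2) ((1/2) ^ (L + 2)))"
      by (rule Bochner_Integration.integral_nonneg) simp
    then show ?thesis using expectation_square_slices[OF assms, of "L + 2"] by linarith
  qed
  finally show ?thesis .
qed

text \<open>The deterministic core. \<open>Q\<close> is another probability measure, later the empirical one. If on each
dyadic level \<open>g\<close> has an approximation \<open>h\<^sub>i\<close> which is rarely bad for either measure, and for which the means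
of the slice under the two measures agree well, then the means of \<open>g\<^sup>2\<close> agree well.\<close>

lemma square_deviation_from_slices:
  fixes Q :: "'a measure" and g :: "'a \<Rightarrow> real" and h :: "nat \<Rightarrow> 'a \<Rightarrow> real"
  assumes Q: "prob_space Q" and QM: "sets Q = sets M"
    and [measurable]: "g \<in> borel_measurable M" "\<And>i. h i \<in> borel_measurable M"
    and g: "\<And>x. x \<in> space M \<Longrightarrow> \<bar>g x\<bar> \<le> 1"
    and d: "0 < d" "d \<le> 1 / 32" and L: "0 < L" "(1/2) ^ L \<le> \<eta>"
    and bad: "\<And>i. i < L \<Longrightarrow> measure Q {x \<in> space M. \<bar>h i x - g x\<bar> > d * sqrt ((1/2) ^ i)}
                + prob {x \<in> space M. \<bar>h i x - g x\<bar> > d * sqrt ((1/2) ^ i)} \<le> \<eta>"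
    and dev: "\<And>i. i < L \<Longrightarrow> \<bar>(\<integral>x. slice ((1/2) ^ i) (h i x) \<partial>Q) - (\<integral>x. slice ((1/2) ^ i) (h i x) \<partial>M)\<bar>
                \<le> d * (\<integral>x. slice ((1/2) ^ i) (h i x) \<partial>M) + \<eta> / L"
  shows "\<bar>(\<integral>x. (g x)\<^sup>2 \<partial>Q) - (\<integral>x. (g x)\<^sup>2 \<partial>M)\<bar> \<le> 67 * d * (\<integral>x. (g x)\<^sup>2 \<partial>M) + 8 * \<eta>"
proof -
  interpret Q: prob_space Q by fact
  note [measurable_cong] = QM
  have sp: "space Q = space M" using QM by (rule sets_eq_imp_space_eq)
  define c :: "nat \<Rightarrow> real" where "c i = (1/2) ^ i" for i
  have c: "c i > 0" for i by (simp add: c_def)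
  define PG QG where "PG = (\<integral>x. (g x)\<^sup>2 \<partial>M)" "QG = (\<integral>x. (g x)\<^sup>2 \<partial>Q)"
  define Ps Qs Ph Qh P4 Q4 where
    "Ps i = (\<integral>x. slice (c i) (g x) \<partial>M)" "Qs i = (\<integral>x. slice (c i) (g x) \<partial>Q)"
    "Ph i = (\<integral>x. slice (c i) (h i x) \<partial>M)" "Qh i = (\<integral>x. slice (c i) (h i x) \<partial>Q)"
    "P4 i = (\<integral>x. slice (c i / 4) (g x) \<partial>M)" "Q4 i = (\<integral>x. slice (c i / 4) (g x) \<partial>Q)" for i
  define PB QB where "PB i = prob {x \<in> space M. \<bar>h i x - g x\<bar> > d * sqrt (c i)}"
    "QB i = measure Q {x \<in> space M. \<bar>h i x - g x\<bar> > d * sqrt (c i)}" for i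
  define Pm Qm where "Pm = (\<integral>x. min ((g x)\<^sup>2) (c L) \<partial>M)" "Qm = (\<integral>x. min ((g x)\<^sup>2) (c L) \<partial>Q)"
  note defs = PG_QG_def Ps_Qs_Ph_Qh_P4_Q4_def PB_QB_def Pm_Qm_def
  have P: "\<bar>Ph i - Ps i\<bar> \<le> 16 * d * P4 i + c i / 2 * PB i" for i
    unfolding defs by (rule slice_expectation_close) (use d c in auto)
  have Q: "\<bar>Qh i - Qs i\<bar> \<le> 16 * d * Q4 i + c i / 2 * QB i" for i
    unfolding defs sp[symmetric] by (rule Q.slice_expectation_close) (use d c in auto)
  have bd: "QB i + PB i \<le> \<eta>" if "i < L" for i using bad[OF that] unfolding defs c_def .
  have dv: "\<bar>Qh i - Ph i\<bar> \<le> d * Ph i + \<eta> / L" if "i < L" for i using dev[OF that] unfolding defs c_def .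
  have PGs: "PG = (\<Sum>i<L. Ps i) + Pm" unfolding defs c_def by (rule expectation_square_slices) (use g in auto)
  have QGs: "QG = (\<Sum>i<L. Qs i) + Qm" unfolding defs c_def by (rule Q.expectation_square_slices) (use g sp in auto)
  have P4: "(\<Sum>i<L. P4 i) \<le> PG" unfolding defs c_def by (rule sum_shifted_slices_le) (use g in auto)
  have Q4: "(\<Sum>i<L. Q4 i) \<le> QG" unfolding defs c_def by (rule Q.sum_shifted_slices_le) (use g sp in auto)
  have "\<eta> \<ge> 0" using L(2) by (meson dual_order.trans zero_le_power zero_le_divide_1_iff zero_le_numeral)
  have m: "0 \<le> Pm" "0 \<le> Qm" "Pm \<le> \<eta>" "Qm \<le> \<eta>"
  proof -
    show "0 \<le> Pm" "0 \<le> Qm" using c[of L] unfolding defs by (auto intro!: Bochner_Integration.integral_nonneg)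
    have "integrable M (\<lambda>x. min ((g x)\<^sup>2) (c L))" "integrable Q (\<lambda>x. min ((g x)\<^sup>2) (c L))"
      using c[of L] by (auto intro!: integrable_const_bound[of _ "c L"] Q.integrable_const_bound[of _ "c L"])
    then have "Pm \<le> c L" "Qm \<le> c L" unfolding defs
      by (auto intro!: integral_le_const Q.integral_le_const)
    then show "Pm \<le> \<eta>" "Qm \<le> \<eta>" using L(2) unfolding c_def by auto
  qed
  have PB0: "PB i \<ge> 0" "QB i \<ge> 0" for i unfolding defs by auto
  have P40: "P4 i \<ge> 0" for i unfolding defs using c[of i] by (auto intro!: Bochner_Integration.integral_nonneg slice_bounds(1))
  have PG0: "PG \<ge> 0" unfolding defs by (auto intro!: Bochner_Integration.integral_nonneg)
  have one: "\<bar>Qs i - Ps i\<bar> \<le> 16 * d * Q4 i + (16 * d + d / 2) * P4 i + d * Ps i + 33 / 32 * \<eta> * (c i / 2) + \<eta> / L"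
    if i: "i < L" for i
  proof -
    have Ph: "Ph i \<le> Ps i + 16 * d * P4 i + c i / 2 * PB i" using P[of i] by linarith
    have "d * Ph i \<le> d * (Ps i + 16 * d * P4 i + c i / 2 * PB i)" using Ph d by (intro mult_left_mono) auto
    also have "\<dots> = d * Ps i + (16 * d) * (d * P4 i) + d * (c i / 2 * PB i)" by (simp add: algebra_simps)
    finally have "d * Ph i \<le> d * Ps i + (16 * d) * (d * P4 i) + d * (c i / 2 * PB i)" .
    moreover have "(16 * d) * (d * P4 i) \<le> (1 / 2) * (d * P4 i)" using d P40[of i] by (intro mult_right_mono) auto
    moreover have "d * (c i / 2 * PB i) \<le> 1 / 32 * (c i / 2 * PB i)" using d PB0[of i] c[of i] by (intro mult_right_mono) auto
    ultimately have "\<bar>Qs i - Ps i\<bar> \<le> 16 * d * Q4 i + (16 * d + d / 2) * P4 i + d * Ps i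
        + (c i / 2 * QB i + 33 / 32 * (c i / 2 * PB i)) + \<eta> / L"
      using P[of i] Q[of i] dv[OF i] by (simp add: algebra_simps)
    moreover have "c i / 2 * QB i + 33 / 32 * (c i / 2 * PB i) \<le> 33 / 32 * \<eta> * (c i / 2)"
    proof -
      have "c i / 2 * QB i \<le> 33 / 32 * (c i / 2 * QB i)" using PB0[of i] c[of i] by simp
      then have "c i / 2 * QB i + 33 / 32 * (c i / 2 * PB i) \<le> 33 / 32 * (c i / 2) * (QB i + PB i)"
        by (simp add: algebra_simps)
      also have "\<dots> \<le> 33 / 32 * (c i / 2) * \<eta>" using bd[OF i] c[of i] by (intro mult_left_mono) auto
      finally show ?thesis by (simp add: algebra_simps)
    qed
    ultimately show ?thesis by linarith
  qed
  have cs: "(\<Sum>i<L. c i / 2) \<le> 1"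
  proof -
    have "(\<Sum>i<n. c i / 2) = 1 - c n" for n by (induction n) (auto simp: c_def)
    then show ?thesis using c[of L] by simp
  qed
  have "\<bar>QG - PG\<bar> \<le> (\<Sum>i<L. \<bar>Qs i - Ps i\<bar>) + \<bar>Qm - Pm\<bar>"
    unfolding PGs QGs using sum_abs[of "\<lambda>i. Qs i - Ps i" "{..<L}"] by (simp add: sum_subtractf)
  also have "\<bar>Qm - Pm\<bar> \<le> \<eta>" using m by linarith
  also have "(\<Sum>i<L. \<bar>Qs i - Ps i\<bar>) \<le> (\<Sum>i<L. 16 * d * Q4 i + (16 * d + d / 2) * P4 i + d * Ps i + 33 / 32 * \<eta> * (c i / 2) + \<eta> / L)"
    by (intro sum_mono one) simp
  also have "\<dots> = 16 * d * (\<Sum>i<L. Q4 i) + (16 * d + d / 2) * (\<Sum>i<L. P4 i) + d * (\<Sum>i<L. Ps i) + 33 / 32 * \<eta> * (\<Sum>i<L. c i / 2) + \<eta>"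
    using L by (simp add: sum.distrib sum_distrib_left[symmetric] sum_divide_distrib[symmetric])
  also have "\<dots> \<le> 16 * d * QG + (16 * d + d / 2) * PG + d * PG + 33 / 32 * \<eta> * 1 + \<eta>"
  proof -
    have "(\<Sum>i<L. Ps i) \<le> PG" using PGs m by simp
    then show ?thesis using d \<open>\<eta> \<ge> 0\<close> P4 Q4 cs
      by (intro add_mono mult_left_mono) auto
  qed
  finally have W: "\<bar>QG - PG\<bar> \<le> 16 * d * QG + (16 * d + d / 2) * PG + d * PG + 33 / 32 * \<eta> * 1 + \<eta> + \<eta>" by linarith
  \<comment> \<open>Since \<open>16 d \<le> 1/2\<close>, the deviation hidden in \<open>QG\<close> on the right is absorbed on the left.\<close>
  define D where "D = \<bar>QG - PG\<bar>"
  have "QG \<le> PG + D" unfolding D_def by linarith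
  then have "16 * d * QG \<le> 16 * d * (PG + D)" using d by (intro mult_left_mono) auto
  also have "\<dots> = 16 * d * PG + (16 * d) * D" by (simp add: algebra_simps)
  finally have "16 * d * QG \<le> 16 * d * PG + (16 * d) * D" .
  moreover have "(16 * d) * D \<le> (1 / 2) * D" using d by (intro mult_right_mono) (auto simp: D_def)
  ultimately have "D / 2 \<le> 16 * d * PG + (16 * d + d / 2) * PG + d * PG + 4 * \<eta>" using W[folded D_def] \<open>\<eta> \<ge> 0\<close> by linarith
  then have "\<bar>QG - PG\<bar> \<le> 67 * d * PG + 8 * \<eta>" by (simp add: algebra_simps D_def)
  then show ?thesis unfolding defs .
qed

end

text \<open>Maurey's empirical method with \<open>N\<close> independent choices from \<open>J\<close> with probabilities \<open>p\<close>, at a single point: \<open>v\<close>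
lists the values of the dictionary there. The expectation over the choices is written as a finite sum, so that its
exchange with an integral over the points is harmless.\<close>

lemma maurey_pointwise:
  fixes p :: "'j \<Rightarrow> real" and v :: "'j \<Rightarrow> real" and N :: nat and r :: real
  assumes J: "finite J" and p: "\<And>j. j \<in> J \<Longrightarrow> p j \<ge> 0" "sum p J = 1"
    and v: "\<And>j. j \<in> J \<Longrightarrow> \<bar>v j\<bar> \<le> 1" and r: "0 < r" "r \<le> 1" and N: "0 < N"
  defines "g \<equiv> \<Sum>j\<in>J. p j * v j"
  shows "(\<Sum>\<omega> \<in> {..<N} \<rightarrow>\<^sub>E J. (\<Prod>k<N. p (\<omega> k)) * of_bool (\<bar>(\<Sum>k<N. v (\<omega> k)) / N - g\<bar> > r)) \<le> 2 * exp (- (N * r\<^sup>2 / 4))"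
proof -
  have gb: "\<bar>g\<bar> \<le> 1"
  proof -
    have "\<bar>g\<bar> \<le> (\<Sum>j\<in>J. \<bar>p j * v j\<bar>)" unfolding g_def by (rule sum_abs)
    also have "\<dots> \<le> (\<Sum>j\<in>J. p j)" using p v by (intro sum_mono) (simp add: abs_mult mult_left_le)
    finally show ?thesis using p by simp
  qed
  have var: "(\<Sum>j\<in>J. p j * (v j - g)\<^sup>2) \<le> 1"
  proof -
    have "(\<Sum>j\<in>J. p j * (v j - g)\<^sup>2) = (\<Sum>j\<in>J. p j * (v j)\<^sup>2) - 2 * g * (\<Sum>j\<in>J. p j * v j) + g\<^sup>2 * sum p J"
      by (simp add: power2_eq_square algebra_simps sum.distrib sum_subtractf sum_distrib_left)
    also have "\<dots> = (\<Sum>j\<in>J. p j * (v j)\<^sup>2) - g\<^sup>2" using p by (simp add: g_def[symmetric] power2_eq_square)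
    also have "\<dots> \<le> (\<Sum>j\<in>J. p j * 1) - g\<^sup>2"
      using p v by (intro diff_right_mono sum_mono mult_left_mono) (auto simp: abs_square_le_1)
    also have "\<dots> \<le> 1" using p by simp
    finally show ?thesis .
  qed
  \<comment> \<open>The exponents stay in \<open>[-1, 1]\<close> for \<open>\<bar>l\<bar> \<le> 1/2\<close>, which covers the values \<open>r / 2\<close> and \<open>- r / 2\<close> used below.\<close>
  have mom: "(\<Sum>j\<in>J. p j * exp (l * (v j - g))) \<le> exp (l\<^sup>2)" if l: "\<bar>l\<bar> \<le> 1 / 2" for l
  proof -
    have "(\<Sum>j\<in>J. p j * exp (l * (v j - g))) \<le> (\<Sum>j\<in>J. p j * (1 + l * (v j - g) + (l * (v j - g))\<^sup>2))"
    proof (intro sum_mono mult_left_mono exp_le_1_plus_x_plus_sq p)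
      fix j assume j: "j \<in> J"
      have "\<bar>l * (v j - g)\<bar> \<le> 1 / 2 * 2" unfolding abs_mult using l gb v[OF j] by (intro mult_mono) auto
      then show "\<bar>l * (v j - g)\<bar> \<le> 1" by simp
    qed
    also have "\<dots> = (\<Sum>j\<in>J. p j + l * (p j * v j) - l * g * p j + l\<^sup>2 * (p j * (v j - g)\<^sup>2))"
      by (intro sum.cong refl) (simp add: power2_eq_square algebra_simps)
    also have "\<dots> = sum p J + l * (\<Sum>j\<in>J. p j * v j) - l * g * sum p J + l\<^sup>2 * (\<Sum>j\<in>J. p j * (v j - g)\<^sup>2)"
      by (simp add: sum.distrib sum_subtractf sum_distrib_left[symmetric])
    also have "\<dots> \<le> 1 + l\<^sup>2" using var p by (simp add: g_def[symmetric] mult_left_le)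
    also have "\<dots> \<le> exp (l\<^sup>2)" by (rule exp_ge_add_one_self)
    finally show ?thesis .
  qed
  let ?S = "\<lambda>\<omega>. \<Sum>k<N. (v (\<omega> k) - g)"
  have half: "(\<Sum>\<omega> \<in> {..<N} \<rightarrow>\<^sub>E J. (\<Prod>k<N. p (\<omega> k)) * exp (l * ?S \<omega>)) \<le> exp (N * l\<^sup>2)" if l: "\<bar>l\<bar> \<le> 1 / 2" for l :: real
  proof -
    have "(\<Sum>\<omega> \<in> {..<N} \<rightarrow>\<^sub>E J. (\<Prod>k<N. p (\<omega> k)) * exp (l * ?S \<omega>))
       = (\<Sum>\<omega> \<in> {..<N} \<rightarrow>\<^sub>E J. (\<Prod>k<N. p (\<omega> k) * exp (l * (v (\<omega> k) - g))))"
      by (simp add: prod.distrib exp_sum sum_distrib_left)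
    also have "\<dots> = (\<Prod>k<N. \<Sum>j\<in>J. p j * exp (l * (v j - g)))"
      using J by (subst prod_sum_PiE) auto
    also have "\<dots> \<le> exp (l\<^sup>2) ^ N"
      using mom[OF l] p by (simp add: power_mono sum_nonneg)
    finally show ?thesis by (simp add: exp_of_nat_mult)
  qed
  have "(\<Sum>\<omega> \<in> {..<N} \<rightarrow>\<^sub>E J. (\<Prod>k<N. p (\<omega> k)) * of_bool (\<bar>(\<Sum>k<N. v (\<omega> k)) / N - g\<bar> > r))
     \<le> (\<Sum>\<omega> \<in> {..<N} \<rightarrow>\<^sub>E J. (\<Prod>k<N. p (\<omega> k)) * (exp (- (N * r\<^sup>2 / 2)) * (exp (r / 2 * ?S \<omega>) + exp (- r / 2 * ?S \<omega>))))"
  proof (intro sum_mono mult_left_mono prod_nonneg)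
    fix \<omega> assume w: "\<omega> \<in> {..<N} \<rightarrow>\<^sub>E J"
    then show "\<And>k. k \<in> {..<N} \<Longrightarrow> 0 \<le> p (\<omega> k)" using p by (auto simp: PiE_iff)
    have S: "(\<Sum>k<N. v (\<omega> k)) / N - g = ?S \<omega> / N" using N by (simp add: sum_subtractf diff_divide_distrib)
    have "1 \<le> exp (- (N * r\<^sup>2 / 2)) * (exp (r / 2 * s) + exp (- r / 2 * s))" if "\<bar>s / N\<bar> > r" for s
    proof -
      have "\<bar>s\<bar> > r * N" using that N by (simp add: field_simps abs_divide)
      then have "r / 2 * \<bar>s\<bar> \<ge> r / 2 * (r * N)" using r by (intro mult_left_mono) auto
      then have "exp (N * r\<^sup>2 / 2) \<le> exp (r / 2 * \<bar>s\<bar>)" by (simp add: power2_eq_square algebra_simps)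
      also have "\<dots> \<le> exp (r / 2 * s) + exp (- r / 2 * s)"
        by (cases "s \<ge> 0") (auto simp: algebra_simps)
      finally show ?thesis by (simp add: exp_minus field_simps)
    qed
    then show "of_bool (\<bar>(\<Sum>k<N. v (\<omega> k)) / N - g\<bar> > r) \<le> exp (- (N * r\<^sup>2 / 2)) * (exp (r / 2 * ?S \<omega>) + exp (- r / 2 * ?S \<omega>))"
      unfolding S by (auto simp: of_bool_def)
  qed
  also have "\<dots> = exp (- (N * r\<^sup>2 / 2)) * ((\<Sum>\<omega> \<in> {..<N} \<rightarrow>\<^sub>E J. (\<Prod>k<N. p (\<omega> k)) * exp (r / 2 * ?S \<omega>))
      + (\<Sum>\<omega> \<in> {..<N} \<rightarrow>\<^sub>E J. (\<Prod>k<N. p (\<omega> k)) * exp (- r / 2 * ?S \<omega>)))"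
    by (simp add: sum_distrib_left sum.distrib algebra_simps)
  also have "\<dots> \<le> exp (- (N * r\<^sup>2 / 2)) * (exp (N * (r / 2)\<^sup>2) + exp (N * (- r / 2)\<^sup>2))"
    using r by (intro mult_left_mono add_mono half) auto
  also have "\<dots> = 2 * exp (- (N * r\<^sup>2 / 4))"
    by (simp add: mult_exp_exp power_divide distrib_left)
  finally show ?thesis .
qed


text \<open>Averaging \<open>maurey_pointwise\<close> over the points shows that some choice is good for both measures
simultaneously.\<close>

lemma (in prob_space) maurey_net:
  fixes Q :: "'a measure" and v :: "'j \<Rightarrow> 'a \<Rightarrow> real" and p :: "'j \<Rightarrow> real" and N :: nat and r :: real
  assumes Q: "prob_space Q" and QM: "sets Q = sets M"
    and J: "finite J" and p: "\<And>j. j \<in> J \<Longrightarrow> p j \<ge> 0" "sum p J = 1"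
    and vm: "\<And>j. j \<in> J \<Longrightarrow> v j \<in> borel_measurable M"
    and v: "\<And>j x. j \<in> J \<Longrightarrow> x \<in> space M \<Longrightarrow> \<bar>v j x\<bar> \<le> 1" and r: "0 < r" "r \<le> 1" and N: "0 < N"
  defines "g \<equiv> \<lambda>x. \<Sum>j\<in>J. p j * v j x"
  obtains \<omega> where "\<omega> \<in> {..<N} \<rightarrow>\<^sub>E J"
    "measure Q {x \<in> space M. \<bar>(\<Sum>k<N. v (\<omega> k) x) / N - g x\<bar> > r}
     + prob {x \<in> space M. \<bar>(\<Sum>k<N. v (\<omega> k) x) / N - g x\<bar> > r} \<le> 4 * exp (- (N * r\<^sup>2 / 4))"
proof -
  let ?W = "{..<N} \<rightarrow>\<^sub>E J"
  let ?w = "\<lambda>\<omega>. \<Prod>k<N. p (\<omega> k)"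
  let ?B = "\<lambda>\<omega>. {x \<in> space M. \<bar>(\<Sum>k<N. v (\<omega> k) x) / N - g x\<bar> > r}"
  have fin: "finite ?W" using J by (intro finite_PiE) auto
  have gm [measurable]: "g \<in> borel_measurable M" unfolding g_def using vm by auto
  have B: "?B \<omega> \<in> sets M" if "\<omega> \<in> ?W" for \<omega>
  proof -
    have [measurable]: "(\<lambda>x. \<Sum>k<N. v (\<omega> k) x) \<in> borel_measurable M"
      using that vm by (intro borel_measurable_sum) (auto simp: PiE_iff)
    show ?thesis by measurable
  qed
  have w0: "?w \<omega> \<ge> 0" if "\<omega> \<in> ?W" for \<omega> using that p by (auto intro!: prod_nonneg simp: PiE_iff)
  have w1: "(\<Sum>\<omega>\<in>?W. ?w \<omega>) = 1"
  proof -
    have "(\<Prod>k<N. sum p J) = (\<Sum>\<omega>\<in>?W. ?w \<omega>)"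
      by (rule prod_sum_PiE) (use J in auto)
    then show ?thesis using p by simp
  qed
  have half: "(\<Sum>\<omega>\<in>?W. ?w \<omega> * measure R (?B \<omega>)) \<le> 2 * exp (- (N * r\<^sup>2 / 4))" if R: "prob_space R" and RM: "sets R = sets M" for R
  proof -
    interpret R: prob_space R by (rule R)
    have sp: "space R = space M" using RM by (rule sets_eq_imp_space_eq)
    have i: "integrable R (\<lambda>x. ?w \<omega> * indicator (?B \<omega>) x)" if "\<omega> \<in> ?W" for \<omega>
      using B[OF that] RM by (auto intro!: Bochner_Integration.integrable_mult_right integrable_real_indicator simp: R.emeasure_eq_measure)
    have "(\<Sum>\<omega>\<in>?W. ?w \<omega> * measure R (?B \<omega>)) = (\<Sum>\<omega>\<in>?W. \<integral>x. ?w \<omega> * indicator (?B \<omega>) x \<partial>R)"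
      using B sp by (intro sum.cong refl) (simp add: Int_absorb2 sets.sets_into_space)
    also have "\<dots> = (\<integral>x. (\<Sum>\<omega>\<in>?W. ?w \<omega> * indicator (?B \<omega>) x) \<partial>R)"
      by (rule Bochner_Integration.integral_sum[symmetric]) (rule i)
    also have "\<dots> \<le> 2 * exp (- (N * r\<^sup>2 / 4))"
    proof (rule R.integral_le_const)
      show "integrable R (\<lambda>x. \<Sum>\<omega>\<in>?W. ?w \<omega> * indicator (?B \<omega>) x)"
        by (intro Bochner_Integration.integrable_sum i)
      show "AE x in R. (\<Sum>\<omega>\<in>?W. ?w \<omega> * indicator (?B \<omega>) x) \<le> 2 * exp (- (N * r\<^sup>2 / 4))"
      proof (rule AE_I2)
        fix x assume "x \<in> space R"
        then have x: "x \<in> space M" using sp by simp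
        have "(\<Sum>\<omega>\<in>?W. ?w \<omega> * indicator (?B \<omega>) x) = (\<Sum>\<omega>\<in>?W. ?w \<omega> * of_bool (\<bar>(\<Sum>k<N. v (\<omega> k) x) / N - (\<Sum>j\<in>J. p j * v j x)\<bar> > r))"
          using x by (intro sum.cong refl) (auto simp: g_def)
        also have "\<dots> \<le> 2 * exp (- (N * r\<^sup>2 / 4))"
          by (rule maurey_pointwise) (use J p v x r N in auto)
        finally show "(\<Sum>\<omega>\<in>?W. ?w \<omega> * indicator (?B \<omega>) x) \<le> 2 * exp (- (N * r\<^sup>2 / 4))" .
      qed
    qed
    finally show ?thesis .
  qed
  have "\<exists>\<omega>\<in>?W. measure Q (?B \<omega>) + prob (?B \<omega>) \<le> 4 * exp (- (N * r\<^sup>2 / 4))"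
  proof (rule ccontr)
    assume "\<not> ?thesis"
    then have gt: "measure Q (?B \<omega>) + prob (?B \<omega>) > 4 * exp (- (N * r\<^sup>2 / 4))" if "\<omega> \<in> ?W" for \<omega>
      using that by force
    have ex: "\<exists>\<omega>\<in>?W. ?w \<omega> > 0"
    proof (rule ccontr)
      assume "\<not> ?thesis"
      then have "(\<Sum>\<omega>\<in>?W. ?w \<omega>) \<le> 0" by (intro sum_nonpos) force
      then show False using w1 by simp
    qed
    have "4 * exp (- (N * r\<^sup>2 / 4)) = (\<Sum>\<omega>\<in>?W. ?w \<omega> * (4 * exp (- (N * r\<^sup>2 / 4))))"
      unfolding sum_distrib_right[symmetric] w1 by simp
    also have "\<dots> < (\<Sum>\<omega>\<in>?W. ?w \<omega> * (measure Q (?B \<omega>) + prob (?B \<omega>)))"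
    proof (rule sum_strict_mono_ex1[OF fin])
      show "\<forall>\<omega>\<in>?W. ?w \<omega> * (4 * exp (- (N * r\<^sup>2 / 4))) \<le> ?w \<omega> * (measure Q (?B \<omega>) + prob (?B \<omega>))"
        by (intro ballI mult_left_mono less_imp_le[OF gt] w0)
      show "\<exists>\<omega>\<in>?W. ?w \<omega> * (4 * exp (- (N * r\<^sup>2 / 4))) < ?w \<omega> * (measure Q (?B \<omega>) + prob (?B \<omega>))"
      proof -
        obtain \<omega> where w: "\<omega> \<in> ?W" "?w \<omega> > 0" using ex by (elim bexE)
        show ?thesis by (rule bexI[OF _ w(1)], rule mult_strict_left_mono[OF gt[OF w(1)] w(2)])
      qed
    qed
    also have "\<dots> \<le> 4 * exp (- (N * r\<^sup>2 / 4))"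
      using half[OF Q QM] half[OF prob_space_axioms refl] by (simp add: distrib_left sum.distrib)
    finally show False by simp
  qed
  then show ?thesis by (elim bexE) (rule that)
qed

text \<open>The dictionary together with its negatives, so that coefficient vectors of \<open>l1\<close> norm 1 become
convex weights.\<close>

definition signed :: "('i \<Rightarrow> 'a \<Rightarrow> real) \<Rightarrow> 'i \<times> bool \<Rightarrow> 'a \<Rightarrow> real" where
  "signed \<psi> j x = (if snd j then \<psi> (fst j) x else - \<psi> (fst j) x)"

text \<open>A uniform law for squares over a symmetric convex hull. Level \<open>l\<close> uses averages of \<open>N l\<close>
dictionary elements; there are \<open>(2n)\<close> to the power \<open>N l\<close> of them, which explains the union bound
in the last assumption. The conclusion is homogeneous in the coefficients \<open>a\<close>.\<close>

theorem (in prob_space) uniform_square_deviation: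
  fixes \<psi> :: "'i \<Rightarrow> 'a \<Rightarrow> real" and N :: "nat \<Rightarrow> nat"
  assumes I: "finite I" and \<psi>m: "\<And>i. i \<in> I \<Longrightarrow> \<psi> i \<in> borel_measurable M"
    and \<psi>: "\<And>i x. i \<in> I \<Longrightarrow> x \<in> space M \<Longrightarrow> \<bar>\<psi> i x\<bar> \<le> 1"
    and d: "0 < d" "d \<le> 1 / 32" and L: "0 < L" "(1/2) ^ L \<le> \<eta>"
    and N: "\<And>l. l < L \<Longrightarrow> 4 * exp (- (N l * (d\<^sup>2 * (1/2) ^ l) / 4)) \<le> \<eta>" "\<And>l. l < L \<Longrightarrow> 0 < N l"
    and m: "0 < m"
    and fail: "(\<Sum>l<L. (2 * card I) ^ N l * (2 * exp (- (m * d * (\<eta> / L) * 2 ^ Suc l)))) \<le> \<epsilon>"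
  obtains E where "E \<in> sets (sample m)" "measure (sample m) E \<ge> 1 - \<epsilon>"
    "\<And>t a. t \<in> E \<Longrightarrow> \<bar>(\<Sum>k<m. (\<Sum>i\<in>I. a i * \<psi> i (t k))\<^sup>2) / m - expectation (\<lambda>x. (\<Sum>i\<in>I. a i * \<psi> i x)\<^sup>2)\<bar>
        \<le> 67 * d * expectation (\<lambda>x. (\<Sum>i\<in>I. a i * \<psi> i x)\<^sup>2) + 8 * \<eta> * (\<Sum>i\<in>I. \<bar>a i\<bar>)\<^sup>2"
proof -
  interpret S: prob_space "sample m" by (rule prob_space_sample)
  define J where "J = I \<times> (UNIV :: bool set)"
  define v where "v = signed \<psi>"
  have J: "finite J" "card J = 2 * card I" using I by (auto simp: J_def card_cartesian_product)
  have vm [measurable]: "v j \<in> borel_measurable M" if "j \<in> J" for j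
    using that \<psi>m unfolding v_def signed_def[abs_def] J_def by (cases "snd j") auto
  have v: "\<bar>v j x\<bar> \<le> 1" if "j \<in> J" "x \<in> space M" for j x
    using that \<psi> unfolding v_def signed_def J_def by auto
  define W where "W l = {..<N l} \<rightarrow>\<^sub>E J" for l
  have W: "finite (W l)" "card (W l) = (2 * card I) ^ N l" for l
    unfolding W_def using J by (auto intro!: finite_PiE simp: card_PiE)
  define h where "h l \<omega> x = (\<Sum>k<N l. v (\<omega> k) x) / N l" for l \<omega> x
  have hm: "h l \<omega> \<in> borel_measurable M" if "\<omega> \<in> W l" for l \<omega>
    using that unfolding h_def[abs_def] W_def
    by (intro borel_measurable_divide borel_measurable_sum vm) (auto simp: PiE_iff)
  define c :: "nat \<Rightarrow> real" where "c l = (1/2) ^ l" for l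
  have c: "c l > 0" for l by (simp add: c_def)
  define p where "p l \<omega> = expectation (\<lambda>x. slice (c l) (h l \<omega> x))" for l \<omega>
  define Bad where "Bad l \<omega> = {t \<in> space (sample m). \<bar>(\<Sum>k<m. slice (c l) (h l \<omega> (t k))) - m * p l \<omega>\<bar> > m * (d * p l \<omega> + \<eta> / L)}" for l \<omega>
  have Bad: "Bad l \<omega> \<in> S.events" "measure (sample m) (Bad l \<omega>) \<le> 2 * exp (- (m * d * (\<eta> / L) * 2 ^ Suc l))"
    if w: "\<omega> \<in> W l" for l \<omega>
  proof -
    note [measurable] = hm[OF w]
    show "Bad l \<omega> \<in> S.events" unfolding Bad_def by measurable
    have "measure (sample m) (Bad l \<omega>) \<le> 2 * exp (- (m * d * (\<eta> / L) / (c l / 2)))"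
      unfolding Bad_def p_def
      by (rule relative_chernoff) (use d c[of l] slice_bounds[of "c l"] in auto)
    also have "m * d * (\<eta> / L) / (c l / 2) = m * d * (\<eta> / L) * 2 ^ Suc l"
      by (simp add: c_def power_divide)
    finally show "measure (sample m) (Bad l \<omega>) \<le> 2 * exp (- (m * d * (\<eta> / L) * 2 ^ Suc l))" .
  qed
  define F where "F = (\<Union>l<L. \<Union>\<omega>\<in>W l. Bad l \<omega>)"
  have F [measurable]: "F \<in> S.events" unfolding F_def using W Bad by (intro sets.finite_UN) auto
  have "measure (sample m) F \<le> (\<Sum>l<L. measure (sample m) (\<Union>\<omega>\<in>W l. Bad l \<omega>))"
    unfolding F_def using W Bad by (intro S.finite_measure_subadditive_finite) auto
  also have "\<dots> \<le> (\<Sum>l<L. \<Sum>\<omega>\<in>W l. measure (sample m) (Bad l \<omega>))"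
    using W Bad by (intro sum_mono S.finite_measure_subadditive_finite) auto
  also have "\<dots> \<le> (\<Sum>l<L. \<Sum>\<omega>\<in>W l. 2 * exp (- (m * d * (\<eta> / L) * 2 ^ Suc l)))"
    using Bad by (intro sum_mono) auto
  also have "\<dots> \<le> \<epsilon>" using fail W by simp
  finally have Fe: "measure (sample m) F \<le> \<epsilon>" .
  define E where "E = space (sample m) - F"
  have E: "E \<in> S.events" "measure (sample m) E \<ge> 1 - \<epsilon>"
    unfolding E_def using Fe S.prob_compl[OF F] by auto
  have norm1: "\<bar>(\<Sum>k<m. (\<Sum>i\<in>I. a i * \<psi> i (t k))\<^sup>2) / m - expectation (\<lambda>x. (\<Sum>i\<in>I. a i * \<psi> i x)\<^sup>2)\<bar>
        \<le> 67 * d * expectation (\<lambda>x. (\<Sum>i\<in>I. a i * \<psi> i x)\<^sup>2) + 8 * \<eta>"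
    if t: "t \<in> E" and a: "(\<Sum>i\<in>I. \<bar>a i\<bar>) = 1" for t a
  proof -
    have tS: "t \<in> space (sample m)" and tF: "t \<notin> F" using t by (auto simp: E_def)
    have tk: "t k \<in> space M" if "k < m" for k using tS that by (auto simp: space_PiM)
    define g where "g x = (\<Sum>i\<in>I. a i * \<psi> i x)" for x
    have gm: "g \<in> borel_measurable M" unfolding g_def[abs_def] using \<psi>m by auto
    have g1: "\<bar>g x\<bar> \<le> 1" if "x \<in> space M" for x
    proof -
      have "\<bar>g x\<bar> \<le> (\<Sum>i\<in>I. \<bar>a i * \<psi> i x\<bar>)" unfolding g_def by (rule sum_abs)
      also have "\<dots> \<le> (\<Sum>i\<in>I. \<bar>a i\<bar>)" using \<psi> that by (intro sum_mono) (simp add: abs_mult mult_left_le)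
      finally show ?thesis using a by simp
    qed
    \<comment> \<open>Each coefficient puts its absolute value on the copy of \<open>\<psi>\<close> with the matching sign.\<close>
    define q where "q j = (if snd j = (a (fst j) \<ge> 0) then \<bar>a (fst j)\<bar> else 0)" for j
    have q0: "q j \<ge> 0" for j by (simp add: q_def)
    have q1: "sum q J = 1" unfolding J_def using a by (simp add: sum.cartesian_product' q_def UNIV_bool)
    have gq: "g = (\<lambda>x. \<Sum>j\<in>J. q j * v j x)"
    proof
      fix x
      have "(\<Sum>j\<in>J. q j * v j x) = (\<Sum>i\<in>I. \<Sum>b\<in>UNIV. q (i, b) * v (i, b) x)"
        unfolding J_def by (rule sum.cartesian_product')
      also have "\<dots> = (\<Sum>i\<in>I. a i * \<psi> i x)"
        by (intro sum.cong refl) (simp add: UNIV_bool q_def v_def signed_def)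
      finally show "g x = (\<Sum>j\<in>J. q j * v j x)" by (simp add: g_def)
    qed
    \<comment> \<open>the empirical measure of the sample, so that averages over the sample are integrals\<close>
    define Q where "Q = distr (uniform_count_measure {..<m}) M t"
    have tm: "t \<in> measurable (uniform_count_measure {..<m}) M"
      using tk by (auto simp: measurable_def space_uniform_count_measure sets_uniform_count_measure)
    have prQ: "prob_space Q" unfolding Q_def
      by (intro prob_space.prob_space_distr prob_space_uniform_count_measure tm) (use m in auto)
    have setsQ: "sets Q = sets M" by (simp add: Q_def)
    have intQ: "(\<integral>x. f x \<partial>Q) = (\<Sum>k<m. f (t k)) / m" if "f \<in> borel_measurable M" for f :: "'a \<Rightarrow> real"
      unfolding Q_def by (subst integral_distr[OF tm that]) (simp add: integral_uniform_count_measure)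
    define bad where "bad l \<omega> = measure Q {x \<in> space M. \<bar>h l \<omega> x - g x\<bar> > d * sqrt (c l)}
       + prob {x \<in> space M. \<bar>h l \<omega> x - g x\<bar> > d * sqrt (c l)}" for l \<omega>
    have "\<exists>\<omega>. \<omega> \<in> W l \<and> bad l \<omega> \<le> \<eta>" if l: "l < L" for l
    proof -
      have "c l \<le> 1" unfolding c_def by (simp add: power_le_one)
      then have r: "0 < d * sqrt (c l)" "d * sqrt (c l) \<le> 1" using d c[of l] by (auto intro!: mult_le_one)
      have r2: "(d * sqrt (c l))\<^sup>2 = d\<^sup>2 * (1/2) ^ l"
        using c[of l] by (simp add: power_mult_distrib c_def)
      obtain \<omega> where w: "\<omega> \<in> {..<N l} \<rightarrow>\<^sub>E J" "measure Q {x \<in> space M. \<bar>(\<Sum>k<N l. v (\<omega> k) x) / N l - (\<Sum>j\<in>J. q j * v j x)\<bar> > d * sqrt (c l)}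
         + prob {x \<in> space M. \<bar>(\<Sum>k<N l. v (\<omega> k) x) / N l - (\<Sum>j\<in>J. q j * v j x)\<bar> > d * sqrt (c l)} \<le> 4 * exp (- (N l * (d * sqrt (c l))\<^sup>2 / 4))"
        by (rule maurey_net[OF prQ setsQ J(1) q0 q1 vm v r N(2)[OF l]])
      have "bad l \<omega> \<le> \<eta>"
        unfolding bad_def h_def gq by (rule order_trans[OF w(2)[unfolded r2] N(1)[OF l]])
      with w(1) show ?thesis unfolding W_def by blast
    qed
    then have "\<exists>\<omega>. \<forall>l. l < L \<longrightarrow> \<omega> l \<in> W l \<and> bad l (\<omega> l) \<le> \<eta>"
      by (intro choice) blast
    then obtain \<omega> where w: "\<omega> l \<in> W l" "bad l (\<omega> l) \<le> \<eta>" if "l < L" for l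
      by blast
    define H where "H l = (if l < L then h l (\<omega> l) else (\<lambda>_. 0))" for l
    have Hm [measurable]: "H l \<in> borel_measurable M" for l unfolding H_def using hm w by auto
    have "\<bar>(\<integral>x. (g x)\<^sup>2 \<partial>Q) - (\<integral>x. (g x)\<^sup>2 \<partial>M)\<bar> \<le> 67 * d * (\<integral>x. (g x)\<^sup>2 \<partial>M) + 8 * \<eta>"
    proof (rule square_deviation_from_slices[OF prQ setsQ gm Hm g1 d L])
      fix l assume l: "l < L"
      show "measure Q {x \<in> space M. \<bar>H l x - g x\<bar> > d * sqrt ((1/2) ^ l)}
                + prob {x \<in> space M. \<bar>H l x - g x\<bar> > d * sqrt ((1/2) ^ l)} \<le> \<eta>"
        using w(2)[OF l] l unfolding H_def c_def bad_def by simp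
      have "t \<notin> Bad l (\<omega> l)" using tF l w(1)[OF l] unfolding F_def by blast
      then have "\<bar>(\<Sum>k<m. slice (c l) (h l (\<omega> l) (t k))) - m * p l (\<omega> l)\<bar> \<le> m * (d * p l (\<omega> l) + \<eta> / L)"
        using tS unfolding Bad_def by auto
      moreover have "\<bar>(\<Sum>k<m. slice (c l) (h l (\<omega> l) (t k))) / m - p l (\<omega> l)\<bar> = \<bar>(\<Sum>k<m. slice (c l) (h l (\<omega> l) (t k))) - m * p l (\<omega> l)\<bar> / m"
      proof -
        have "x / m - y = (x - m * y) / m" for x y :: real using m by (simp add: field_simps)
        then show ?thesis by (simp only: abs_divide abs_of_nat)
      qed
      ultimately have "\<bar>(\<Sum>k<m. slice (c l) (h l (\<omega> l) (t k))) / m - p l (\<omega> l)\<bar> \<le> d * p l (\<omega> l) + \<eta> / L"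
        using m by (simp add: divide_le_eq mult.commute)
      moreover have sm: "(\<lambda>x. slice ((1/2) ^ l) (H l x)) \<in> borel_measurable M" by measurable
      ultimately show "\<bar>(\<integral>x. slice ((1/2) ^ l) (H l x) \<partial>Q) - (\<integral>x. slice ((1/2) ^ l) (H l x) \<partial>M)\<bar>
                \<le> d * (\<integral>x. slice ((1/2) ^ l) (H l x) \<partial>M) + \<eta> / L"
        unfolding intQ[OF sm] using l by (simp add: H_def p_def c_def)
    qed
    moreover have gm2: "(\<lambda>x. (g x)\<^sup>2) \<in> borel_measurable M"
      by (intro borel_measurable_power gm)
    ultimately show ?thesis unfolding intQ[OF gm2] unfolding g_def by - assumption
  qed
  have "\<bar>(\<Sum>k<m. (\<Sum>i\<in>I. a i * \<psi> i (t k))\<^sup>2) / m - expectation (\<lambda>x. (\<Sum>i\<in>I. a i * \<psi> i x)\<^sup>2)\<bar>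
        \<le> 67 * d * expectation (\<lambda>x. (\<Sum>i\<in>I. a i * \<psi> i x)\<^sup>2) + 8 * \<eta> * (\<Sum>i\<in>I. \<bar>a i\<bar>)\<^sup>2"
    if t: "t \<in> E" for t a
  proof (cases "(\<Sum>i\<in>I. \<bar>a i\<bar>) = 0")
    case True
    then have "\<And>i. i \<in> I \<Longrightarrow> a i = 0" using I by (simp add: sum_nonneg_eq_0_iff)
    then show ?thesis by simp
  next
    case False
    define s where "s = (\<Sum>i\<in>I. \<bar>a i\<bar>)"
    have s: "s > 0" using False unfolding s_def by (simp add: order_less_le sum_nonneg)
    have sc: "(\<Sum>i\<in>I. a i / s * \<psi> i x)\<^sup>2 = (\<Sum>i\<in>I. a i * \<psi> i x)\<^sup>2 / s\<^sup>2" for x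
      by (simp add: sum_divide_distrib[symmetric] power_divide)
    have "(\<Sum>i\<in>I. \<bar>a i / s\<bar>) = 1" using s by (simp add: abs_divide sum_divide_distrib[symmetric] s_def[symmetric])
    from norm1[OF t this, unfolded sc]
    have "\<bar>(\<Sum>k<m. (\<Sum>i\<in>I. a i * \<psi> i (t k))\<^sup>2) / m / s\<^sup>2 - expectation (\<lambda>x. (\<Sum>i\<in>I. a i * \<psi> i x)\<^sup>2) / s\<^sup>2\<bar>
        \<le> 67 * d * expectation (\<lambda>x. (\<Sum>i\<in>I. a i * \<psi> i x)\<^sup>2) / s\<^sup>2 + 8 * \<eta>"
      by (simp add: sum_divide_distrib[symmetric] mult.commute)
    then have "s\<^sup>2 * \<bar>((\<Sum>k<m. (\<Sum>i\<in>I. a i * \<psi> i (t k))\<^sup>2) / m - expectation (\<lambda>x. (\<Sum>i\<in>I. a i * \<psi> i x)\<^sup>2)) / s\<^sup>2\<bar>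
        \<le> s\<^sup>2 * (67 * d * expectation (\<lambda>x. (\<Sum>i\<in>I. a i * \<psi> i x)\<^sup>2) / s\<^sup>2 + 8 * \<eta>)"
      by (intro mult_left_mono) (auto simp: diff_divide_distrib)
    then show ?thesis using s unfolding s_def[symmetric] by (simp add: abs_divide distrib_left mult.commute)
  qed
  from that[OF E this] show ?thesis .
qed

section \<open>Restricted isometry of the design matrix\<close>

text \<open>The sample size meets the requirements of \<open>uniform_square_deviation\<close> for \<open>d = \<delta>/140\<close>, \<open>\<eta> = \<delta>\<^sup>2/(16 \<kappa>)\<close> and
\<open>L\<close> levels. With \<open>X = \<kappa>/\<delta>\<^sup>2\<close> and \<open>Z = ln X\<close>, both \<open>L\<close> and \<open>ln(4/\<eta>)\<close> are at most
multiples of \<open>Z\<close>, and the exponent of the Chernoff bound is at least a multiple of \<open>2\<^sup>l\<close> times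
\<open>\<delta>\<close> times the maximum in the definition of \<open>polylog\<close>. The first entry of the maximum dominates the
logarithm of the number of averages, the second one the logarithm of the failure probability.\<close>

lemma sample_size_suffices:
  fixes \<kappa> \<delta> \<epsilon> M :: real and n l :: nat
  assumes \<kappa>: "\<kappa> \<ge> 1" and \<delta>: "0 < \<delta>" "\<delta> < 1 / 5" and \<epsilon>: "0 < \<epsilon>" "\<epsilon> < 1" and n: "n \<ge> 2"
    and M: "M \<ge> 4480000000 * \<kappa> * polylog \<kappa> n \<delta> \<epsilon>"
  defines "d \<equiv> \<delta> / 140" and "\<eta> \<equiv> \<delta>\<^sup>2 / (16 * \<kappa>)"
  defines "L \<equiv> nat \<lceil>log 2 (1 / \<eta>)\<rceil>" and "N \<equiv> nat \<lceil>4 * 2 ^ l / d\<^sup>2 * ln (4 / \<eta>)\<rceil>"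
  shows "0 < L" "(1/2) ^ L \<le> \<eta>" "0 < N" "4 * exp (- (N * (d\<^sup>2 * (1/2) ^ l) / 4)) \<le> \<eta>"
    "(2 * real n) ^ N * (2 * exp (- (M * d * (\<eta> / L) * 2 ^ Suc l))) \<le> \<epsilon> / L" "0 < M"
proof -
  define X where "X = \<kappa> / \<delta>\<^sup>2"
  define Z where "Z = ln X"
  have d0: "d > 0" and \<eta>0: "\<eta> > 0" using \<delta> \<kappa> by (auto simp: d_def \<eta>_def)
  have \<delta>2: "\<delta>\<^sup>2 \<le> 1 / 25"
  proof -
    have "\<delta>\<^sup>2 \<le> (1 / 5)\<^sup>2" using \<delta> by (intro power_mono) auto
    then show ?thesis by (simp add: power2_eq_square)
  qed
  have X: "X \<ge> 25"
  proof -
    have "25 \<le> 1 / \<delta>\<^sup>2" using \<delta>2 \<delta> by (simp add: field_simps)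
    also have "\<dots> \<le> X" unfolding X_def using \<kappa> \<delta> by (intro divide_right_mono) auto
    finally show ?thesis .
  qed
  have Z: "Z \<ge> 3"
  proof -
    have "exp (3 :: real) = exp 1 ^ 3" by (simp flip: exp_of_nat_mult)
    also have "\<dots> \<le> (272 / 100) ^ 3" using e_less_272 by (intro power_mono) auto
    also have "\<dots> \<le> X" using X by (simp add: power3_eq_cube)
    finally show ?thesis unfolding Z_def using X by (simp add: ln_ge_iff)
  qed
  have \<eta>X: "1 / \<eta> = 16 * X" "4 / \<eta> = 64 * X" using \<kappa> \<delta> by (auto simp: \<eta>_def X_def field_simps)
  have ln16: "ln (16 * X) \<le> 2 * Z" "ln (16 * X) > 0"
  proof -
    have "ln (16 * X) = ln (2 ^ 4) + Z" using X by (simp add: Z_def ln_mult)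
    also have "ln (2 ^ 4 :: real) = 4 * ln 2" by (subst ln_realpow) auto
    finally show "ln (16 * X) \<le> 2 * Z" "ln (16 * X) > 0" using Z ln2_le_25_over_36 ln2_ge_two_thirds by linarith+
  qed
  have ln64: "ln (4 / \<eta>) \<le> 3 * Z" "ln (4 / \<eta>) > 0"
  proof -
    have "ln (64 * X) = ln (2 ^ 6) + Z" using X by (simp add: Z_def ln_mult)
    also have "ln (2 ^ 6 :: real) = 6 * ln 2" by (subst ln_realpow) auto
    finally show "ln (4 / \<eta>) \<le> 3 * Z" "ln (4 / \<eta>) > 0" unfolding \<eta>X using Z ln2_le_25_over_36 ln2_ge_two_thirds by linarith+
  qed
  have lg0: "log 2 (1 / \<eta>) > 0" unfolding \<eta>X log_def using ln16(2) by simp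
  then show L0: "0 < L" unfolding L_def by simp
  have Lge: "real L \<ge> log 2 (1 / \<eta>)" unfolding L_def using lg0 by linarith
  have L4: "real L \<le> 4 * Z"
  proof -
    have "real L \<le> log 2 (1 / \<eta>) + 1" unfolding L_def using lg0 by linarith
    also have "log 2 (1 / \<eta>) \<le> 2 * Z / (2 / 3)" unfolding \<eta>X log_def
      using ln16 ln2_ge_two_thirds by (intro frac_le) auto
    finally show ?thesis using Z by simp
  qed
  show "(1/2) ^ L \<le> \<eta>"
  proof -
    have "1 / \<eta> \<le> 2 powr real L" using Lge \<eta>0 by (subst (asm) log_le_iff) auto
    then have "1 / \<eta> \<le> 2 ^ L" by (simp add: powr_realpow)
    then show ?thesis using \<eta>0 by (simp add: field_simps)
  qed
  define N' where "N' = 4 * 2 ^ l / d\<^sup>2 * ln (4 / \<eta>)"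
  have N'0: "N' > 0" unfolding N'_def using d0 ln64 by simp
  have Nge: "real N \<ge> N'" unfolding N_def N'_def[symmetric] using N'0 by linarith
  have Nle: "real N \<le> N' + 1" unfolding N_def N'_def[symmetric] using N'0 by linarith
  show "0 < N" using Nge N'0 by linarith
  show "4 * exp (- (N * (d\<^sup>2 * (1/2) ^ l) / 4)) \<le> \<eta>"
  proof -
    have "ln (4 / \<eta>) = N' * (d\<^sup>2 * (1/2) ^ l) / 4"
      unfolding N'_def using d0 by (simp add: field_simps power_divide)
    also have "\<dots> \<le> N * (d\<^sup>2 * (1/2) ^ l) / 4" using Nge by (intro divide_right_mono mult_right_mono) auto
    finally have "exp (- (N * (d\<^sup>2 * (1/2) ^ l) / 4)) \<le> exp (- ln (4 / \<eta>))" by simp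
    also have "\<dots> = \<eta> / 4" using \<eta>0 by (simp add: exp_minus)
    finally show ?thesis by simp
  qed
  \<comment> \<open>A multiple of \<open>P\<close> bounds the logarithm of the number of averages on level \<open>l\<close>; \<open>Y\<close> accounts for the failure probability.\<close>
  define Y where "Y = ln (1 / (\<delta> * \<epsilon>) * Z)"
  define P where "P = 2 ^ l * (1 / \<delta>\<^sup>2) * Z * ln n"
  have lnn: "ln (real n) > 0" using n by simp
  have Nb: "real N \<le> 254800 * (2 ^ l * (1 / \<delta>\<^sup>2) * Z)"
  proof -
    have "N' \<le> 4 * 2 ^ l / d\<^sup>2 * (3 * Z)" unfolding N'_def using ln64 d0 by (intro mult_left_mono) auto
    also have "\<dots> = 235200 * (2 ^ l * (1 / \<delta>\<^sup>2) * Z)" using \<delta> by (simp add: d_def power_divide)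
    finally have "N' \<le> 235200 * (2 ^ l * (1 / \<delta>\<^sup>2) * Z)" .
    moreover have "1 * 1 * 1 \<le> 2 ^ l * (1 / \<delta>\<^sup>2) * Z" using \<delta>2 \<delta> Z by (intro mult_mono) (auto simp: field_simps)
    ultimately show ?thesis using Nle by linarith
  qed
  have count: "N * ln (2 * real n) \<le> 509600 * P"
  proof -
    have "2 * real n \<le> real n * real n" using n by (intro mult_right_mono) auto
    then have "ln (2 * real n) \<le> ln (real n * real n)" using n by (subst ln_le_cancel_iff) auto
    also have "\<dots> = 2 * ln (real n)" using n by (simp add: ln_mult)
    finally have "N * ln (2 * real n) \<le> (254800 * (2 ^ l * (1 / \<delta>\<^sup>2) * Z)) * (2 * ln (real n))"
      using Nb n by (intro mult_mono) auto
    then show ?thesis by (simp add: P_def algebra_simps)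
  qed
  have fail: "ln (2 * L / \<epsilon>) \<le> 2 * Y" and Y0: "Y \<ge> 0"
  proof -
    have z: "Z / \<epsilon> \<ge> 1" using Z \<epsilon> by (simp add: field_simps)
    have "2 * L / \<epsilon> \<le> 25 * (Z / \<epsilon>)" using L4 Z \<epsilon> by (simp add: divide_right_mono field_simps)
    also have "\<dots> \<le> (1 / \<delta>\<^sup>2) * ((Z / \<epsilon>) * (Z / \<epsilon>))"
    proof (rule mult_mono)
      show "25 \<le> 1 / \<delta>\<^sup>2" using \<delta>2 \<delta> by (simp add: field_simps)
      show "Z / \<epsilon> \<le> (Z / \<epsilon>) * (Z / \<epsilon>)" using mult_left_mono[OF z, of "Z / \<epsilon>"] z by simp
    qed (use z in auto)
    also have "\<dots> = (1 / (\<delta> * \<epsilon>) * Z)\<^sup>2" by (simp add: power2_eq_square)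
    finally have "ln (2 * L / \<epsilon>) \<le> ln ((1 / (\<delta> * \<epsilon>) * Z)\<^sup>2)" using L0 \<epsilon> Z \<delta> by (subst ln_le_cancel_iff) auto
    also have "\<dots> = 2 * Y" unfolding Y_def using \<delta> \<epsilon> Z by (subst ln_realpow) auto
    finally show "ln (2 * L / \<epsilon>) \<le> 2 * Y" .
    have "1 * 1 \<le> (1 / \<delta>) * (Z / \<epsilon>)" using z \<delta> by (intro mult_mono) (auto simp: field_simps)
    then show "Y \<ge> 0" unfolding Y_def by (intro ln_ge_zero) simp
  qed
  define G where "G = max (1 / \<delta>^4 * ln (X * Z) * ln (real n)) (1 / \<delta> * Y)"
  have pl: "polylog \<kappa> n \<delta> \<epsilon> = 1 / \<delta>\<^sup>2 * Z * G"
    unfolding polylog_def G_def Y_def Z_def X_def by (rule refl)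
  have G1: "\<delta> * G \<ge> P / 2 ^ l"
  proof -
    have "Z \<le> ln (X * Z)" unfolding Z_def[symmetric] using X Z by (simp add: ln_mult Z_def[symmetric])
    then have "1 / \<delta>^3 * Z * ln n \<le> 1 / \<delta>^3 * ln (X * Z) * ln n" using lnn \<delta> by (intro mult_right_mono mult_left_mono) auto
    also have "\<dots> = \<delta> * (1 / \<delta>^4 * ln (X * Z) * ln (real n))" using \<delta> by (simp add: field_simps eval_nat_numeral)
    also have "\<dots> \<le> \<delta> * G" unfolding G_def using \<delta> by (intro mult_left_mono) auto
    finally have a: "1 / \<delta>^3 * Z * ln n \<le> \<delta> * G" .
    have "1 / \<delta>\<^sup>2 \<le> 1 / \<delta>^3" using \<delta> by (intro divide_left_mono power_decreasing) auto
    then have "1 / \<delta>\<^sup>2 * Z * ln n \<le> 1 / \<delta>^3 * Z * ln n" using Z lnn by (intro mult_right_mono) auto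
    then show ?thesis using a by (simp add: P_def)
  qed
  have G2: "\<delta> * G \<ge> Y"
  proof -
    have "Y = \<delta> * (1 / \<delta> * Y)" using \<delta> by simp
    also have "\<dots> \<le> \<delta> * G" unfolding G_def using \<delta> by (intro mult_left_mono) auto
    finally show ?thesis .
  qed
  have "P > 0" unfolding P_def using \<delta> Z lnn by (intro mult_pos_pos) auto
  then have "\<delta> * G > 0" using G1 by (meson divide_pos_pos less_le_trans zero_less_numeral zero_less_power)
  then have G0: "G > 0" using \<delta> by (simp add: zero_less_mult_iff)
  have "4480000000 * \<kappa> * polylog \<kappa> n \<delta> \<epsilon> > 0" unfolding pl using \<kappa> \<delta> Z G0 by (intro mult_pos_pos) auto
  then show M0: "M > 0" using M by linarith
  have main: "M * d * (\<eta> / L) * 2 ^ Suc l \<ge> 509600 * P + 2 * Y"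
  proof -
    have "(4480000000 * \<kappa> * (1 / \<delta>\<^sup>2 * Z * G)) * d * (\<eta> / (4 * Z)) * 2 ^ Suc l \<le> M * d * (\<eta> / L) * 2 ^ Suc l"
      using M[unfolded pl] d0 \<eta>0 L4 L0 Z M0 by (intro mult_right_mono mult_mono divide_left_mono) auto
    \<comment> \<open>\<open>4480 = 140 * 16 * 4 / 2\<close> collects the constants of \<open>d\<close>, \<open>\<eta>\<close>, \<open>L\<close> and \<open>2 ^ Suc l\<close>.\<close>
    also have "(4480000000 * \<kappa> * (1 / \<delta>\<^sup>2 * Z * G)) * d * (\<eta> / (4 * Z)) * 2 ^ Suc l = 1000000 * (2 ^ l * (\<delta> * G)) "
      using \<kappa> \<delta> Z by (simp add: d_def \<eta>_def field_simps power2_eq_square)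
    finally have "1000000 * (2 ^ l * (\<delta> * G)) \<le> M * d * (\<eta> / L) * 2 ^ Suc l" .
    moreover have "P \<le> 2 ^ l * (\<delta> * G)" using G1 by (simp add: field_simps)
    moreover have "Y \<le> 2 ^ l * (\<delta> * G)" using mult_mono[of 1 "2 ^ l" Y "\<delta> * G"] G2 Y0 by simp
    ultimately show ?thesis using Y0 \<open>P > 0\<close> by linarith
  qed
  have "(2 * real n) ^ N * (2 * exp (- (M * d * (\<eta> / L) * 2 ^ Suc l))) \<le> (2 * real n) ^ N * (2 * exp (- (N * ln (2 * real n) + ln (2 * L / \<epsilon>))))"
    using main count fail n by (intro mult_left_mono) auto
  also have "\<dots> = (2 * real n) ^ N * (2 * (inverse ((2 * real n) ^ N) * inverse (2 * L / \<epsilon>)))"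
  proof -
    have "exp (N * ln (2 * real n)) = (2 * real n) ^ N" using n by (simp add: exp_of_nat_mult)
    moreover have "exp (ln (2 * L / \<epsilon>)) = 2 * L / \<epsilon>" using L0 \<epsilon> by simp
    moreover have "exp (- (x + y)) = inverse (exp x) * inverse (exp y)" for x y :: real
      by (simp only: exp_minus exp_add inverse_mult_distrib)
    ultimately show ?thesis by simp
  qed
  also have "\<dots> = \<epsilon> / L" using n L0 by (simp add: field_simps)
  finally show "(2 * real n) ^ N * (2 * exp (- (M * d * (\<eta> / L) * 2 ^ Suc l))) \<le> \<epsilon> / L" .
qed

lemma expansion_square_integral:
  assumes "finite I" "I \<subseteq> multi_idx d"
  shows "(\<integral>t. (\<Sum>i\<in>I. a i * phi b d i t)\<^sup>2 \<partial>nu b d) = (\<Sum>i\<in>I. (a i)\<^sup>2)"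
proof -
  interpret N: prob_space "nu b d" by (rule prob_space_nu)
  have int: "integrable (nu b d) (\<lambda>t. phi b d i t * phi b d j t)" for i j
    by (rule N.integrable_const_bound[of _ "tensor_weight b d i * tensor_weight b d j"])
       (auto intro!: AE_I2 mult_mono phi_bound less_imp_le[OF tensor_weight_pos] simp: abs_mult)
  have "(\<integral>t. (\<Sum>i\<in>I. a i * phi b d i t)\<^sup>2 \<partial>nu b d) = (\<integral>t. (\<Sum>i\<in>I. \<Sum>j\<in>I. a i * a j * (phi b d i t * phi b d j t)) \<partial>nu b d)"
    by (simp add: power2_eq_square sum_product algebra_simps)
  also have "\<dots> = (\<Sum>i\<in>I. \<Sum>j\<in>I. a i * a j * (\<integral>t. phi b d i t * phi b d j t \<partial>nu b d))"
    by (subst Bochner_Integration.integral_sum, intro Bochner_Integration.integrable_sum Bochner_Integration.integrable_mult_right int)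
       (intro sum.cong refl, subst Bochner_Integration.integral_sum, auto intro!: int)
  also have "\<dots> = (\<Sum>i\<in>I. \<Sum>j\<in>I. a i * a j * of_bool (i = j))"
    using assms(2) by (intro sum.cong refl) (auto simp: phi_orthonormal subset_iff)
  also have "\<dots> = (\<Sum>i\<in>I. (a i)\<^sup>2)"
    using assms(1) by (intro sum.cong refl) (simp add: of_bool_def if_distrib[of "\<lambda>x. _ * x"] power2_eq_square cong: if_cong)
  finally show ?thesis .
qed

text \<open>The uniform law for the basis functions divided by their weights, applied to the real and to the
imaginary part of \<open>z\<close>. The true mean of \<open>g\<^sup>2\<close> is \<open>\<parallel>z\<parallel>\<^sup>2\<close> by orthonormality. The choice of \<open>d\<close> and \<open>\<eta>\<close> gives
\<open>67 d \<le> \<delta>/2\<close>, and \<open>8 \<eta> = \<delta>\<^sup>2/(2 \<kappa>)\<close> for each of the two parts.\<close>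

lemma sampling_RIP:
  fixes b :: poly_family and d s m :: nat and \<delta> \<epsilon> :: real
  assumes ds: "1 \<le> d" "2 \<le> s" and \<delta>: "0 < \<delta>" "\<delta> < 1 / 5" and \<epsilon>: "0 < \<epsilon>" "\<epsilon> < 1"
  defines "I \<equiv> hyperbolic_cross d s" and "\<kappa> \<equiv> K b d s"
  assumes m: "real m \<ge> 4480000000 * \<kappa> * polylog \<kappa> (card I) \<delta> \<epsilon>"
  obtains E where "E \<in> sets (PiM {..<m} (\<lambda>_. nu b d))" "measure (PiM {..<m} (\<lambda>_. nu b d)) E \<ge> 1 - \<epsilon>"
    "\<And>t z. t \<in> E \<Longrightarrow> \<bar>(l2_norm m (mat_vec I (design_matrix b d m t) z))\<^sup>2 - (\<Sum>i\<in>I. (cmod (z i))\<^sup>2)\<bar>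
       \<le> \<delta> / 2 * (\<Sum>i\<in>I. (cmod (z i))\<^sup>2) + \<delta>\<^sup>2 / \<kappa> * (\<Sum>i\<in>I. weight b d i * cmod (z i))\<^sup>2"
proof -
  interpret N: prob_space "nu b d" by (rule prob_space_nu)
  have fI: "finite I" and cI: "card I \<ge> 2" and subI: "I \<subseteq> multi_idx d"
    using hyperbolic_cross_finite card_hyperbolic_cross_ge_2[OF ds] by (auto simp: I_def hyperbolic_cross_def)
  have \<kappa>: "\<kappa> \<ge> 1" unfolding \<kappa>_def using ds by (intro K_ge_1) auto
  define d0 where "d0 = \<delta> / 140"
  define \<eta> where "\<eta> = \<delta>\<^sup>2 / (16 * \<kappa>)"
  define L where "L = nat \<lceil>log 2 (1 / \<eta>)\<rceil>"
  define Nl where "Nl l = nat \<lceil>4 * 2 ^ l / d0\<^sup>2 * ln (4 / \<eta>)\<rceil>" for l :: nat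
  note num = sample_size_suffices[OF \<kappa> \<delta> \<epsilon> cI m, folded d0_def \<eta>_def, folded L_def Nl_def]
  define \<psi> where "\<psi> i t = phi b d i t / tensor_weight b d i" for i t
  have \<psi>m: "\<psi> i \<in> borel_measurable (nu b d)" for i unfolding \<psi>_def[abs_def] by measurable
  have \<psi>b: "\<bar>\<psi> i t\<bar> \<le> 1" if "i \<in> I" "t \<in> space (nu b d)" for i t
    using phi_bound[OF that(2), of i] tensor_weight_pos[of b d i] by (simp add: \<psi>_def abs_divide)
  have d0: "0 < d0" "d0 \<le> 1 / 32" using \<delta> by (auto simp: d0_def)
  have m0: "m > 0" using num(6) by simp
  have f: "(\<Sum>l<L. (2 * card I) ^ Nl l * (2 * exp (- (m * d0 * (\<eta> / L) * 2 ^ Suc l)))) \<le> \<epsilon>"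
  proof -
    have "(\<Sum>l<L. (2 * card I) ^ Nl l * (2 * exp (- (m * d0 * (\<eta> / L) * 2 ^ Suc l)))) \<le> (\<Sum>l<L. \<epsilon> / L)"
      by (intro sum_mono) (use num(5) in simp)
    then show ?thesis using num(1) by simp
  qed
  obtain E where E: "E \<in> sets (N.sample m)" "measure (N.sample m) E \<ge> 1 - \<epsilon>"
    "\<And>t a. t \<in> E \<Longrightarrow> \<bar>(\<Sum>k<m. (\<Sum>i\<in>I. a i * \<psi> i (t k))\<^sup>2) / m - N.expectation (\<lambda>x. (\<Sum>i\<in>I. a i * \<psi> i x)\<^sup>2)\<bar>
        \<le> 67 * d0 * N.expectation (\<lambda>x. (\<Sum>i\<in>I. a i * \<psi> i x)\<^sup>2) + 8 * \<eta> * (\<Sum>i\<in>I. \<bar>a i\<bar>)\<^sup>2"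
    by (rule N.uniform_square_deviation[where \<psi> = \<psi>, OF fI \<psi>m \<psi>b d0 num(1,2,4,3) m0 f], assumption, assumption, rule that)
  have real_case: "\<bar>(\<Sum>k<m. (\<Sum>i\<in>I. c i * phi b d i (t k))\<^sup>2) / m - (\<Sum>i\<in>I. (c i)\<^sup>2)\<bar>
        \<le> \<delta> / 2 * (\<Sum>i\<in>I. (c i)\<^sup>2) + \<delta>\<^sup>2 / (2 * \<kappa>) * (\<Sum>i\<in>I. weight b d i * cmod (z i))\<^sup>2"
    if t: "t \<in> E" and c: "\<And>i. \<bar>c i\<bar> \<le> cmod (z i)" for t c and z :: "(nat \<Rightarrow> nat) \<Rightarrow> complex"
  proof -
    define S where "S = (\<Sum>i\<in>I. (c i)\<^sup>2)"
    have S0: "S \<ge> 0" unfolding S_def by (intro sum_nonneg) auto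
    have e: "(\<Sum>i\<in>I. tensor_weight b d i * c i * \<psi> i x) = (\<Sum>i\<in>I. c i * phi b d i x)" for x
      using tensor_weight_pos[of b d] by (intro sum.cong refl) (simp add: \<psi>_def less_imp_neq[THEN not_sym])
    have "\<bar>(\<Sum>k<m. (\<Sum>i\<in>I. c i * phi b d i (t k))\<^sup>2) / m - S\<bar> \<le> 67 * d0 * S + 8 * \<eta> * (\<Sum>i\<in>I. \<bar>tensor_weight b d i * c i\<bar>)\<^sup>2"
      using E(3)[OF t, of "\<lambda>i. tensor_weight b d i * c i"] unfolding e expansion_square_integral[OF fI subI] S_def .
    also have "67 * d0 * S \<le> \<delta> / 2 * S" using \<delta> S0 by (intro mult_right_mono) (auto simp: d0_def)
    also have "8 * \<eta> * (\<Sum>i\<in>I. \<bar>tensor_weight b d i * c i\<bar>)\<^sup>2 \<le> 8 * \<eta> * (\<Sum>i\<in>I. weight b d i * cmod (z i))\<^sup>2"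
      using \<kappa> by (intro mult_left_mono power_mono sum_mono sum_nonneg)
        (auto simp: \<eta>_def abs_mult weight_eq less_imp_le[OF tensor_weight_pos] intro!: mult_left_mono c)
    also have "8 * \<eta> = \<delta>\<^sup>2 / (2 * \<kappa>)" by (simp add: \<eta>_def)
    finally show ?thesis unfolding S_def by simp
  qed
  have "\<bar>(l2_norm m (mat_vec I (design_matrix b d m t) z))\<^sup>2 - (\<Sum>i\<in>I. (cmod (z i))\<^sup>2)\<bar>
       \<le> \<delta> / 2 * (\<Sum>i\<in>I. (cmod (z i))\<^sup>2) + \<delta>\<^sup>2 / \<kappa> * (\<Sum>i\<in>I. weight b d i * cmod (z i))\<^sup>2"
    if t: "t \<in> E" for t z
  proof -
    define R where "R k = (\<Sum>i\<in>I. Re (z i) * phi b d i (t k))" for k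
    define J where "J k = (\<Sum>i\<in>I. Im (z i) * phi b d i (t k))" for k
    have mv: "(cmod (mat_vec I (design_matrix b d m t) z k))\<^sup>2 = ((R k)\<^sup>2 + (J k)\<^sup>2) / m" for k
    proof -
      have "Re (mat_vec I (design_matrix b d m t) z k) = R k / sqrt m"
        by (simp add: mat_vec_def design_matrix_def R_def sum_divide_distrib mult.commute)
      moreover have "Im (mat_vec I (design_matrix b d m t) z k) = J k / sqrt m"
        by (simp add: mat_vec_def design_matrix_def J_def sum_divide_distrib mult.commute)
      ultimately show ?thesis by (simp add: cmod_power2 power_divide add_divide_distrib)
    qed
    have A: "(l2_norm m (mat_vec I (design_matrix b d m t) z))\<^sup>2 = (\<Sum>k<m. (R k)\<^sup>2) / m + (\<Sum>k<m. (J k)\<^sup>2) / m"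
      by (simp add: l2_norm_def L2_set_def sum_nonneg mv sum.distrib sum_divide_distrib add_divide_distrib)
    have B: "(\<Sum>i\<in>I. (cmod (z i))\<^sup>2) = (\<Sum>i\<in>I. (Re (z i))\<^sup>2) + (\<Sum>i\<in>I. (Im (z i))\<^sup>2)"
      by (simp add: cmod_power2 sum.distrib)
    define W where "W = (\<Sum>i\<in>I. weight b d i * cmod (z i))\<^sup>2"
    have 1: "\<bar>(\<Sum>k<m. (R k)\<^sup>2) / m - (\<Sum>i\<in>I. (Re (z i))\<^sup>2)\<bar> \<le> \<delta> / 2 * (\<Sum>i\<in>I. (Re (z i))\<^sup>2) + \<delta>\<^sup>2 / (2 * \<kappa>) * W"
      unfolding R_def W_def by (rule real_case[OF t]) (rule abs_Re_le_cmod)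
    have 2: "\<bar>(\<Sum>k<m. (J k)\<^sup>2) / m - (\<Sum>i\<in>I. (Im (z i))\<^sup>2)\<bar> \<le> \<delta> / 2 * (\<Sum>i\<in>I. (Im (z i))\<^sup>2) + \<delta>\<^sup>2 / (2 * \<kappa>) * W"
      unfolding J_def W_def by (rule real_case[OF t]) (rule abs_Im_le_cmod)
    have 3: "\<delta>\<^sup>2 / \<kappa> * W = \<delta>\<^sup>2 / (2 * \<kappa>) * W + \<delta>\<^sup>2 / (2 * \<kappa>) * W" by (simp add: field_simps)
    show ?thesis unfolding A B W_def[symmetric] 3 distrib_left using 1 2 by linarith
  qed
  from that[OF E(1,2) this] show ?thesis .
qed

section \<open>Consequences of the restricted isometry for the weighted LASSO\<close>

lemma quadratic_max:
  fixes a b r :: real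
  assumes "a > 0" shows "b * r - a * r\<^sup>2 \<le> b\<^sup>2 / (4 * a)"
proof -
  have "0 \<le> (b - 2 * a * r)\<^sup>2" by simp
  then have "4 * a * (b * r - a * r\<^sup>2) \<le> b\<^sup>2" by (simp add: power2_eq_square algebra_simps)
  then show ?thesis using assms by (simp add: pos_le_divide_eq mult.commute)
qed

lemma sqrt_sum_le: "0 \<le> a \<Longrightarrow> 0 \<le> b \<Longrightarrow> x\<^sup>2 \<le> a\<^sup>2 + b\<^sup>2 \<Longrightarrow> x \<le> a + b" for x :: real
  by (rule power2_le_imp_le) (auto simp: power2_sum intro: order_trans[of _ "a\<^sup>2 + b\<^sup>2"])

text \<open>For a vector \<open>v\<close> and a set \<open>S\<close>, the numbers \<open>p\<close>, \<open>v2\<close>, \<open>w\<close> stand for the Euclidean norms of \<open>v\<close> on \<open>S\<close>, of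
\<open>v\<close> and of \<open>A v\<close>, and \<open>a\<close>, \<open>b\<close> for the weighted \<open>l1\<close> norms of \<open>v\<close> on \<open>S\<close> and off \<open>S\<close>. In the first bound
the contribution of \<open>a\<close> is absorbed into the left side, since \<open>a\<close> is at most \<open>sqrt \<kappa> p\<close>.
That \<open>\<rho>\<close> is linear in \<open>\<delta>\<close> is the reason for \<open>\<delta>\<^sup>2\<close>, rather than \<open>\<delta>\<close>, in front of the weighted
norm.\<close>

lemma null_space_bounds:
  fixes \<delta> \<kappa> :: real
  assumes \<delta>: "0 < \<delta>" "\<delta> < 1 / 5" and \<kappa>: "\<kappa> > 0"
    and nn: "0 \<le> p" "p \<le> v2" "0 \<le> a" "0 \<le> b" "0 \<le> w"
    and rip: "v2\<^sup>2 - w\<^sup>2 \<le> \<delta> / 2 * v2\<^sup>2 + \<delta>\<^sup>2 / \<kappa> * (a + b)\<^sup>2"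
    and cs: "a \<le> sqrt \<kappa> * p"
  defines "\<rho> \<equiv> 4 * \<delta> / (1 - \<delta>)" and "\<tau> \<equiv> sqrt (1 + \<delta>) / (1 - \<delta>)"
  shows "p \<le> \<rho> * (b / sqrt \<kappa>) + \<tau> * w" "v2 \<le> (2 + \<rho>) * ((a + b) / sqrt \<kappa>) + \<tau> * w"
proof -
  have tau: "1 / sqrt (1 - \<delta>) \<le> \<tau>"
  proof -
    have "sqrt (1 - \<delta>) * sqrt (1 - \<delta>) = 1 - \<delta>" "sqrt (1 - \<delta>) > 0" using \<delta> by auto
    then have "1 / sqrt (1 - \<delta>) = sqrt (1 - \<delta>) / (1 - \<delta>)" using \<delta> by (simp add: frac_eq_eq)
    also have "\<dots> \<le> \<tau>" unfolding \<tau>_def using \<delta> by (intro divide_right_mono) auto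
    finally show ?thesis .
  qed
  define s where "s = sqrt \<kappa>"
  have s: "s > 0" "s\<^sup>2 = \<kappa>" using \<kappa> by (auto simp: s_def)
  define q where "q = b / s"
  have q: "q \<ge> 0" "b = s * q" using nn s by (auto simp: q_def)
  define u where "u = (a + b) / s"
  have u: "u \<ge> 0" "u \<le> p + q" using nn s cs[folded s_def] q by (auto simp: u_def field_simps)
  have ripu: "(1 - \<delta> / 2) * v2\<^sup>2 \<le> w\<^sup>2 + (\<delta> * u)\<^sup>2"
  proof -
    have "(\<delta> * u)\<^sup>2 = \<delta>\<^sup>2 / \<kappa> * (a + b)\<^sup>2" by (simp add: u_def power_divide power_mult_distrib s(2))
    then show ?thesis using rip by (simp add: left_diff_distrib)
  qed
  define g where "g = sqrt (1 - \<delta>)"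
  have g: "g > 0" "g\<^sup>2 = 1 - \<delta>" "g \<ge> 1 - \<delta>"
  proof -
    show "g > 0" "g\<^sup>2 = 1 - \<delta>" using \<delta> by (auto simp: g_def)
    have "(1 - \<delta>)\<^sup>2 \<le> 1 - \<delta>" using \<delta> by (simp add: power2_eq_square mult_left_le)
    then show "g \<ge> 1 - \<delta>" unfolding g_def by (rule real_le_rsqrt)
  qed
  have tw: "w / g \<le> \<tau> * w" using mult_right_mono[OF tau nn(5)] unfolding g_def[symmetric] by simp
  have rho: "4 * \<delta> / g \<le> \<rho>" unfolding \<rho>_def using g \<delta> by (intro divide_left_mono) auto
  have rho0: "\<rho> \<ge> 0" using \<delta> by (simp add: \<rho>_def)
  have "v2 * g \<le> w + \<delta> * u"
  proof (rule sqrt_sum_le)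
    have "(v2 * g)\<^sup>2 = (1 - \<delta>) * v2\<^sup>2" using g by (simp add: power_mult_distrib)
    also have "\<dots> \<le> (1 - \<delta> / 2) * v2\<^sup>2" using \<delta> by (intro mult_right_mono) auto
    finally show "(v2 * g)\<^sup>2 \<le> w\<^sup>2 + (\<delta> * u)\<^sup>2" using ripu by linarith
  qed (use nn u \<delta> in auto)
  then have "v2 \<le> w / g + \<delta> / g * u" using g by (simp add: field_simps)
  also have "\<delta> / g * u \<le> \<rho> * u"
  proof (rule mult_right_mono)
    have "\<delta> / g \<le> 4 * \<delta> / g" using \<delta> g by (intro divide_right_mono) auto
    then show "\<delta> / g \<le> \<rho>" using rho by linarith
  qed (rule u)
  also have "\<rho> * u \<le> (2 + \<rho>) * u" using u by (simp add: algebra_simps)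
  finally show "v2 \<le> (2 + \<rho>) * ((a + b) / sqrt \<kappa>) + \<tau> * w" using tw unfolding u_def s_def by linarith
  have "p * g \<le> w + 2 * \<delta> * q"
  proof (rule sqrt_sum_le)
    have "(1 - \<delta> / 2) * p\<^sup>2 \<le> (1 - \<delta> / 2) * v2\<^sup>2" using nn \<delta> by (intro mult_left_mono power_mono) auto
    also have "\<dots> \<le> w\<^sup>2 + \<delta>\<^sup>2 * u\<^sup>2" using ripu by (simp add: power_mult_distrib)
    also have "\<delta>\<^sup>2 * u\<^sup>2 \<le> \<delta>\<^sup>2 * (2 * p\<^sup>2 + 2 * q\<^sup>2)"
    proof (rule mult_left_mono)
      have "u\<^sup>2 \<le> (p + q)\<^sup>2" using u by (intro power_mono) auto
      also have "\<dots> \<le> 2 * p\<^sup>2 + 2 * q\<^sup>2" using zero_le_power2[of "p - q"] by (simp add: power2_eq_square algebra_simps)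
      finally show "u\<^sup>2 \<le> 2 * p\<^sup>2 + 2 * q\<^sup>2" .
    qed simp
    finally have "(1 - \<delta> / 2 - 2 * \<delta>\<^sup>2) * p\<^sup>2 \<le> w\<^sup>2 + 2 * \<delta>\<^sup>2 * q\<^sup>2" by (simp add: algebra_simps)
    moreover have "(1 - \<delta>) * p\<^sup>2 \<le> (1 - \<delta> / 2 - 2 * \<delta>\<^sup>2) * p\<^sup>2"
    proof (rule mult_right_mono)
      have "2 * \<delta> * \<delta> \<le> 2 * \<delta> * (1 / 5)" using \<delta> by (intro mult_left_mono) auto
      then show "1 - \<delta> \<le> 1 - \<delta> / 2 - 2 * \<delta>\<^sup>2" using \<delta> unfolding power2_eq_square by linarith
    qed simp
    moreover have "2 * \<delta>\<^sup>2 * q\<^sup>2 \<le> (2 * \<delta> * q)\<^sup>2" by (simp add: power_mult_distrib)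
    moreover have "(p * g)\<^sup>2 = (1 - \<delta>) * p\<^sup>2" using g by (simp add: power_mult_distrib)
    ultimately show "(p * g)\<^sup>2 \<le> w\<^sup>2 + (2 * \<delta> * q)\<^sup>2" by linarith
  qed (use nn q \<delta> in auto)
  then have "p \<le> w / g + 2 * \<delta> / g * q" using g by (simp add: field_simps)
  also have "2 * \<delta> / g * q \<le> \<rho> * q"
  proof (rule mult_right_mono)
    have "2 * \<delta> / g \<le> 4 * \<delta> / g" using \<delta> g by (intro divide_right_mono) auto
    then show "2 * \<delta> / g \<le> \<rho>" using rho by linarith
  qed (rule q)
  finally show "p \<le> \<rho> * (b / sqrt \<kappa>) + \<tau> * w" using tw unfolding q_def s_def by linarith
qed

text \<open>As in \<open>null_space_bounds\<close>, for the error \<open>v\<close> of the minimizer; \<open>r\<close> is its residual, \<open>\<epsilon>\<close> the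
size of the noise, \<open>\<sigma>\<close> the weighted norm of the true coefficients off \<open>S\<close>, and \<open>opt\<close> compares
the objective at the minimizer with that at the truth.\<close>

lemma lasso_bounds:
  fixes \<rho> \<tau> \<theta> \<kappa> \<epsilon> :: real
  assumes pos: "0 \<le> \<rho>" "\<rho> < 1" "0 \<le> \<tau>" "\<theta> > 0" "\<kappa> > 0" "\<epsilon> > 0"
    and nn: "0 \<le> b" "0 \<le> r" "w \<le> r + \<epsilon>"
    and nsp: "a \<le> sqrt \<kappa> * p" "p \<le> \<rho> * (b / sqrt \<kappa>) + \<tau> * w" "v2 \<le> (2 + \<rho>) * ((a + b) / sqrt \<kappa>) + \<tau> * w"
    and opt: "b - a + \<theta> * sqrt \<kappa> / \<epsilon> * r\<^sup>2 \<le> 2 * \<sigma> + \<theta> * sqrt \<kappa> / \<epsilon> * \<epsilon>\<^sup>2"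
  shows "a + b \<le> 2 * (1 + \<rho>) / (1 - \<rho>) * \<sigma> + 1 / (1 - \<rho>) * (\<tau>\<^sup>2 / ((1 + \<rho>) * \<theta>) + (1 + \<rho>) * \<theta> + 2 * \<tau>) * (sqrt \<kappa> * \<epsilon>)"
    and "v2 \<le> 2 * (1 + \<rho>) * (2 + \<rho>) / (1 - \<rho>) * (\<sigma> / sqrt \<kappa>) +
      1 / (1 - \<rho>) * ((5 + \<rho>)\<^sup>2 * \<tau>\<^sup>2 / (4 * (1 + \<rho>) * (2 + \<rho>) * \<theta>) + (1 + \<rho>) * (2 + \<rho>) * \<theta> + (5 + \<rho>) * \<tau>) * \<epsilon>"
proof -
  define s where "s = sqrt \<kappa>"
  have s: "s > 0" using pos by (simp add: s_def)
  define W where "W = r + \<epsilon>"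
  have W0: "W \<ge> 0" using nn pos by (simp add: W_def)
  have tw: "\<tau> * w \<le> \<tau> * W" using nn pos unfolding W_def by (intro mult_left_mono) auto
  define B where "B = 2 * \<sigma> / s + \<theta> * \<epsilon> - \<theta> / \<epsilon> * r\<^sup>2"
  have a: "a \<le> \<rho> * b + s * (\<tau> * W)"
  proof -
    have "a \<le> s * p" using nsp s_def by simp
    also have "\<dots> \<le> s * (\<rho> * (b / s) + \<tau> * W)" using nsp(2) tw s unfolding s_def[symmetric] by (intro mult_left_mono) auto
    also have "\<dots> = \<rho> * b + s * (\<tau> * W)" using s by (simp add: field_simps)
    finally show ?thesis .
  qed
  have ba: "b - a \<le> s * B"
  proof -
    have "s * B = 2 * \<sigma> + \<theta> * s * \<epsilon> - \<theta> * s / \<epsilon> * r\<^sup>2" using s by (simp add: B_def field_simps)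
    moreover have "\<theta> * s / \<epsilon> * \<epsilon>\<^sup>2 = \<theta> * s * \<epsilon>" using pos by (simp add: power2_eq_square)
    ultimately show ?thesis using opt unfolding s_def[symmetric] by linarith
  qed
  have b: "(1 - \<rho>) * b \<le> s * B + s * (\<tau> * W)" using a ba by (simp add: algebra_simps)
  \<comment> \<open>The coefficient 2 of \<open>\<tau> W\<close> is \<open>(1 + \<rho>) + (1 - \<rho>)\<close>.\<close>
  have l1: "(1 - \<rho>) * (a + b) \<le> s * ((1 + \<rho>) * B + 2 * \<tau> * W)"
  proof -
    have "(1 - \<rho>) * (a + b) \<le> (1 - \<rho>) * ((1 + \<rho>) * b + s * (\<tau> * W))"
      using a pos by (intro mult_left_mono) (auto simp: algebra_simps)
    also have "\<dots> = (1 + \<rho>) * ((1 - \<rho>) * b) + (1 - \<rho>) * (s * (\<tau> * W))" by (simp add: algebra_simps)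
    also have "\<dots> \<le> (1 + \<rho>) * (s * B + s * (\<tau> * W)) + (1 - \<rho>) * (s * (\<tau> * W))"
      using b pos by (intro add_right_mono mult_left_mono) auto
    finally show ?thesis by (simp add: algebra_simps)
  qed
  \<comment> \<open>The residual \<open>r\<close> is unknown: take the maximum over all \<open>r\<close>.\<close>
  have m1: "2 * \<tau> * r - (1 + \<rho>) * \<theta> / \<epsilon> * r\<^sup>2 \<le> \<tau>\<^sup>2 / ((1 + \<rho>) * \<theta>) * \<epsilon>"
  proof -
    have "2 * \<tau> * r - (1 + \<rho>) * \<theta> / \<epsilon> * r\<^sup>2 \<le> (2 * \<tau>)\<^sup>2 / (4 * ((1 + \<rho>) * \<theta> / \<epsilon>))"
      by (rule quadratic_max) (use pos in auto)
    also have "\<dots> = \<tau>\<^sup>2 / ((1 + \<rho>) * \<theta>) * \<epsilon>" using pos by (simp add: power_mult_distrib)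
    finally show ?thesis .
  qed
  have m2: "(5 + \<rho>) * \<tau> * r - (1 + \<rho>) * (2 + \<rho>) * \<theta> / \<epsilon> * r\<^sup>2 \<le> (5 + \<rho>)\<^sup>2 * \<tau>\<^sup>2 / (4 * (1 + \<rho>) * (2 + \<rho>) * \<theta>) * \<epsilon>"
  proof -
    have "(5 + \<rho>) * \<tau> * r - (1 + \<rho>) * (2 + \<rho>) * \<theta> / \<epsilon> * r\<^sup>2 \<le> ((5 + \<rho>) * \<tau>)\<^sup>2 / (4 * ((1 + \<rho>) * (2 + \<rho>) * \<theta> / \<epsilon>))"
      by (rule quadratic_max) (use pos in auto)
    also have "\<dots> = (5 + \<rho>)\<^sup>2 * \<tau>\<^sup>2 / (4 * (1 + \<rho>) * (2 + \<rho>) * \<theta>) * \<epsilon>"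
      unfolding power_mult_distrib by (simp add: mult.assoc)
    finally show ?thesis .
  qed
  have r1: "1 - \<rho> > 0" using pos by simp
  have gen: "v \<le> P / q * x + 1 / q * C * e" if "v \<le> (P * x + C * e) / q" for v P x C e q :: real
    using that by (simp add: add_divide_distrib)
  define C2 where "C2 = \<tau>\<^sup>2 / ((1 + \<rho>) * \<theta>) + (1 + \<rho>) * \<theta> + 2 * \<tau>"
  define C4 where "C4 = (5 + \<rho>)\<^sup>2 * \<tau>\<^sup>2 / (4 * (1 + \<rho>) * (2 + \<rho>) * \<theta>) + (1 + \<rho>) * (2 + \<rho>) * \<theta> + (5 + \<rho>) * \<tau>"
  have "(1 + \<rho>) * B + 2 * \<tau> * W = 2 * (1 + \<rho>) * (\<sigma> / s) + (1 + \<rho>) * \<theta> * \<epsilon> + 2 * \<tau> * \<epsilon> + (2 * \<tau> * r - (1 + \<rho>) * \<theta> / \<epsilon> * r\<^sup>2)"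
    by (simp add: B_def W_def algebra_simps add_divide_distrib)
  also have "\<dots> \<le> 2 * (1 + \<rho>) * (\<sigma> / s) + C2 * \<epsilon>" using m1 by (simp add: C2_def distrib_right)
  finally have "s * ((1 + \<rho>) * B + 2 * \<tau> * W) \<le> s * (2 * (1 + \<rho>) * (\<sigma> / s) + C2 * \<epsilon>)" using s by (intro mult_left_mono) auto
  also have "\<dots> = 2 * (1 + \<rho>) * \<sigma> + C2 * (s * \<epsilon>)" using s by (simp add: distrib_left)
  finally have "(1 - \<rho>) * (a + b) \<le> 2 * (1 + \<rho>) * \<sigma> + C2 * (s * \<epsilon>)" using l1 by linarith
  then have "a + b \<le> (2 * (1 + \<rho>) * \<sigma> + C2 * (s * \<epsilon>)) / (1 - \<rho>)" using r1 by (simp add: pos_le_divide_eq mult.commute)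
  then show "a + b \<le> 2 * (1 + \<rho>) / (1 - \<rho>) * \<sigma> + 1 / (1 - \<rho>) * (\<tau>\<^sup>2 / ((1 + \<rho>) * \<theta>) + (1 + \<rho>) * \<theta> + 2 * \<tau>) * (sqrt \<kappa> * \<epsilon>)"
    unfolding C2_def[symmetric] s_def[symmetric] by (rule gen)
  \<comment> \<open>The coefficient of \<open>\<tau> W\<close> becomes \<open>2 (2 + \<rho>) + (1 - \<rho>) = 5 + \<rho>\<close>.\<close>
  have "(1 - \<rho>) * v2 \<le> (1 - \<rho>) * ((2 + \<rho>) * ((a + b) / s) + \<tau> * W)"
    using nsp(3) tw r1 unfolding s_def[symmetric] by (intro mult_left_mono) auto
  also have "\<dots> = (2 + \<rho>) * ((1 - \<rho>) * (a + b) / s) + (1 - \<rho>) * (\<tau> * W)" by (simp add: algebra_simps)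
  also have "\<dots> \<le> (2 + \<rho>) * ((1 + \<rho>) * B + 2 * \<tau> * W) + (1 - \<rho>) * (\<tau> * W)"
    using l1 s pos by (intro add_right_mono mult_left_mono) (auto simp: divide_le_eq mult.commute)
  also have "\<dots> = 2 * (1 + \<rho>) * (2 + \<rho>) * (\<sigma> / s) + (1 + \<rho>) * (2 + \<rho>) * \<theta> * \<epsilon> + (5 + \<rho>) * \<tau> * \<epsilon>
      + ((5 + \<rho>) * \<tau> * r - (1 + \<rho>) * (2 + \<rho>) * \<theta> / \<epsilon> * r\<^sup>2)"
    by (simp add: B_def W_def algebra_simps add_divide_distrib)
  also have "\<dots> \<le> 2 * (1 + \<rho>) * (2 + \<rho>) * (\<sigma> / s) + C4 * \<epsilon>" using m2 by (simp add: C4_def distrib_right)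
  finally have "v2 \<le> (2 * (1 + \<rho>) * (2 + \<rho>) * (\<sigma> / s) + C4 * \<epsilon>) / (1 - \<rho>)" using r1 by (simp add: pos_le_divide_eq mult.commute)
  then show "v2 \<le> 2 * (1 + \<rho>) * (2 + \<rho>) / (1 - \<rho>) * (\<sigma> / sqrt \<kappa>) +
      1 / (1 - \<rho>) * ((5 + \<rho>)\<^sup>2 * \<tau>\<^sup>2 / (4 * (1 + \<rho>) * (2 + \<rho>) * \<theta>) + (1 + \<rho>) * (2 + \<rho>) * \<theta> + (5 + \<rho>) * \<tau>) * \<epsilon>"
    unfolding C4_def[symmetric] s_def[symmetric] by (rule gen)
qed

section \<open>Expansions in the uniform and the L2 norm\<close>

text \<open>Minkowski's inequality, from \<open>(p + q)\<^sup>2 \<le> (1 + B/A) p\<^sup>2 + (1 + A/B) q\<^sup>2\<close> with \<open>A\<close> and \<open>B\<close> the two norms,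
made positive by a small amount.\<close>

lemma L2_norm_triangle:
  fixes g h :: "'a \<Rightarrow> complex"
  assumes [measurable]: "g \<in> borel_measurable M" "h \<in> borel_measurable M"
    and g: "integrable M (\<lambda>x. (cmod (g x))\<^sup>2)" and h: "integrable M (\<lambda>x. (cmod (h x))\<^sup>2)"
  shows "L2_norm M (\<lambda>x. g x + h x) \<le> L2_norm M g + L2_norm M h"
proof (rule field_le_epsilon)
  fix e :: real assume e: "e > 0"
  define A where "A = L2_norm M g + e / 2"
  define B where "B = L2_norm M h + e / 2"
  have nn: "L2_norm M g \<ge> 0" "L2_norm M h \<ge> 0" unfolding L2_norm_def by auto
  have A: "A > 0" "(\<integral>x. (cmod (g x))\<^sup>2 \<partial>M) \<le> A\<^sup>2" and B: "B > 0" "(\<integral>x. (cmod (h x))\<^sup>2 \<partial>M) \<le> B\<^sup>2"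
  proof -
    show "A > 0" "B > 0" using nn e unfolding A_def B_def by auto
    have "(\<integral>x. (cmod (g x))\<^sup>2 \<partial>M) = (L2_norm M g)\<^sup>2" "(\<integral>x. (cmod (h x))\<^sup>2 \<partial>M) = (L2_norm M h)\<^sup>2"
      unfolding L2_norm_def by simp_all
    then show "(\<integral>x. (cmod (g x))\<^sup>2 \<partial>M) \<le> A\<^sup>2" "(\<integral>x. (cmod (h x))\<^sup>2 \<partial>M) \<le> B\<^sup>2"
      using nn e unfolding A_def B_def by (auto intro!: power_mono)
  qed
  have pt: "(cmod (g x + h x))\<^sup>2 \<le> (1 + B / A) * (cmod (g x))\<^sup>2 + (1 + A / B) * (cmod (h x))\<^sup>2" for x
  proof -
    have "(p + q)\<^sup>2 \<le> (1 + B / A) * p\<^sup>2 + (1 + A / B) * q\<^sup>2" for p q :: real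
    proof -
      have "0 \<le> (B * p - A * q)\<^sup>2 / (A * B)" using A B by simp
      also have "\<dots> = B / A * p\<^sup>2 + A / B * q\<^sup>2 - 2 * p * q"
        using A B by (simp add: field_simps power2_eq_square)
      finally show ?thesis by (simp add: power2_eq_square algebra_simps)
    qed
    moreover have "(cmod (g x + h x))\<^sup>2 \<le> (cmod (g x) + cmod (h x))\<^sup>2"
      by (intro power_mono norm_triangle_ineq) auto
    ultimately show ?thesis using order_trans by blast
  qed
  have "(\<integral>x. (cmod (g x + h x))\<^sup>2 \<partial>M) \<le> (\<integral>x. (1 + B / A) * (cmod (g x))\<^sup>2 + (1 + A / B) * (cmod (h x))\<^sup>2 \<partial>M)"
  proof (rule integral_mono')
    show "integrable M (\<lambda>x. (1 + B / A) * (cmod (g x))\<^sup>2 + (1 + A / B) * (cmod (h x))\<^sup>2)" using g h by auto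
  qed (use pt A B in auto)
  also have "\<dots> = (1 + B / A) * (\<integral>x. (cmod (g x))\<^sup>2 \<partial>M) + (1 + A / B) * (\<integral>x. (cmod (h x))\<^sup>2 \<partial>M)"
    using g h by simp
  also have "\<dots> \<le> (1 + B / A) * A\<^sup>2 + (1 + A / B) * B\<^sup>2"
    using A B by (intro add_mono mult_left_mono) auto
  also have "\<dots> = (A + B)\<^sup>2" using A B by (simp add: field_simps power2_eq_square)
  finally have "L2_norm M (\<lambda>x. g x + h x) \<le> sqrt ((A + B)\<^sup>2)" unfolding L2_norm_def by (rule real_sqrt_le_mono)
  then show "L2_norm M (\<lambda>x. g x + h x) \<le> L2_norm M g + L2_norm M h + e" using A B by (simp add: A_def B_def)
qed

lemma borel_measurable_expansion [measurable]: "expansion b d I z \<in> borel_measurable (nu b d)"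
  unfolding expansion_def[abs_def]
  by (intro borel_measurable_sum) measurable

lemma cmod_expansion_square:
  "(cmod (expansion b d I z t))\<^sup>2 = (\<Sum>i\<in>I. Re (z i) * phi b d i t)\<^sup>2 + (\<Sum>i\<in>I. Im (z i) * phi b d i t)\<^sup>2"
  by (simp add: cmod_power2 expansion_def)

lemma cmod_expansion_le:
  assumes "t \<in> space (nu b d)"
  shows "cmod (expansion b d I z t) \<le> (\<Sum>i\<in>I. weight b d i * cmod (z i))"
  unfolding expansion_def
proof (rule sum_norm_le)
  fix i
  have "cmod (z i) * \<bar>phi b d i t\<bar> \<le> cmod (z i) * weight b d i"
    unfolding weight_eq by (intro mult_left_mono phi_bound[OF assms]) auto
  then show "cmod (z i * complex_of_real (phi b d i t)) \<le> weight b d i * cmod (z i)"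
    by (simp add: norm_mult mult.commute)
qed

lemma integrable_expansion_square: "integrable (nu b d) (\<lambda>t. (cmod (expansion b d I z t))\<^sup>2)"
proof -
  interpret N: prob_space "nu b d" by (rule prob_space_nu)
  show ?thesis
    by (rule N.integrable_const_bound[of _ "(\<Sum>i\<in>I. weight b d i * cmod (z i))\<^sup>2"])
       (auto intro!: AE_I2 power_mono cmod_expansion_le)
qed

lemma L2_norm_expansion:
  assumes "finite I" "I \<subseteq> multi_idx d"
  shows "L2_norm (nu b d) (expansion b d I z) = sqrt (\<Sum>i\<in>I. (cmod (z i))\<^sup>2)"
proof -
  interpret N: prob_space "nu b d" by (rule prob_space_nu)
  have m: "(\<lambda>t. \<Sum>i\<in>I. c i * phi b d i t) \<in> borel_measurable (nu b d)" for c :: "_ \<Rightarrow> real"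
    by (intro borel_measurable_sum borel_measurable_times borel_measurable_const borel_measurable_phi)
  have i: "integrable (nu b d) (\<lambda>t. (\<Sum>i\<in>I. c i * phi b d i t)\<^sup>2)" for c :: "_ \<Rightarrow> real"
  proof (rule Bochner_Integration.integrable_bound[OF integrable_expansion_square[of b d I "\<lambda>i. of_real (c i)"]])
    show "(\<lambda>t. (\<Sum>i\<in>I. c i * phi b d i t)\<^sup>2) \<in> borel_measurable (nu b d)" by (intro borel_measurable_power m)
    show "AE t in nu b d. norm ((\<Sum>i\<in>I. c i * phi b d i t)\<^sup>2) \<le> norm ((cmod (expansion b d I (\<lambda>i. of_real (c i)) t))\<^sup>2)"
      by (simp add: cmod_expansion_square)
  qed
  show ?thesis unfolding L2_norm_def cmod_expansion_square
    by (subst Bochner_Integration.integral_add[OF i i]) (simp add: expansion_square_integral[OF assms] cmod_power2 sum.distrib)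
qed

lemma infinite_multi_idx: "1 \<le> d \<Longrightarrow> infinite (multi_idx d)"
proof -
  assume d: "1 \<le> d"
  have "inj (\<lambda>n. \<lambda>l\<in>{..<d}. n :: nat)"
    using d by (auto intro!: injI dest!: fun_cong[of _ _ 0])
  then have "infinite (range (\<lambda>n. \<lambda>l\<in>{..<d}. n :: nat))" by (rule range_inj_infinite)
  moreover have "range (\<lambda>n. \<lambda>l\<in>{..<d}. n :: nat) \<subseteq> multi_idx d"
    by (simp add: multi_idx_def image_subset_iff restrict_PiE_iff)
  ultimately show ?thesis using finite_subset by blast
qed

lemma L2_Linf_integrable:
  assumes "f \<in> L2_Linf (nu b d)" shows "integrable (nu b d) f"
proof -
  interpret N: prob_space "nu b d" by (rule prob_space_nu)
  have fin: "Linf_norm (nu b d) f < \<infinity>" and m: "f \<in> borel_measurable (nu b d)" using assms unfolding L2_Linf_def by auto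
  have "AE t in nu b d. ennreal (cmod (f t)) \<le> Linf_norm (nu b d) f" unfolding Linf_norm_def by (rule esssup_AE)
  then have "AE t in nu b d. norm (f t) \<le> enn2real (Linf_norm (nu b d) f)"
    by eventually_elim (use fin in \<open>metis enn2real_ennreal enn2real_mono norm_ge_zero infinity_ennreal_def\<close>)
  then show ?thesis using m by (rule N.integrable_const_bound)
qed

text \<open>The weighted coefficients are summable, so the expansion converges uniformly to some \<open>g\<close>, which
has the same coefficients as \<open>f\<close>. Completeness, applied to the real and the imaginary part of
\<open>f - g\<close>, gives \<open>f = g\<close> almost everywhere.\<close>

lemma expansion_represents:
  assumes d: "1 \<le> d" and f: "f \<in> L2_Linf (nu b d)"
    and R: "\<And>F. finite F \<Longrightarrow> F \<subseteq> multi_idx d \<Longrightarrow> (\<Sum>i\<in>F. weight b d i * cmod (coeff_seq b d f i)) \<le> R"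
  defines "e \<equiv> from_nat_into (multi_idx d)"
  shows "AE t in nu b d. (\<lambda>n. expansion b d (e ` {..<n}) (coeff_seq b d f) t) \<longlonglongrightarrow> f t"
proof -
  interpret N: prob_space "nu b d" by (rule prob_space_nu)
  let ?x = "coeff_seq b d f"
  have cnt: "countable (multi_idx d)" unfolding multi_idx_def by (intro countable_PiE) auto
  have bij: "bij_betw e UNIV (multi_idx d)" unfolding e_def by (rule bij_betw_from_nat_into[OF cnt infinite_multi_idx[OF d]])
  have inj: "inj e" and ran: "range e = multi_idx d" using bij by (auto simp: bij_betw_def)
  have ein: "e k \<in> multi_idx d" for k using ran by auto
  have fint: "integrable (nu b d) f" by (rule L2_Linf_integrable[OF f])
  have w0: "weight b d i \<ge> 0" for i by (simp add: weight_eq less_imp_le[OF tensor_weight_pos])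
  have summ: "summable (\<lambda>k. weight b d (e k) * cmod (?x (e k)))"
  proof (rule summableI_nonneg_bounded)
    show "0 \<le> weight b d (e k) * cmod (?x (e k))" for k using w0 by simp
    show "(\<Sum>k<n. weight b d (e k) * cmod (?x (e k))) \<le> R" for n
    proof -
      have "(\<Sum>k<n. weight b d (e k) * cmod (?x (e k))) = (\<Sum>i\<in>e ` {..<n}. weight b d i * cmod (?x i))"
        by (subst sum.reindex) (use inj in \<open>auto intro: inj_on_subset\<close>)
      also have "\<dots> \<le> R" by (rule R) (use ran in auto)
      finally show ?thesis .
    qed
  qed
  define T where "T k t = ?x (e k) * complex_of_real (phi b d (e k) t)" for k t
  have Tm: "T k \<in> borel_measurable (nu b d)" for k unfolding T_def[abs_def] by measurable
  have Tb: "norm (T k t) \<le> weight b d (e k) * cmod (?x (e k))" if "t \<in> space (nu b d)" for k t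
    using mult_left_mono[OF phi_bound[OF that, of "e k"], of "cmod (?x (e k))"]
    by (simp add: T_def norm_mult weight_eq mult.commute)
  have Ts: "summable (\<lambda>k. norm (T k t))" if "t \<in> space (nu b d)" for t
    by (rule summable_comparison_test[OF _ summ]) (use Tb[OF that] in auto)
  have partial: "expansion b d (e ` {..<n}) ?x t = (\<Sum>k<n. T k t)" for n t
    unfolding expansion_def T_def by (subst sum.reindex) (use inj in \<open>auto intro: inj_on_subset\<close>)
  define g where "g t = (\<Sum>k. T k t)" for t
  have lim: "(\<lambda>n. expansion b d (e ` {..<n}) ?x t) \<longlonglongrightarrow> g t" if "t \<in> space (nu b d)" for t
    unfolding partial g_def by (rule summable_LIMSEQ) (rule summable_norm_cancel[OF Ts[OF that]])
  have inner: "integrable (nu b d) (\<lambda>t. T k t * complex_of_real (phi b d j t))"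
    "(\<integral>t. T k t * complex_of_real (phi b d j t) \<partial>nu b d) = ?x (e k) * of_bool (e k = j)" if j: "j \<in> multi_idx d" for k j
  proof -
    have i: "integrable (nu b d) (\<lambda>t. phi b d (e k) t * phi b d j t)"
      by (rule N.integrable_const_bound[of _ "tensor_weight b d (e k) * tensor_weight b d j"])
         (auto intro!: AE_I2 mult_mono phi_bound less_imp_le[OF tensor_weight_pos] simp: abs_mult)
    have eq: "T k t * complex_of_real (phi b d j t) = ?x (e k) * complex_of_real (phi b d (e k) t * phi b d j t)" for t
      by (simp add: T_def)
    show "integrable (nu b d) (\<lambda>t. T k t * complex_of_real (phi b d j t))"
      unfolding eq by (intro Bochner_Integration.integrable_mult_right integrable_of_real i)
    show "(\<integral>t. T k t * complex_of_real (phi b d j t) \<partial>nu b d) = ?x (e k) * of_bool (e k = j)"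
      unfolding eq using phi_orthonormal[OF ein j, of b k] i
      by (simp only: Bochner_Integration.integral_mult_right_zero integral_complex_of_real) simp
  qed
  have inner_bound: "norm (T k t * complex_of_real (phi b d j t)) \<le> tensor_weight b d j * (weight b d (e k) * cmod (?x (e k)))"
    if "t \<in> space (nu b d)" for k j t
    using mult_mono[OF Tb[OF that, of k] phi_bound[OF that, of j]] w0 by (simp add: norm_mult mult.commute)
  have summ2: "summable (\<lambda>k. tensor_weight b d j * (weight b d (e k) * cmod (?x (e k))))" for j
    by (rule summable_mult[OF summ])
  have g_coeff: "integrable (nu b d) (\<lambda>t. g t * complex_of_real (phi b d j t))"
     "(\<integral>t. g t * complex_of_real (phi b d j t) \<partial>nu b d) = ?x j" if j: "j \<in> multi_idx d" for j
  proof -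
    have s1: "AE t in nu b d. summable (\<lambda>k. norm (T k t * complex_of_real (phi b d j t)))"
      by (intro AE_I2 summable_comparison_test[OF _ summ2[of j]]) (use inner_bound in auto)
    have s2: "summable (\<lambda>k. \<integral>t. norm (T k t * complex_of_real (phi b d j t)) \<partial>nu b d)"
    proof (rule summable_comparison_test[OF _ summ2[of j]], intro exI allI impI)
      fix k
      have "(\<integral>t. norm (T k t * complex_of_real (phi b d j t)) \<partial>nu b d) \<le> tensor_weight b d j * (weight b d (e k) * cmod (?x (e k)))"
        by (rule N.integral_le_const) (use inner[OF j] inner_bound in auto)
      then show "norm (\<integral>t. norm (T k t * complex_of_real (phi b d j t)) \<partial>nu b d) \<le> tensor_weight b d j * (weight b d (e k) * cmod (?x (e k)))"
        by simp
    qed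
    have gs: "(\<lambda>t. g t * complex_of_real (phi b d j t)) t = (\<Sum>k. T k t * complex_of_real (phi b d j t))" if "t \<in> space (nu b d)" for t
      unfolding g_def using summable_norm_cancel[OF Ts[OF that]] by (simp add: suminf_mult2)
    have "integrable (nu b d) (\<lambda>t. \<Sum>k. T k t * complex_of_real (phi b d j t))"
      by (rule integrable_suminf[OF inner(1)[OF j] s1 s2])
    then show "integrable (nu b d) (\<lambda>t. g t * complex_of_real (phi b d j t))"
      by (subst Bochner_Integration.integrable_cong[OF refl gs]) auto
    have "(\<integral>t. g t * complex_of_real (phi b d j t) \<partial>nu b d) = (\<integral>t. (\<Sum>k. T k t * complex_of_real (phi b d j t)) \<partial>nu b d)"
      by (rule Bochner_Integration.integral_cong[OF refl gs])
    also have "\<dots> = (\<Sum>k. \<integral>t. T k t * complex_of_real (phi b d j t) \<partial>nu b d)"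
      by (rule integral_suminf[OF inner(1)[OF j] s1 s2])
    also have "\<dots> = (\<Sum>k. ?x (e k) * of_bool (e k = j))" by (simp only: inner(2)[OF j])
    also have "\<dots> = ?x j"
    proof -
      have "j \<in> range e" unfolding ran by (rule j)
      then obtain k0 where k0: "e k0 = j" by auto
      have "(\<Sum>k. ?x (e k) * of_bool (e k = j)) = (\<Sum>k\<in>{k0}. ?x (e k) * of_bool (e k = j))"
        by (rule suminf_finite) (use inj k0 in \<open>auto simp: inj_def\<close>)
      then show ?thesis using k0 by simp
    qed
    finally show "(\<integral>t. g t * complex_of_real (phi b d j t) \<partial>nu b d) = ?x j" .
  qed
  define z where "z = (\<lambda>l\<in>{..<d}. 0 :: nat)"
  have z: "z \<in> multi_idx d" "phi b d z t = 1" for t by (auto simp: z_def multi_idx_def phi_def phi1_0)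
  have gint: "integrable (nu b d) g" using g_coeff(1)[OF z(1)] z(2) by simp
  define h where "h t = f t - g t" for t
  have hint: "integrable (nu b d) h" unfolding h_def[abs_def] using fint gint by simp
  have h0: "(\<integral>t. h t * complex_of_real (phi b d j t) \<partial>nu b d) = 0" and hi: "integrable (nu b d) (\<lambda>t. h t * complex_of_real (phi b d j t))"
    if j: "j \<in> multi_idx d" for j
  proof -
    have fi: "integrable (nu b d) (\<lambda>t. f t * complex_of_real (phi b d j t))"
    proof (rule Bochner_Integration.integrable_bound[of _ "\<lambda>t. tensor_weight b d j *\<^sub>R f t"])
      show "AE t in nu b d. norm (f t * complex_of_real (phi b d j t)) \<le> norm (tensor_weight b d j *\<^sub>R f t)"
        using mult_left_mono[OF phi_bound, of _ b d "cmod (f _)" j] tensor_weight_pos[of b d j]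
        by (intro AE_I2) (simp add: norm_mult mult.commute)
    qed (use fint in auto)
    then show "integrable (nu b d) (\<lambda>t. h t * complex_of_real (phi b d j t))"
      unfolding h_def left_diff_distrib using g_coeff(1)[OF j] by (rule Bochner_Integration.integrable_diff)
    show "(\<integral>t. h t * complex_of_real (phi b d j t) \<partial>nu b d) = 0"
      unfolding h_def left_diff_distrib using g_coeff[OF j] fi by (simp add: coeff_seq_def)
  qed
  have "AE t in nu b d. Re (h t) = 0"
  proof (rule phi_complete)
    show "integrable (nu b d) (\<lambda>t. Re (h t))" using hint by (rule integrable_Re)
    show "(\<integral>t. Re (h t) * phi b d j t \<partial>nu b d) = 0" if "j \<in> multi_idx d" for j
      using integral_Re[OF hi[OF that]] h0[OF that] by simp
  qed
  moreover have "AE t in nu b d. Im (h t) = 0"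
  proof (rule phi_complete)
    show "integrable (nu b d) (\<lambda>t. Im (h t))" using hint by (rule integrable_Im)
    show "(\<integral>t. Im (h t) * phi b d j t \<partial>nu b d) = 0" if "j \<in> multi_idx d" for j
      using integral_Im[OF hi[OF that]] h0[OF that] by simp
  qed
  ultimately have "AE t in nu b d. f t = g t"
    by eventually_elim (simp add: h_def complex_eq_iff)
  moreover have "AE t in nu b d. (\<lambda>n. expansion b d (e ` {..<n}) ?x t) \<longlonglongrightarrow> g t" using lim by (intro AE_I2)
  ultimately show ?thesis by eventually_elim simp
qed

text \<open>On the index set \<open>I\<close> the coefficient errors count, outside of it the coefficients themselves; the
essential supremum of a basis function is its weight.\<close>

lemma Linf_error_le:
  assumes d: "1 \<le> d" and f: "f \<in> L2_Linf (nu b d)" and I: "finite I" "I \<subseteq> multi_idx d"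
    and T: "\<And>F. finite F \<Longrightarrow> F \<subseteq> multi_idx d - I \<Longrightarrow> (\<Sum>i\<in>F. weight b d i * cmod (coeff_seq b d f i)) \<le> T"
  shows "Linf_norm (nu b d) (\<lambda>t. f t - expansion b d I z t) \<le> ennreal ((\<Sum>i\<in>I. weight b d i * cmod (z i - coeff_seq b d f i)) + T)"
proof -
  let ?x = "coeff_seq b d f"
  define e where "e = from_nat_into (multi_idx d)"
  have w0: "weight b d i \<ge> 0" for i by (simp add: weight_eq less_imp_le[OF tensor_weight_pos])
  have cnt: "countable (multi_idx d)" unfolding multi_idx_def by (intro countable_PiE) auto
  have ran: "range e = multi_idx d"
    using bij_betw_from_nat_into[OF cnt infinite_multi_idx[OF d]] by (auto simp: bij_betw_def e_def)
  have R: "(\<Sum>i\<in>F. weight b d i * cmod (?x i)) \<le> (\<Sum>i\<in>I. weight b d i * cmod (?x i)) + T" if F: "finite F" "F \<subseteq> multi_idx d" for F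
  proof -
    have "(\<Sum>i\<in>F. weight b d i * cmod (?x i)) = (\<Sum>i\<in>F \<inter> I. weight b d i * cmod (?x i)) + (\<Sum>i\<in>F - I. weight b d i * cmod (?x i))"
      using F(1) by (rule sum.Int_Diff)
    also have "\<dots> \<le> (\<Sum>i\<in>I. weight b d i * cmod (?x i)) + T"
      using F I w0 by (intro add_mono sum_mono2 T) auto
    finally show ?thesis .
  qed
  have "AE t in nu b d. (\<lambda>n. expansion b d (e ` {..<n}) ?x t) \<longlonglongrightarrow> f t"
    unfolding e_def by (rule expansion_represents[OF d f R])
  then have "AE t in nu b d. t \<in> space (nu b d) \<longrightarrow> cmod (f t - expansion b d I z t) \<le> (\<Sum>i\<in>I. weight b d i * cmod (z i - ?x i)) + T"
  proof eventually_elim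
    case (elim t)
    show ?case
    proof
      assume t: "t \<in> space (nu b d)"
      have "\<forall>i\<in>I. \<exists>k. e k = i"
      proof
        fix i assume "i \<in> I"
        then have "i \<in> range e" unfolding ran using I(2) by blast
        then show "\<exists>k. e k = i" by auto
      qed
      then obtain k where k: "\<And>i. i \<in> I \<Longrightarrow> e (k i) = i" by metis
      obtain N where N: "\<And>i. i \<in> I \<Longrightarrow> k i < N" using finite_nat_set_iff_bounded[of "k ` I"] I(1) by auto
      have bound: "cmod (expansion b d (e ` {..<n}) ?x t - expansion b d I z t) \<le> (\<Sum>i\<in>I. weight b d i * cmod (z i - ?x i)) + T"
        if n: "n \<ge> N" for n
      proof -
        have sub: "I \<subseteq> e ` {..<n}"
        proof
          fix i assume "i \<in> I"
          then show "i \<in> e ` {..<n}" using k[of i] N[of i] n by (intro image_eqI[of _ _ "k i"]) auto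
        qed
        have "expansion b d (e ` {..<n}) ?x t = expansion b d (e ` {..<n} - I) ?x t + expansion b d I ?x t"
          unfolding expansion_def by (rule sum.subset_diff[OF sub]) simp
        then have "expansion b d (e ` {..<n}) ?x t - expansion b d I z t = expansion b d (e ` {..<n} - I) ?x t + expansion b d I (\<lambda>i. ?x i - z i) t"
          by (simp add: expansion_def sum_subtractf algebra_simps)
        also have "cmod \<dots> \<le> cmod (expansion b d (e ` {..<n} - I) ?x t) + cmod (expansion b d I (\<lambda>i. ?x i - z i) t)"
          by (rule norm_triangle_ineq)
        also have "cmod (expansion b d (e ` {..<n} - I) ?x t) \<le> (\<Sum>i\<in>e ` {..<n} - I. weight b d i * cmod (?x i))"
          by (rule cmod_expansion_le[OF t])
        also have "\<dots> \<le> T" by (rule T) (use ran in auto)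
        also have "cmod (expansion b d I (\<lambda>i. ?x i - z i) t) \<le> (\<Sum>i\<in>I. weight b d i * cmod (z i - ?x i))"
          using cmod_expansion_le[OF t, of I "\<lambda>i. ?x i - z i"] by (simp add: norm_minus_commute)
        finally show ?thesis by simp
      qed
      have "(\<lambda>n. cmod (expansion b d (e ` {..<n}) ?x t - expansion b d I z t)) \<longlonglongrightarrow> cmod (f t - expansion b d I z t)"
        by (intro tendsto_intros elim)
      then show "cmod (f t - expansion b d I z t) \<le> (\<Sum>i\<in>I. weight b d i * cmod (z i - ?x i)) + T"
        by (rule LIMSEQ_le_const2) (use bound in auto)
    qed
  qed
  then have "AE t in nu b d. ennreal (cmod (f t - expansion b d I z t)) \<le> ennreal ((\<Sum>i\<in>I. weight b d i * cmod (z i - ?x i)) + T)"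
    by (rule AE_mp) (auto intro!: AE_I2 ennreal_leI)
  moreover have "f \<in> borel_measurable (nu b d)" using f by (simp add: L2_Linf_def)
  ultimately show ?thesis unfolding Linf_norm_def by (intro esssup_I) auto
qed

lemma L2_error_le:
  assumes f: "f \<in> L2_Linf (nu b d)" and I: "finite I" "I \<subseteq> multi_idx d"
  shows "L2_norm (nu b d) (\<lambda>t. f t - expansion b d I z t)
    \<le> sqrt (\<Sum>i\<in>I. (cmod (z i - coeff_seq b d f i))\<^sup>2) + L2_norm (nu b d) (\<lambda>t. f t - expansion b d I (coeff_seq b d f) t)"
proof -
  let ?x = "coeff_seq b d f"
  have fm [measurable]: "f \<in> borel_measurable (nu b d)" and fi: "integrable (nu b d) (\<lambda>t. (cmod (f t))\<^sup>2)"
    using f by (auto simp: L2_Linf_def)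
  have gi: "integrable (nu b d) (\<lambda>t. (cmod (f t - expansion b d I ?x t))\<^sup>2)"
  proof (rule Bochner_Integration.integrable_bound[of _ "\<lambda>t. 2 * (cmod (f t))\<^sup>2 + 2 * (cmod (expansion b d I ?x t))\<^sup>2"])
    show "integrable (nu b d) (\<lambda>t. 2 * (cmod (f t))\<^sup>2 + 2 * (cmod (expansion b d I ?x t))\<^sup>2)"
      using fi integrable_expansion_square by auto
    show "AE t in nu b d. norm ((cmod (f t - expansion b d I ?x t))\<^sup>2) \<le> norm (2 * (cmod (f t))\<^sup>2 + 2 * (cmod (expansion b d I ?x t))\<^sup>2)"
    proof (rule AE_I2)
      fix t
      have "(cmod (f t - expansion b d I ?x t))\<^sup>2 \<le> (cmod (f t) + cmod (expansion b d I ?x t))\<^sup>2"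
        by (intro power_mono norm_triangle_ineq4) auto
      also have "\<dots> \<le> 2 * (cmod (f t))\<^sup>2 + 2 * (cmod (expansion b d I ?x t))\<^sup>2"
        using sum_squares_bound[of "cmod (f t)" "cmod (expansion b d I ?x t)"] by (simp add: power2_sum)
      finally show "norm ((cmod (f t - expansion b d I ?x t))\<^sup>2) \<le> norm (2 * (cmod (f t))\<^sup>2 + 2 * (cmod (expansion b d I ?x t))\<^sup>2)"
        by simp
    qed
  qed simp
  have eq: "f t - expansion b d I z t = (f t - expansion b d I ?x t) + expansion b d I (\<lambda>i. ?x i - z i) t" for t
    by (simp add: expansion_def sum_subtractf algebra_simps)
  have "L2_norm (nu b d) (\<lambda>t. f t - expansion b d I z t)
     \<le> L2_norm (nu b d) (\<lambda>t. f t - expansion b d I ?x t) + L2_norm (nu b d) (expansion b d I (\<lambda>i. ?x i - z i))"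
    unfolding eq by (rule L2_norm_triangle[OF _ _ gi integrable_expansion_square]) auto
  then show ?thesis unfolding L2_norm_expansion[OF I] by (simp add: norm_minus_commute)
qed

section \<open>Recovery with high probability\<close>

text \<open>Bounds that hold for every competitor pass to the infimum in the definition of \<open>sigma_L\<close>, also when
it is infinite.\<close>

lemma le_affine_INF:
  fixes A B :: ennreal and w :: "'a \<Rightarrow> ennreal"
  assumes C: "C > 0" and le: "\<And>z. z \<in> Z \<Longrightarrow> A \<le> ennreal C * w z + B"
  shows "A \<le> ennreal C * (INF z\<in>Z. w z) + B"
proof (cases "B = top")
  case False
  have inv: "ennreal (1 / C) * ennreal C = 1" using C by (simp add: ennreal_mult[symmetric])
  have "ennreal (1 / C) * (A - B) \<le> (INF z\<in>Z. w z)"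
  proof (rule INF_greatest)
    fix z assume "z \<in> Z"
    then have "A - B \<le> ennreal C * w z" using le False by (simp add: ennreal_minus_le_iff add.commute)
    then have "ennreal (1 / C) * (A - B) \<le> ennreal (1 / C) * (ennreal C * w z)" by (intro mult_left_mono) auto
    then show "ennreal (1 / C) * (A - B) \<le> w z" unfolding mult.assoc[symmetric] inv by simp
  qed
  then have "ennreal C * (ennreal (1 / C) * (A - B)) \<le> ennreal C * (INF z\<in>Z. w z)" by (intro mult_left_mono) auto
  moreover have "ennreal C * (ennreal (1 / C) * (A - B)) = A - B"
    using inv by (simp add: mult.assoc[symmetric] mult.commute[of "ennreal C"])
  ultimately have "A - B \<le> ennreal C * (INF z\<in>Z. w z)" by simp
  then show ?thesis by (simp add: ennreal_minus_le_iff add.commute)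
qed simp

lemma wl1_norm_ge_sum:
  assumes "finite F" "F \<subseteq> multi_idx d" "wl1_norm b d z < \<infinity>"
  shows "(\<Sum>i\<in>F. weight b d i * cmod (z i)) \<le> enn2real (wl1_norm b d z)"
proof -
  have w0: "weight b d i \<ge> 0" for i by (simp add: weight_eq less_imp_le[OF tensor_weight_pos])
  have "ennreal (\<Sum>i\<in>F. weight b d i * cmod (z i)) = (\<Sum>\<^sub>\<infinity>i\<in>F. ennreal (weight b d i * cmod (z i)))"
    using assms(1) w0 by (simp add: sum_ennreal)
  also have "\<dots> \<le> wl1_norm b d z"
    unfolding wl1_norm_def by (rule infsum_mono_neutral) (use assms(2) in \<open>auto intro: nonneg_summable_on_complete\<close>)
  finally have "ennreal (\<Sum>i\<in>F. weight b d i * cmod (z i)) \<le> wl1_norm b d z" .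
  then have "enn2real (ennreal (\<Sum>i\<in>F. weight b d i * cmod (z i))) \<le> enn2real (wl1_norm b d z)"
    using assms(3) by (intro enn2real_mono) auto
  then show ?thesis using w0 by (simp add: sum_nonneg)
qed

text \<open>The scalar bounds of \<open>lasso_bounds\<close> for an actual minimizer. The competitor in the minimisation is
the true coefficient sequence cut off outside of the hyperbolic cross; its residual is, up to the sign, the noise
\<open>e\<close>.\<close>

lemma lasso_recovery:
  fixes b :: poly_family and d s m :: nat and \<delta> \<theta> :: real and e y :: "nat \<Rightarrow> complex"
    and A :: "nat \<Rightarrow> (nat \<Rightarrow> nat) \<Rightarrow> complex" and x xhat :: "(nat \<Rightarrow> nat) \<Rightarrow> complex"
  defines "I \<equiv> hyperbolic_cross d s" and "\<kappa> \<equiv> K b d s"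
  assumes s: "1 \<le> s" and \<delta>: "0 < \<delta>" "\<delta> < 1 / 5" and \<theta>: "\<theta> > 0"
    and rip: "\<And>z. \<bar>(l2_norm m (mat_vec I A z))\<^sup>2 - (\<Sum>i\<in>I. (cmod (z i))\<^sup>2)\<bar>
       \<le> \<delta> / 2 * (\<Sum>i\<in>I. (cmod (z i))\<^sup>2) + \<delta>\<^sup>2 / \<kappa> * (\<Sum>i\<in>I. weight b d i * cmod (z i))\<^sup>2"
    and e: "\<exists>k<m. e k \<noteq> 0" and y: "\<And>k. k < m \<Longrightarrow> y k = mat_vec I A x k + e k"
    and min: "wlasso_minimizer b d I m A y (\<theta> * sqrt \<kappa> / l2_norm m e) xhat"
    and S: "lower_set d S" "finite S" "card S \<le> s"
  defines "\<rho> \<equiv> 4 * \<delta> / (1 - \<delta>)" and "\<tau> \<equiv> sqrt (1 + \<delta>) / (1 - \<delta>)"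
    and "\<sigma> \<equiv> \<Sum>i\<in>I - S. weight b d i * cmod (x i)"
  shows "(\<Sum>i\<in>I. weight b d i * cmod (xhat i - x i)) \<le> 2 * (1 + \<rho>) / (1 - \<rho>) * \<sigma>
        + 1 / (1 - \<rho>) * (\<tau>\<^sup>2 / ((1 + \<rho>) * \<theta>) + (1 + \<rho>) * \<theta> + 2 * \<tau>) * (sqrt \<kappa> * l2_norm m e)" (is ?l1)
    and "sqrt (\<Sum>i\<in>I. (cmod (xhat i - x i))\<^sup>2) \<le> 2 * (1 + \<rho>) * (2 + \<rho>) / (1 - \<rho>) * (\<sigma> / sqrt \<kappa>)
        + 1 / (1 - \<rho>) * ((5 + \<rho>)\<^sup>2 * \<tau>\<^sup>2 / (4 * (1 + \<rho>) * (2 + \<rho>) * \<theta>) + (1 + \<rho>) * (2 + \<rho>) * \<theta> + (5 + \<rho>) * \<tau>) * l2_norm m e" (is ?l2)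
    and "l2_norm m e > 0"
proof -
  define v where "v i = xhat i - x i" for i
  define \<epsilon> where "\<epsilon> = l2_norm m e"
  have fI: "finite I" by (simp add: I_def hyperbolic_cross_finite)
  have SI: "S \<subseteq> I" unfolding I_def by (rule lower_set_subset_hyperbolic_cross[OF S])
  have w0: "weight b d i \<ge> 0" for i by (simp add: weight_eq less_imp_le[OF tensor_weight_pos])
  have \<kappa>: "\<kappa> \<ge> 1" unfolding \<kappa>_def using s by (rule K_ge_1)
  show \<epsilon>0: "l2_norm m e > 0"
  proof -
    have "l2_norm m e \<noteq> 0" unfolding l2_norm_def using e by (subst L2_set_eq_0_iff) auto
    moreover have "l2_norm m e \<ge> 0" by (simp add: l2_norm_def)
    ultimately show ?thesis by simp
  qed
  define p where "p = L2_set (\<lambda>i. cmod (v i)) S"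
  define v2 where "v2 = L2_set (\<lambda>i. cmod (v i)) I"
  define a where "a = (\<Sum>i\<in>S. weight b d i * cmod (v i))"
  define c where "c = (\<Sum>i\<in>I - S. weight b d i * cmod (v i))"
  define w where "w = l2_norm m (mat_vec I A v)"
  define r where "r = l2_norm m (\<lambda>k. mat_vec I A xhat k - y k)"
  have split: "(\<Sum>i\<in>I. f i) = (\<Sum>i\<in>S. f i) + (\<Sum>i\<in>I - S. f i)" for f :: "(nat \<Rightarrow> nat) \<Rightarrow> real"
    using sum.subset_diff[OF SI fI, of f] by simp
  have ac: "a + c = (\<Sum>i\<in>I. weight b d i * cmod (v i))" unfolding a_def c_def split ..
  have v22: "v2\<^sup>2 = (\<Sum>i\<in>I. (cmod (v i))\<^sup>2)" unfolding v2_def L2_set_def by (simp add: sum_nonneg)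
  have rho: "0 \<le> \<rho>" "\<rho> < 1" unfolding \<rho>_def using \<delta> by (auto simp: field_simps)
  have tau: "0 \<le> \<tau>" unfolding \<tau>_def using \<delta> by simp
  have cs: "a \<le> sqrt \<kappa> * p"
  proof -
    have "a = (\<Sum>i\<in>S. \<bar>weight b d i\<bar> * \<bar>cmod (v i)\<bar>)" unfolding a_def using w0 by simp
    also have "\<dots> \<le> L2_set (weight b d) S * p" unfolding p_def by (rule L2_set_mult_ineq)
    also have "L2_set (weight b d) S \<le> sqrt \<kappa>"
      unfolding L2_set_def \<kappa>_def using wcard_le_K[OF S, of b] by (simp add: wcard_def)
    finally show ?thesis by (simp add: mult_right_mono p_def)
  qed
  have pv: "p \<le> v2" unfolding p_def v2_def L2_set_def
    using fI SI by (intro real_sqrt_le_mono sum_mono2) auto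
  have nn: "0 \<le> p" "0 \<le> a" "0 \<le> c" "0 \<le> w" "0 \<le> r"
    unfolding p_def a_def c_def w_def r_def l2_norm_def using w0 by (auto intro!: sum_nonneg)
  have rip': "v2\<^sup>2 - w\<^sup>2 \<le> \<delta> / 2 * v2\<^sup>2 + \<delta>\<^sup>2 / \<kappa> * (a + c)\<^sup>2"
    using rip[of v] unfolding v22 ac w_def by linarith
  have \<kappa>0: "\<kappa> > 0" using \<kappa> by simp
  note nsp = null_space_bounds[OF \<delta> \<kappa>0 nn(1) pv nn(2,3,4) rip' cs, folded \<rho>_def \<tau>_def]
  have wr: "w \<le> r + \<epsilon>"
  proof -
    have eq: "cmod (mat_vec I A v k) \<le> cmod (mat_vec I A xhat k - y k) + cmod (e k)" if "k < m" for k
    proof -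
      have "mat_vec I A v k = (mat_vec I A xhat k - y k) + e k"
        using y[OF that] by (simp add: mat_vec_def v_def sum_subtractf right_diff_distrib)
      then show ?thesis using norm_triangle_ineq by metis
    qed
    have "w \<le> L2_set (\<lambda>k. cmod (mat_vec I A xhat k - y k) + cmod (e k)) {..<m}"
      unfolding w_def l2_norm_def using eq by (intro L2_set_mono) auto
    also have "\<dots> \<le> r + \<epsilon>" unfolding r_def \<epsilon>_def l2_norm_def by (rule L2_set_triangle_ineq)
    finally show ?thesis .
  qed
  have opt: "c - a + \<theta> * sqrt \<kappa> / \<epsilon> * r\<^sup>2 \<le> 2 * \<sigma> + \<theta> * sqrt \<kappa> / \<epsilon> * \<epsilon>\<^sup>2"
  proof -
    \<comment> \<open>feasible for the LASSO, which admits only sequences vanishing off \<open>I\<close>\<close>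
    define x0 where "x0 i = (if i \<in> I then x i else 0)" for i
    have mx0: "mat_vec I A x0 = mat_vec I A x"
      unfolding mat_vec_def x0_def by (auto intro!: ext sum.cong)
    have "l2_norm m (\<lambda>k. mat_vec I A x0 k - y k) = \<epsilon>"
      unfolding mx0 \<epsilon>_def l2_norm_def using y by (intro L2_set_cong) auto
    moreover have "(\<Sum>i\<in>I. weight b d i * cmod (xhat i)) + \<theta> * sqrt \<kappa> / \<epsilon> * r\<^sup>2
      \<le> (\<Sum>i\<in>I. weight b d i * cmod (x0 i)) + \<theta> * sqrt \<kappa> / \<epsilon> * (l2_norm m (\<lambda>k. mat_vec I A x0 k - y k))\<^sup>2"
    proof -
      have "\<forall>i. i \<notin> I \<longrightarrow> x0 i = 0" by (simp add: x0_def)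
      then show ?thesis using min
        unfolding wlasso_minimizer_def is_arg_min_def r_def \<epsilon>_def not_less[symmetric] by blast
    qed
    moreover have "(\<Sum>i\<in>I. weight b d i * cmod (x0 i)) = (\<Sum>i\<in>I. weight b d i * cmod (x i))"
      by (intro sum.cong) (auto simp: x0_def)
    ultimately have o: "(\<Sum>i\<in>I. weight b d i * cmod (xhat i)) + \<theta> * sqrt \<kappa> / \<epsilon> * r\<^sup>2
      \<le> (\<Sum>i\<in>I. weight b d i * cmod (x i)) + \<theta> * sqrt \<kappa> / \<epsilon> * \<epsilon>\<^sup>2" by simp
    have "(\<Sum>i\<in>S. weight b d i * cmod (x i)) - a \<le> (\<Sum>i\<in>S. weight b d i * cmod (xhat i))"
      unfolding a_def sum_subtractf[symmetric] right_diff_distrib[symmetric]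
    proof (intro sum_mono mult_left_mono w0)
      show "cmod (x i) - cmod (v i) \<le> cmod (xhat i)" for i
        using norm_triangle_ineq2[of "x i" "x i - xhat i"] by (simp add: v_def norm_minus_commute)
    qed
    moreover have "c - \<sigma> \<le> (\<Sum>i\<in>I - S. weight b d i * cmod (xhat i))"
      unfolding c_def \<sigma>_def sum_subtractf[symmetric] right_diff_distrib[symmetric]
    proof (intro sum_mono mult_left_mono w0)
      show "cmod (v i) - cmod (x i) \<le> cmod (xhat i)" for i
        using norm_triangle_ineq4[of "xhat i" "x i"] by (simp add: v_def)
    qed
    ultimately show ?thesis using o unfolding split \<sigma>_def by linarith
  qed
  have \<epsilon>1: "\<epsilon> > 0" using \<epsilon>0 by (simp add: \<epsilon>_def)
  note bounds = lasso_bounds[OF rho tau \<theta> \<kappa>0 \<epsilon>1 nn(3,5) wr cs nsp opt]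
  show ?l1 using bounds(1) unfolding ac v_def \<epsilon>_def .
  have "v2 = sqrt (\<Sum>i\<in>I. (cmod (xhat i - x i))\<^sup>2)" by (simp add: v2_def L2_set_def v_def)
  then show ?l2 using bounds(2) unfolding \<epsilon>_def by simp
qed

text \<open>For a competitor \<open>z'\<close> in \<open>sigma_L\<close>, let \<open>S\<close> be its support and \<open>R\<close> its distance to \<open>x\<close>. The
coefficients of \<open>f\<close> off \<open>S\<close>, inside and outside of the hyperbolic cross together, have weighted
norm at most \<open>R\<close>. The factor 2 between the constant of \<open>lasso_recovery\<close> and \<open>C3\<close>
pays for replacing \<open>1/sqrt \<kappa>\<close> by \<open>2/s\<^sup>\<gamma>\<^sup>/\<^sup>2\<close>.\<close>

lemma error_bounds:
  fixes b :: poly_family and d s m :: nat and \<delta> \<theta> :: real and e y :: "nat \<Rightarrow> complex"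
    and A :: "nat \<Rightarrow> (nat \<Rightarrow> nat) \<Rightarrow> complex" and xhat :: "(nat \<Rightarrow> nat) \<Rightarrow> complex"
  defines "I \<equiv> hyperbolic_cross d s" and "\<kappa> \<equiv> K b d s" and "\<gamma> \<equiv> gamma_exp b"
  assumes d: "1 \<le> d" and s: "2 \<le> s" "s \<le> 2 ^ (d + 1)" and \<delta>: "0 < \<delta>" "\<delta> < 1 / 5" and \<theta>: "\<theta> > 0"
    and rip: "\<And>z. \<bar>(l2_norm m (mat_vec I A z))\<^sup>2 - (\<Sum>i\<in>I. (cmod (z i))\<^sup>2)\<bar>
       \<le> \<delta> / 2 * (\<Sum>i\<in>I. (cmod (z i))\<^sup>2) + \<delta>\<^sup>2 / \<kappa> * (\<Sum>i\<in>I. weight b d i * cmod (z i))\<^sup>2"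
    and f: "f \<in> L2_Linf (nu b d)"
  defines "x \<equiv> coeff_seq b d f"
  assumes e: "\<exists>k<m. e k \<noteq> 0" and y: "\<And>k. k < m \<Longrightarrow> y k = mat_vec I A x k + e k"
    and min: "wlasso_minimizer b d I m A y (\<theta> * sqrt \<kappa> / l2_norm m e) xhat"
  defines "\<rho> \<equiv> 4 * \<delta> / (1 - \<delta>)" and "\<tau> \<equiv> sqrt (1 + \<delta>) / (1 - \<delta>)"
  defines "C1 \<equiv> (3 + \<rho>) / (1 - \<rho>)"
    and "C2 \<equiv> 1 / (1 - \<rho>) * (\<tau>\<^sup>2 / ((1 + \<rho>) * \<theta>) + (1 + \<rho>) * \<theta> + 2 * \<tau>)"
    and "C3 \<equiv> 4 * (1 + \<rho>) * (2 + \<rho>) / (1 - \<rho>)"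
    and "C4 \<equiv> 1 / (1 - \<rho>) * ((5 + \<rho>)\<^sup>2 * \<tau>\<^sup>2 / (4 * (1 + \<rho>) * (2 + \<rho>) * \<theta>) + (1 + \<rho>) * (2 + \<rho>) * \<theta> + (5 + \<rho>) * \<tau>)"
  shows "Linf_norm (nu b d) (\<lambda>t. f t - expansion b d I xhat t)
      \<le> ennreal C1 * sigma_L b d s x + ennreal (C2 * real s powr (\<gamma> / 2) * l2_norm m e)"
    and "ennreal (L2_norm (nu b d) (\<lambda>t. f t - expansion b d I xhat t))
      \<le> ennreal C3 * (sigma_L b d s x / ennreal (real s powr (\<gamma> / 2))) + ennreal (C4 * l2_norm m e)
        + ennreal (L2_norm (nu b d) (\<lambda>t. f t - expansion b d I x t))"
proof -
  have s1: "1 \<le> s" using s by simp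
  define G where "G = real s powr (\<gamma> / 2)"
  have G: "G > 0" "G\<^sup>2 = real s powr \<gamma>" using s unfolding G_def by (auto simp: power2_eq_square powr_add[symmetric])
  have \<kappa>: "\<kappa> \<ge> 1" unfolding \<kappa>_def using s1 by (rule K_ge_1)
  have \<kappa>u: "sqrt \<kappa> \<le> G"
    using K_le[OF s1, of b d] G unfolding \<kappa>_def \<gamma>_def by (intro real_le_lsqrt) auto
  have \<kappa>l: "1 / sqrt \<kappa> \<le> 2 / G"
  proof -
    have "(G / 2)\<^sup>2 \<le> \<kappa>" using K_ge[OF s, of b] G unfolding \<kappa>_def \<gamma>_def by (simp add: power_divide)
    then have "G / 2 \<le> sqrt \<kappa>" by (rule real_le_rsqrt)
    then have "1 / sqrt \<kappa> \<le> 1 / (G / 2)" using G \<kappa> by (intro divide_left_mono) (auto intro!: mult_pos_pos)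
    then show ?thesis by simp
  qed
  have rho: "0 \<le> \<rho>" "\<rho> < 1" unfolding \<rho>_def using \<delta> by (auto simp: field_simps)
  have tau: "0 \<le> \<tau>" unfolding \<tau>_def using \<delta> by simp
  have fI: "finite I" by (simp add: I_def hyperbolic_cross_finite)
  have subI: "I \<subseteq> multi_idx d" by (auto simp: I_def hyperbolic_cross_def)
  have w0: "weight b d i \<ge> 0" for i by (simp add: weight_eq less_imp_le[OF tensor_weight_pos])
  have C1: "C1 > 0" "C1 \<ge> 2 * (1 + \<rho>) / (1 - \<rho>)" "C1 \<ge> 1"
    unfolding C1_def using rho by (auto simp: divide_right_mono pos_le_divide_eq)
  have C2: "C2 \<ge> 0" unfolding C2_def using rho tau \<theta> by (intro mult_nonneg_nonneg add_nonneg_nonneg) auto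
  have C3: "C3 > 0" unfolding C3_def using rho by (intro divide_pos_pos mult_pos_pos) auto
  have C4: "C4 \<ge> 0" unfolding C4_def using rho tau \<theta> by (intro mult_nonneg_nonneg add_nonneg_nonneg divide_nonneg_nonneg) auto
  define Z where "Z = {z'. finite (supp d z') \<and> card (supp d z') \<le> s \<and> lower_set d (supp d z')}"
  define w where "w z' = wl1_norm b d (\<lambda>i. x i - z' i)" for z'
  have sig: "sigma_L b d s x = (INF z'\<in>Z. w z')" by (simp add: sigma_L_def Z_def w_def)
  define ee where "ee = l2_norm m e"
  have ee0: "ee \<ge> 0" by (simp add: ee_def l2_norm_def)
  have both: "Linf_norm (nu b d) (\<lambda>t. f t - expansion b d I xhat t) \<le> ennreal C1 * w z' + ennreal (C2 * G * ee)
    \<and> ennreal (L2_norm (nu b d) (\<lambda>t. f t - expansion b d I xhat t))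
      \<le> ennreal (C3 / G) * w z' + (ennreal (C4 * ee) + ennreal (L2_norm (nu b d) (\<lambda>t. f t - expansion b d I x t)))"
    if z': "z' \<in> Z" for z'
  proof (cases "w z' < \<infinity>")
    case False
    then have "w z' = \<infinity>" by (simp add: less_top[symmetric])
    then show ?thesis using C1 C3 G by (simp add: ennreal_mult_top)
  next
    case True
    define R where "R = enn2real (w z')"
    have wR: "w z' = ennreal R" using True by (simp add: R_def)
    have R0: "R \<ge> 0" by (simp add: R_def)
    define S where "S = supp d z'"
    have S: "lower_set d S" "finite S" "card S \<le> s" using z' by (auto simp: Z_def S_def)
    define \<sigma> where "\<sigma> = (\<Sum>i\<in>I - S. weight b d i * cmod (x i))"
    note rec = lasso_recovery[OF s1 \<delta> \<theta> rip[unfolded I_def \<kappa>_def] e y[unfolded I_def] min[unfolded I_def \<kappa>_def] S,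
        folded I_def \<kappa>_def, folded \<sigma>_def, folded \<rho>_def \<tau>_def]
    have l1: "(\<Sum>i\<in>I. weight b d i * cmod (xhat i - x i)) \<le> 2 * (1 + \<rho>) / (1 - \<rho>) * \<sigma> + C2 * (sqrt \<kappa> * ee)"
      using rec(1) unfolding C2_def ee_def .
    have l2: "sqrt (\<Sum>i\<in>I. (cmod (xhat i - x i))\<^sup>2) \<le> 2 * (1 + \<rho>) * (2 + \<rho>) / (1 - \<rho>) * (\<sigma> / sqrt \<kappa>) + C4 * ee"
      using rec(2) unfolding C4_def ee_def .
    have \<sigma>0: "\<sigma> \<ge> 0" unfolding \<sigma>_def using w0 by (intro sum_nonneg) auto
    have SI: "S \<subseteq> I" unfolding I_def by (rule lower_set_subset_hyperbolic_cross[OF S])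
    \<comment> \<open>\<open>z'\<close> vanishes on \<open>F\<close> and on \<open>I - S\<close>, which are disjoint.\<close>
    have tail: "(\<Sum>i\<in>F. weight b d i * cmod (x i)) \<le> R - \<sigma>" if F: "finite F" "F \<subseteq> multi_idx d - I" for F
    proof -
      have z0: "z' i = 0" if "i \<in> F \<union> (I - S)" for i
      proof -
        have "i \<in> multi_idx d" "i \<notin> S" using that F(2) SI subI by auto
        then show ?thesis unfolding S_def supp_def by simp
      qed
      have "(\<Sum>i\<in>F. weight b d i * cmod (x i)) + \<sigma> = (\<Sum>i\<in>F \<union> (I - S). weight b d i * cmod (x i))"
        unfolding \<sigma>_def using F fI by (subst sum.union_disjoint) auto
      also have "\<dots> = (\<Sum>i\<in>F \<union> (I - S). weight b d i * cmod (x i - z' i))"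
        by (intro sum.cong refl) (use z0 in simp)
      also have "\<dots> \<le> R" unfolding R_def w_def
        by (rule wl1_norm_ge_sum) (use F fI subI True in \<open>auto simp: w_def\<close>)
      finally show ?thesis by simp
    qed
    have \<sigma>R: "\<sigma> \<le> R" using tail[of "{}"] by simp
    have "(\<Sum>i\<in>I. weight b d i * cmod (xhat i - x i)) + (R - \<sigma>) \<le> C1 * R + C2 * G * ee"
    proof -
      have "2 * (1 + \<rho>) / (1 - \<rho>) * \<sigma> \<le> C1 * \<sigma>" using C1(2) \<sigma>0 by (rule mult_right_mono)
      moreover have "1 * (R - \<sigma>) \<le> C1 * (R - \<sigma>)" using C1(3) \<sigma>R by (intro mult_right_mono) auto
      moreover have "C2 * (sqrt \<kappa> * ee) \<le> C2 * (G * ee)" using \<kappa>u C2 ee0 by (intro mult_left_mono mult_right_mono) auto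
      ultimately show ?thesis using l1 by (simp add: algebra_simps)
    qed
    then have le: "ennreal ((\<Sum>i\<in>I. weight b d i * cmod (xhat i - x i)) + (R - \<sigma>)) \<le> ennreal (C1 * R + C2 * G * ee)"
      by (rule ennreal_leI)
    have "Linf_norm (nu b d) (\<lambda>t. f t - expansion b d I xhat t)
      \<le> ennreal ((\<Sum>i\<in>I. weight b d i * cmod (xhat i - x i)) + (R - \<sigma>))"
      unfolding x_def by (rule Linf_error_le[OF d f fI subI]) (use tail in \<open>simp add: x_def\<close>)
    also note le
    also have "ennreal (C1 * R + C2 * G * ee) = ennreal C1 * w z' + ennreal (C2 * G * ee)"
      unfolding wR using C1 R0 C2 G ee0 by (subst ennreal_plus) (auto simp: ennreal_mult)
    finally have part1: "Linf_norm (nu b d) (\<lambda>t. f t - expansion b d I xhat t) \<le> ennreal C1 * w z' + ennreal (C2 * G * ee)" .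
    define f2 where "f2 = L2_norm (nu b d) (\<lambda>t. f t - expansion b d I x t)"
    have f20: "f2 \<ge> 0" by (simp add: f2_def L2_norm_def)
    have "L2_norm (nu b d) (\<lambda>t. f t - expansion b d I xhat t) \<le> sqrt (\<Sum>i\<in>I. (cmod (xhat i - x i))\<^sup>2) + f2"
      unfolding x_def f2_def by (rule L2_error_le[OF f fI subI])
    also have "\<dots> \<le> C3 / G * R + C4 * ee + f2"
    proof -
      have "\<sigma> / sqrt \<kappa> \<le> R * (2 / G)"
        using mult_mono[OF \<sigma>R \<kappa>l] R0 \<kappa> by simp
      then have "2 * (1 + \<rho>) * (2 + \<rho>) / (1 - \<rho>) * (\<sigma> / sqrt \<kappa>) \<le> 2 * (1 + \<rho>) * (2 + \<rho>) / (1 - \<rho>) * (R * (2 / G))"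
        using rho by (intro mult_left_mono) auto
      also have "\<dots> = C3 / G * R" unfolding C3_def by simp
      finally show ?thesis using l2 by linarith
    qed
    finally have "ennreal (L2_norm (nu b d) (\<lambda>t. f t - expansion b d I xhat t)) \<le> ennreal (C3 / G * R + C4 * ee + f2)"
      by (rule ennreal_leI)
    also have "\<dots> = ennreal (C3 / G) * w z' + (ennreal (C4 * ee) + ennreal f2)"
    proof -
      have "ennreal (u * R + v + f2) = ennreal u * ennreal R + (ennreal v + ennreal f2)" if "0 \<le> u" "0 \<le> v" for u v
        using that R0 f20 by (simp add: ennreal_mult add.assoc)
      from this[of "C3 / G" "C4 * ee"] show ?thesis unfolding wR using C3 G C4 ee0 by simp
    qed
    finally show ?thesis using part1 unfolding f2_def by blast
  qed
  show "Linf_norm (nu b d) (\<lambda>t. f t - expansion b d I xhat t)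
      \<le> ennreal C1 * sigma_L b d s x + ennreal (C2 * real s powr (\<gamma> / 2) * l2_norm m e)"
    unfolding sig G_def[symmetric] ee_def[symmetric] by (rule le_affine_INF[OF C1(1)]) (use both in blast)
  have "ennreal (L2_norm (nu b d) (\<lambda>t. f t - expansion b d I xhat t))
      \<le> ennreal (C3 / G) * sigma_L b d s x + (ennreal (C4 * ee) + ennreal (L2_norm (nu b d) (\<lambda>t. f t - expansion b d I x t)))"
    unfolding sig by (rule le_affine_INF) (use both C3 G in auto)
  moreover have "ennreal (C3 / G) * sigma_L b d s x = ennreal C3 * (sigma_L b d s x / ennreal G)"
    using divide_ennreal[of C3 G] C3 G ennreal_divide_times[of "ennreal C3" "ennreal G"] by simp
  ultimately show "ennreal (L2_norm (nu b d) (\<lambda>t. f t - expansion b d I xhat t))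
      \<le> ennreal C3 * (sigma_L b d s x / ennreal (real s powr (\<gamma> / 2))) + ennreal (C4 * l2_norm m e)
        + ennreal (L2_norm (nu b d) (\<lambda>t. f t - expansion b d I x t))"
    unfolding G_def[symmetric] ee_def[symmetric] by (simp add: add.assoc)
qed

theorem theorem5p13:
  shows "\<exists>c::real. c > 0 \<and>
    (\<forall>(b::poly_family) (d::nat) (s::nat) (m::nat) (\<epsilon>::real) (\<delta>::real).
      let \<Lambda> = hyperbolic_cross d s; n = card \<Lambda>; \<gamma> = gamma_exp b;
          \<rho> = 4 * \<delta> / (1 - \<delta>); \<tau> = sqrt (1 + \<delta>) / (1 - \<delta>)
      in
        1 \<le> d \<longrightarrow> 0 < \<epsilon> \<longrightarrow> \<epsilon> < 1 \<longrightarrow> 0 < \<delta> \<longrightarrow> \<delta> < 1 / 5 \<longrightarrow> 2 \<le> s \<longrightarrow> s \<le> 2 ^ (d + 1) \<longrightarrow>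
        real m \<ge> c * real s powr \<gamma> * polylog (K b d s) n \<delta> \<epsilon> \<longrightarrow>
        (\<exists>E \<in> sets (PiM {..<m} (\<lambda>_. nu b d)).
          measure (PiM {..<m} (\<lambda>_. nu b d)) E \<ge> 1 - \<epsilon> \<and>
          (\<forall>t \<in> E. \<forall>f \<in> L2_Linf (nu b d). \<forall>(e::nat \<Rightarrow> complex) (y::nat \<Rightarrow> complex) (\<theta>::real)
              (xhat::(nat \<Rightarrow> nat) \<Rightarrow> complex).
            let A = design_matrix b d m t; x = coeff_seq b d f;
                f\<^sub>\<Lambda> = expansion b d \<Lambda> x; ftilde = expansion b d \<Lambda> xhat;
                C1 = (3 + \<rho>) / (1 - \<rho>);
                C2 = 1 / (1 - \<rho>) * (\<tau>\<^sup>2 / ((1 + \<rho>) * \<theta>) + (1 + \<rho>) * \<theta> + 2 * \<tau>);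
                C3 = 4 * (1 + \<rho>) * (2 + \<rho>) / (1 - \<rho>);
                C4 = 1 / (1 - \<rho>) * ((5 + \<rho>)\<^sup>2 * \<tau>\<^sup>2 / (4 * (1 + \<rho>) * (2 + \<rho>) * \<theta>)
                       + (1 + \<rho>) * (2 + \<rho>) * \<theta> + (5 + \<rho>) * \<tau>)
            in
              (\<exists>k<m. e k \<noteq> 0) \<longrightarrow>
              (\<forall>k<m. y k = mat_vec \<Lambda> A x k + e k) \<longrightarrow>
              \<theta> > 0 \<longrightarrow>
              wlasso_minimizer b d \<Lambda> m A y (\<theta> * sqrt (K b d s) / l2_norm m e) xhat \<longrightarrow>
              Linf_norm (nu b d) (\<lambda>t. f t - ftilde t)
                \<le> ennreal C1 * sigma_L b d s x + ennreal (C2 * real s powr (\<gamma> / 2) * l2_norm m e) \<and>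
              ennreal (L2_norm (nu b d) (\<lambda>t. f t - ftilde t))
                \<le> ennreal C3 * (sigma_L b d s x / ennreal (real s powr (\<gamma> / 2)))
                  + ennreal (C4 * l2_norm m e)
                  + ennreal (L2_norm (nu b d) (\<lambda>t. f t - f\<^sub>\<Lambda> t)))))"
  unfolding Let_def
proof (intro exI[of _ 4480000000] conjI allI impI, goal_cases)
  case 1
  show ?case by simp
next
  case (2 b d s m \<epsilon> \<delta>)
  note d = 2(1) and \<epsilon> = 2(2,3) and \<delta> = 2(4,5) and s = 2(6,7) and m = 2(8)
  let ?I = "hyperbolic_cross d s"
  let ?pl = "polylog (K b d s) (card ?I) \<delta> \<epsilon>"
  have K1: "K b d s \<ge> 1" using s by (intro K_ge_1) auto
  have "0 < 4480000000 * K b d s * ?pl"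
    by (rule sample_size_suffices(6)[OF K1 \<delta> \<epsilon> card_hyperbolic_cross_ge_2[OF d s(1)] order_refl])
  then have pl: "?pl > 0" using K1 by (simp add: zero_less_mult_iff)
  have "4480000000 * K b d s * ?pl \<le> 4480000000 * real s powr gamma_exp b * ?pl"
    using K_le[of s b d] s pl by (intro mult_right_mono mult_left_mono) auto
  then have m': "real m \<ge> 4480000000 * K b d s * ?pl" using m by linarith
  obtain E where E: "E \<in> sets (PiM {..<m} (\<lambda>_. nu b d))" "measure (PiM {..<m} (\<lambda>_. nu b d)) E \<ge> 1 - \<epsilon>"
    and rip: "\<And>t z. t \<in> E \<Longrightarrow> \<bar>(l2_norm m (mat_vec ?I (design_matrix b d m t) z))\<^sup>2 - (\<Sum>i\<in>?I. (cmod (z i))\<^sup>2)\<bar>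
     \<le> \<delta> / 2 * (\<Sum>i\<in>?I. (cmod (z i))\<^sup>2) + \<delta>\<^sup>2 / K b d s * (\<Sum>i\<in>?I. weight b d i * cmod (z i))\<^sup>2"
    by (rule sampling_RIP[OF d s(1) \<delta> \<epsilon> m'], rule that)
  show ?case
  proof (intro bexI[OF _ E(1)] conjI[OF E(2)] ballI allI impI, goal_cases)
    case (1 t f e y \<theta> xhat)
    note bounds = error_bounds[OF d s \<delta> 1(5) rip[OF 1(1)] 1(2) 1(3) 1(4)[rule_format] 1(6)]
    show ?case by (rule conjI[OF bounds])
  qed
qed

end
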